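(* Let $\mathcal{D}$ be a $k$-linear, Hom-finite triangulated category with a cluster-tilting object $T$ and a Serre functor. Let $M=U\oplus X$ be a basic $T[1]$-cluster tilting object in $\mathcal{D}$, where $X$ is indecomposable. Then the following hold. (1) If $X\in U\ast[T[1]]$, take a triangle $$Y\xrightarrow{g}U_1\xrightarrow{f}X\xrightarrow{h}Y[1],$$ where $f$ is a minimal right $(\mathrm{add}\,U)$-approximation. In this case, $Y$ is another complement to $U$ and $U\oplus Y>M$. (2) If $X\notin U\ast[T[1]]$, take a triangle $$X\xrightarrow{g}U_2\xrightarrow{f}Y\xrightarrow{h}X[1],$$ where $g$ is a minimal left $(\mathrm{add}\,U)$-approximation. In this case, $Y$ is another complement to $U$ and $U\oplus Y<M$.
   Context: Conventions: $k$ is an algebraically closed field; triangulated categories are Krull-Schmidt, with shift $[1]$. A Serre functor is a $k$-linear equivalence $\mathbb{S}:\mathcal{D}\to\mathcal{D}$ with bifunctorial isomorphisms $\mathrm{Hom}_{\mathcal{D}}(A,B)\simeq \mathrm{Hom}_k(\mathrm{Hom}_{\mathcal{D}}(B,\mathbb{S}A),k)$. For an object $M$, $\mathrm{add}\,M$ is the full subcategory of direct summands of finite direct sums of copies of $M$; $[M](X,Y)$ is the subgroup of $\mathrm{Hom}_{\mathcal{D}}(X,Y)$ of morphisms factoring through $\mathrm{add}\,M$; $|X|$ is the number of non-isomorphic indecomposable direct summands of $X$; basic means that the indecomposable summands are pairwise non-isomorphic. An object $T$ is cluster-tilting if $\mathrm{add}\,T=\{X\mid \mathrm{Hom}_{\mathcal{D}}(T,X[1])=0\}=\{X\mid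 \mathrm{Hom}_{\mathcal{D}}(X,T[1])=0\}$. An object $X$ is $T[1]$-rigid if $[T[1]](X,X[1])=0$; it is $T[1]$-cluster tilting (respectively almost $T[1]$-cluster tilting) if it is $T[1]$-rigid and $|X|=|T|$ (respectively $|X|=|T|-1$). A complement to a basic almost $T[1]$-cluster tilting object $U$ is an indecomposable object $Z$ such that $U\oplus Z$ is a basic $T[1]$-cluster tilting object; "another complement" means a complement not isomorphic to $X$. $M\ast[T[1]]$ is the full subcategory of all $Z\in\mathcal{D}$ admitting a triangle $M_Z\to Z\xrightarrow{\eta_Z} C_Z\to M_Z[1]$ with $M_Z\in\mathrm{add}\,M$ and $\eta_Z$ factoring through $\mathrm{add}\,T[1]$. For basic $T[1]$-cluster tilting objects $M,N$, write $M\geq N$ if $M\ast[T[1]]\supseteq N\ast[T[1]]$; this is a partial order on isomorphism classes, and $M>N$ means $M\ge N$ and $M\not\cong N$. A right $(\mathrm{add}\,U)$-approximation of $X$ is a morphism $f:U_1\to X$ with $U_1\in\mathrm{add}\,U$ through which every morphism from an object of $\mathrm{add}\,U$ to $X$ factors; it is minimal if every endomorphism $\varphi$ of $U_1$ with $f\varphi=f$ is an isomorphism. (Minimal) left approximations are dual. *)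

theory Defs
  imports "HOL-Computational_Algebra.Computational_Algebra"
begin

section \<open>Linear categories\<close>

text \<open>
  The objects of a category are all elements of the type \<open>'o\<close>. The Hom-spaces are subspaces
  of one ambient \<open>k\<close>-vector space \<open>'m\<close> (for instance the direct sum of all of them), so that the
  library's addition, zero, finite sums and \<open>module.span\<close> apply to morphisms. They
  have pairwise zero intersection, so a morphism other than \<open>0\<close> has one source and
  one target, and \<open>0\<close> serves as the zero morphism of every Hom-space. The field \<open>k\<close> is a type.
  \<open>g \<odot>\<^bsub>C\<^esub> f\<close> is \<open>g\<close> after \<open>f\<close>; it carries no information outside composable pairs.
\<close>

record ('k, 'o, 'm) klin_cat =
  scale :: "'k \<Rightarrow> 'm \<Rightarrow> 'm"
  hom :: "'o \<Rightarrow> 'o \<Rightarrow> 'm set"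
  comp :: "'m \<Rightarrow> 'm \<Rightarrow> 'm"  (infixl "\<odot>\<index>" 70)
  ident :: "'o \<Rightarrow> 'm"

locale k_linear_category =
  fixes C :: "('k::field, 'o, 'm::ab_group_add, 'z) klin_cat_scheme" (structure)
  assumes vector_space_scale: "vector_space (scale C)"
    and hom_subspace: "module.subspace (scale C) (hom C A B)"
    and hom_disjoint: "(A, B) \<noteq> (A', B') \<Longrightarrow> hom C A B \<inter> hom C A' B' = {0}"
    and ident_in_hom: "ident C A \<in> hom C A A"
    and comp_in_hom: "f \<in> hom C A B \<Longrightarrow> g \<in> hom C B E \<Longrightarrow> g \<odot> f \<in> hom C A E"
    and comp_assoc: "f \<in> hom C A B \<Longrightarrow> g \<in> hom C B E \<Longrightarrow> h \<in> hom C E F \<Longrightarrow>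
          (h \<odot> g) \<odot> f = h \<odot> (g \<odot> f)"
    and comp_ident_right: "f \<in> hom C A B \<Longrightarrow> f \<odot> ident C A = f"
    and comp_ident_left: "f \<in> hom C A B \<Longrightarrow> ident C B \<odot> f = f"
    and comp_add_left: "f \<in> hom C A B \<Longrightarrow> g \<in> hom C B E \<Longrightarrow> g' \<in> hom C B E \<Longrightarrow>
          (g + g') \<odot> f = g \<odot> f + g' \<odot> f"
    and comp_add_right: "f \<in> hom C A B \<Longrightarrow> f' \<in> hom C A B \<Longrightarrow> g \<in> hom C B E \<Longrightarrow>
          g \<odot> (f + f') = g \<odot> f + g \<odot> f'"
    and comp_scale_left: "f \<in> hom C A B \<Longrightarrow> g \<in> hom C B E \<Longrightarrow>
          scale C c g \<odot> f = scale C c (g \<odot> f)"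
    and comp_scale_right: "f \<in> hom C A B \<Longrightarrow> g \<in> hom C B E \<Longrightarrow>
          g \<odot> scale C c f = scale C c (g \<odot> f)"

definition hom_finite :: "('k::field, 'o, 'm::ab_group_add, 'z) klin_cat_scheme \<Rightarrow> bool" where
  "hom_finite C \<longleftrightarrow> (\<forall>A B. \<exists>S. finite S \<and> hom C A B = module.span (scale C) S)"

definition is_iso :: "('k, 'o, 'm, 'z) klin_cat_scheme \<Rightarrow> 'o \<Rightarrow> 'o \<Rightarrow> 'm \<Rightarrow> bool" where
  "is_iso C A B f \<longleftrightarrow> f \<in> hom C A B \<and>
     (\<exists>g \<in> hom C B A. g \<odot>\<^bsub>C\<^esub> f = ident C A \<and> f \<odot>\<^bsub>C\<^esub> g = ident C B)"

definition isomorphic :: "('k, 'o, 'm, 'z) klin_cat_scheme \<Rightarrow> 'o \<Rightarrow> 'o \<Rightarrow> bool" where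
  "isomorphic C A B \<longleftrightarrow> (\<exists>f. is_iso C A B f)"

definition zero_object :: "('k, 'o, 'm::zero, 'z) klin_cat_scheme \<Rightarrow> 'o \<Rightarrow> bool" where
  "zero_object C Z \<longleftrightarrow> (\<forall>A. hom C A Z = {0} \<and> hom C Z A = {0})"

text \<open>
  Direct sums are not chosen: \<open>is_direct_sum C Xs S\<close> says that \<open>S\<close> is a biproduct of
  the objects in the list \<open>Xs\<close>, for some injections and projections. For the empty list it says
  that \<open>S\<close> is a zero object.
\<close>

definition is_direct_sum ::
    "('k, 'o, 'm::comm_monoid_add, 'z) klin_cat_scheme \<Rightarrow> 'o list \<Rightarrow> 'o \<Rightarrow> bool" where
  "is_direct_sum C Xs S \<longleftrightarrow> (\<exists>\<iota> \<pi> :: nat \<Rightarrow> 'm.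
     (\<forall>i < length Xs. \<iota> i \<in> hom C (Xs ! i) S \<and> \<pi> i \<in> hom C S (Xs ! i)) \<and>
     (\<forall>i < length Xs. \<forall>j < length Xs.
        \<pi> j \<odot>\<^bsub>C\<^esub> \<iota> i = (if i = j then ident C (Xs ! i) else 0)) \<and>
     (\<Sum>i < length Xs. \<iota> i \<odot>\<^bsub>C\<^esub> \<pi> i) = ident C S)"

definition direct_summand ::
    "('k, 'o, 'm::comm_monoid_add, 'z) klin_cat_scheme \<Rightarrow> 'o \<Rightarrow> 'o \<Rightarrow> bool" where
  "direct_summand C A S \<longleftrightarrow> (\<exists>B. is_direct_sum C [A, B] S)"

definition indecomposable ::
    "('k, 'o, 'm::comm_monoid_add, 'z) klin_cat_scheme \<Rightarrow> 'o \<Rightarrow> bool" where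
  "indecomposable C X \<longleftrightarrow> \<not> zero_object C X \<and>
     (\<forall>A B. is_direct_sum C [A, B] X \<longrightarrow> zero_object C A \<or> zero_object C B)"

definition local_endo_ring ::
    "('k, 'o, 'm::comm_monoid_add, 'z) klin_cat_scheme \<Rightarrow> 'o \<Rightarrow> bool" where
  "local_endo_ring C X \<longleftrightarrow> ident C X \<noteq> 0 \<and>
     (\<forall>f \<in> hom C X X. \<forall>g \<in> hom C X X.
        \<not> is_iso C X X f \<longrightarrow> \<not> is_iso C X X g \<longrightarrow> \<not> is_iso C X X (f + g))"

definition krull_schmidt ::
    "('k, 'o, 'm::comm_monoid_add, 'z) klin_cat_scheme \<Rightarrow> bool" where
  "krull_schmidt C \<longleftrightarrow>
     (\<forall>X. \<exists>Xs. is_direct_sum C Xs X \<and> (\<forall>A \<in> set Xs. local_endo_ring C A))"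

definition basic :: "('k, 'o, 'm::comm_monoid_add, 'z) klin_cat_scheme \<Rightarrow> 'o \<Rightarrow> bool" where
  "basic C X \<longleftrightarrow> (\<forall>Xs. is_direct_sum C Xs X \<and> (\<forall>A \<in> set Xs. indecomposable C A) \<longrightarrow>
     (\<forall>i < length Xs. \<forall>j < length Xs. i \<noteq> j \<longrightarrow> \<not> isomorphic C (Xs ! i) (Xs ! j)))"

text \<open>\<open>|X|\<close>, counting isomorphism classes.\<close>

definition num_summands ::
    "('k, 'o, 'm::comm_monoid_add, 'z) klin_cat_scheme \<Rightarrow> 'o \<Rightarrow> nat" where
  "num_summands C X =
     card {{B. isomorphic C A B} | A. indecomposable C A \<and> direct_summand C A X}"

definition add_closure ::
    "('k, 'o, 'm::comm_monoid_add, 'z) klin_cat_scheme \<Rightarrow> 'o \<Rightarrow> 'o set" where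
  "add_closure C M = {X. \<exists>n S. is_direct_sum C (replicate n M) S \<and> direct_summand C X S}"

text \<open>\<open>[M](X, Y)\<close>.\<close>

definition factoring ::
    "('k, 'o, 'm::comm_monoid_add, 'z) klin_cat_scheme \<Rightarrow> 'o \<Rightarrow> 'o \<Rightarrow> 'o \<Rightarrow> 'm set" where
  "factoring C M X Y =
     {b \<odot>\<^bsub>C\<^esub> a | a b W. W \<in> add_closure C M \<and> a \<in> hom C X W \<and> b \<in> hom C W Y}"

definition right_approx ::
    "('k, 'o, 'm::comm_monoid_add, 'z) klin_cat_scheme \<Rightarrow> 'o \<Rightarrow> 'o \<Rightarrow> 'o \<Rightarrow> 'm \<Rightarrow> bool" where
  "right_approx C U U1 X f \<longleftrightarrow> U1 \<in> add_closure C U \<and> f \<in> hom C U1 X \<and>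
     (\<forall>V \<in> add_closure C U. \<forall>v \<in> hom C V X. \<exists>w \<in> hom C V U1. v = f \<odot>\<^bsub>C\<^esub> w)"

definition minimal_right_approx ::
    "('k, 'o, 'm::comm_monoid_add, 'z) klin_cat_scheme \<Rightarrow> 'o \<Rightarrow> 'o \<Rightarrow> 'o \<Rightarrow> 'm \<Rightarrow> bool" where
  "minimal_right_approx C U U1 X f \<longleftrightarrow> right_approx C U U1 X f \<and>
     (\<forall>\<phi> \<in> hom C U1 U1. f \<odot>\<^bsub>C\<^esub> \<phi> = f \<longrightarrow> is_iso C U1 U1 \<phi>)"

definition left_approx ::
    "('k, 'o, 'm::comm_monoid_add, 'z) klin_cat_scheme \<Rightarrow> 'o \<Rightarrow> 'o \<Rightarrow> 'o \<Rightarrow> 'm \<Rightarrow> bool" where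
  "left_approx C U X U2 g \<longleftrightarrow> U2 \<in> add_closure C U \<and> g \<in> hom C X U2 \<and>
     (\<forall>V \<in> add_closure C U. \<forall>v \<in> hom C X V. \<exists>w \<in> hom C U2 V. v = w \<odot>\<^bsub>C\<^esub> g)"

definition minimal_left_approx ::
    "('k, 'o, 'm::comm_monoid_add, 'z) klin_cat_scheme \<Rightarrow> 'o \<Rightarrow> 'o \<Rightarrow> 'o \<Rightarrow> 'm \<Rightarrow> bool" where
  "minimal_left_approx C U X U2 g \<longleftrightarrow> left_approx C U X U2 g \<and>
     (\<forall>\<phi> \<in> hom C U2 U2. \<phi> \<odot>\<^bsub>C\<^esub> g = g \<longrightarrow> is_iso C U2 U2 \<phi>)"


section \<open>Functors and Serre duality\<close>

text \<open>A functor is given by its action on objects and its action on morphisms.\<close>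

definition k_linear_endofunctor ::
    "('k, 'o, 'm::plus, 'z) klin_cat_scheme \<Rightarrow> ('o \<Rightarrow> 'o) \<Rightarrow> ('m \<Rightarrow> 'm) \<Rightarrow> bool" where
  "k_linear_endofunctor C F Fm \<longleftrightarrow>
     (\<forall>A B. \<forall>f \<in> hom C A B. Fm f \<in> hom C (F A) (F B)) \<and>
     (\<forall>A. Fm (ident C A) = ident C (F A)) \<and>
     (\<forall>A B E. \<forall>f \<in> hom C A B. \<forall>g \<in> hom C B E. Fm (g \<odot>\<^bsub>C\<^esub> f) = Fm g \<odot>\<^bsub>C\<^esub> Fm f) \<and>
     (\<forall>A B. \<forall>f \<in> hom C A B. \<forall>g \<in> hom C A B. Fm (f + g) = Fm f + Fm g) \<and>
     (\<forall>A B. \<forall>f \<in> hom C A B. \<forall>c. Fm (scale C c f) = scale C c (Fm f))"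

definition naturally_isomorphic_to_id ::
    "('k, 'o, 'm, 'z) klin_cat_scheme \<Rightarrow> ('o \<Rightarrow> 'o) \<Rightarrow> ('m \<Rightarrow> 'm) \<Rightarrow> bool" where
  "naturally_isomorphic_to_id C F Fm \<longleftrightarrow> (\<exists>\<alpha>.
     (\<forall>A. is_iso C (F A) A (\<alpha> A)) \<and>
     (\<forall>A B. \<forall>f \<in> hom C A B. f \<odot>\<^bsub>C\<^esub> \<alpha> A = \<alpha> B \<odot>\<^bsub>C\<^esub> Fm f))"

definition k_linear_autoequivalence ::
    "('k, 'o, 'm::plus, 'z) klin_cat_scheme \<Rightarrow> ('o \<Rightarrow> 'o) \<Rightarrow> ('m \<Rightarrow> 'm) \<Rightarrow> bool" where
  "k_linear_autoequivalence C F Fm \<longleftrightarrow> k_linear_endofunctor C F Fm \<and>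
     (\<exists>G Gm. k_linear_endofunctor C G Gm \<and>
        naturally_isomorphic_to_id C (G \<circ> F) (Gm \<circ> Fm) \<and>
        naturally_isomorphic_to_id C (F \<circ> G) (Fm \<circ> Gm))"

text \<open>
  \<open>Hom\<^sub>k(Hom(A, B), k)\<close>; functionals are normalised outside of \<open>Hom(A, B)\<close> so that equality of
  functionals is equality of functions.
\<close>

definition hom_dual ::
    "('k::field, 'o, 'm::ab_group_add, 'z) klin_cat_scheme \<Rightarrow> 'o \<Rightarrow> 'o \<Rightarrow> ('m \<Rightarrow> 'k) set" where
  "hom_dual C A B = {\<phi>.
     (\<forall>f \<in> hom C A B. \<forall>g \<in> hom C A B. \<phi> (f + g) = \<phi> f + \<phi> g) \<and>
     (\<forall>f \<in> hom C A B. \<forall>c. \<phi> (scale C c f) = c * \<phi> f) \<and>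
     (\<forall>f. f \<notin> hom C A B \<longrightarrow> \<phi> f = 0)}"

text \<open>
  \<open>\<eta> A B\<close> is the isomorphism from \<open>Hom(A, B)\<close> to the dual of \<open>Hom(B, S A)\<close>. The last condition
  is naturality in both variables at once, for \<open>a : A' \<rightarrow> A\<close> and \<open>b : B \<rightarrow> B'\<close>.
\<close>

definition serre_functor ::
    "('k::field, 'o, 'm::ab_group_add, 'z) klin_cat_scheme \<Rightarrow> ('o \<Rightarrow> 'o) \<Rightarrow> ('m \<Rightarrow> 'm) \<Rightarrow> bool" where
  "serre_functor C S Sm \<longleftrightarrow> k_linear_autoequivalence C S Sm \<and>
     (\<exists>\<eta> :: 'o \<Rightarrow> 'o \<Rightarrow> 'm \<Rightarrow> 'm \<Rightarrow> 'k.
        (\<forall>A B. bij_betw (\<eta> A B) (hom C A B) (hom_dual C B (S A))) \<and>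
        (\<forall>A B. \<forall>f \<in> hom C A B. \<forall>g \<in> hom C A B. \<forall>x.
           \<eta> A B (f + g) x = \<eta> A B f x + \<eta> A B g x) \<and>
        (\<forall>A B. \<forall>f \<in> hom C A B. \<forall>c x. \<eta> A B (scale C c f) x = c * \<eta> A B f x) \<and>
        (\<forall>A A' B B'. \<forall>a \<in> hom C A' A. \<forall>b \<in> hom C B B'. \<forall>f \<in> hom C A B. \<forall>x \<in> hom C B' (S A').
           \<eta> A' B' (b \<odot>\<^bsub>C\<^esub> f \<odot>\<^bsub>C\<^esub> a) x = \<eta> A B f (Sm a \<odot>\<^bsub>C\<^esub> x \<odot>\<^bsub>C\<^esub> b)))"


section \<open>Triangulated categories\<close>

text \<open>
  \<open>triangle D X Y Z f g h\<close> says that \<open>X \<rightarrow> Y \<rightarrow> Z \<rightarrow> X[1]\<close>, with maps \<open>f\<close>, \<open>g\<close>, \<open>h\<close>, is a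
  distinguished triangle. The shift is an autoequivalence, not necessarily an automorphism.
\<close>

record ('k, 'o, 'm) tri_cat = "('k, 'o, 'm) klin_cat" +
  shift :: "'o \<Rightarrow> 'o"
  shift_mor :: "'m \<Rightarrow> 'm"
  triangle :: "'o \<Rightarrow> 'o \<Rightarrow> 'o \<Rightarrow> 'm \<Rightarrow> 'm \<Rightarrow> 'm \<Rightarrow> bool"

locale k_linear_triangulated_category = k_linear_category D
  for D :: "('k::field, 'o, 'm::ab_group_add, 'z) tri_cat_scheme" (structure) +
  assumes zero_object_exists: "\<exists>Z. zero_object D Z"
    and direct_sum_exists: "\<exists>S. is_direct_sum D [A, B] S"
    and shift_autoequivalence: "k_linear_autoequivalence D (shift D) (shift_mor D)"
    and triangle_in_hom: "triangle D X Y Z f g h \<Longrightarrow>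
          f \<in> hom D X Y \<and> g \<in> hom D Y Z \<and> h \<in> hom D Z (shift D X)"
    and TR1_iso: "triangle D X Y Z f g h \<Longrightarrow>
          is_iso D X X' a \<Longrightarrow> is_iso D Y Y' b \<Longrightarrow> is_iso D Z Z' c \<Longrightarrow>
          f' \<in> hom D X' Y' \<Longrightarrow> g' \<in> hom D Y' Z' \<Longrightarrow> h' \<in> hom D Z' (shift D X') \<Longrightarrow>
          b \<odot> f = f' \<odot> a \<Longrightarrow> c \<odot> g = g' \<odot> b \<Longrightarrow> shift_mor D a \<odot> h = h' \<odot> c \<Longrightarrow>
          triangle D X' Y' Z' f' g' h'"
    and TR1_ident: "zero_object D Z \<Longrightarrow> triangle D X X Z (ident D X) 0 0"
    and TR1_cone: "f \<in> hom D X Y \<Longrightarrow> \<exists>Z g h. triangle D X Y Z f g h"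
    and TR2: "f \<in> hom D X Y \<Longrightarrow>
          triangle D X Y Z f g h \<longleftrightarrow> triangle D Y Z (shift D X) g h (- shift_mor D f)"
    and TR3: "triangle D X Y Z f g h \<Longrightarrow> triangle D X' Y' Z' f' g' h' \<Longrightarrow>
          a \<in> hom D X X' \<Longrightarrow> b \<in> hom D Y Y' \<Longrightarrow> b \<odot> f = f' \<odot> a \<Longrightarrow>
          \<exists>c \<in> hom D Z Z'. c \<odot> g = g' \<odot> b \<and> shift_mor D a \<odot> h = h' \<odot> c"
    and TR4: "triangle D X Y Z' f u v \<Longrightarrow> triangle D Y Z X' g p q \<Longrightarrow>
          triangle D X Z Y' (g \<odot> f) r s \<Longrightarrow>
          \<exists>a b. triangle D Z' Y' X' a b (shift_mor D u \<odot> q) \<and>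
            a \<odot> u = r \<odot> g \<and> s \<odot> a = v \<and> b \<odot> r = p \<and> q \<odot> b = shift_mor D f \<odot> s"


section \<open>Relative cluster tilting\<close>

definition cluster_tilting ::
    "('k, 'o, 'm::comm_monoid_add, 'z) tri_cat_scheme \<Rightarrow> 'o \<Rightarrow> bool" where
  "cluster_tilting D T \<longleftrightarrow>
     add_closure D T = {X. hom D T (shift D X) = {0}} \<and>
     add_closure D T = {X. hom D X (shift D T) = {0}}"

text \<open>\<open>rel_X D T\<close> renders the paper's prefix \<open>T[1]-\<close>.\<close>

definition rel_rigid ::
    "('k, 'o, 'm::comm_monoid_add, 'z) tri_cat_scheme \<Rightarrow> 'o \<Rightarrow> 'o \<Rightarrow> bool" where
  "rel_rigid D T X \<longleftrightarrow> factoring D (shift D T) X (shift D X) = {0}"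

definition rel_cluster_tilting ::
    "('k, 'o, 'm::comm_monoid_add, 'z) tri_cat_scheme \<Rightarrow> 'o \<Rightarrow> 'o \<Rightarrow> bool" where
  "rel_cluster_tilting D T X \<longleftrightarrow> rel_rigid D T X \<and> num_summands D X = num_summands D T"

definition almost_rel_cluster_tilting ::
    "('k, 'o, 'm::comm_monoid_add, 'z) tri_cat_scheme \<Rightarrow> 'o \<Rightarrow> 'o \<Rightarrow> bool" where
  "almost_rel_cluster_tilting D T X \<longleftrightarrow>
     rel_rigid D T X \<and> num_summands D X + 1 = num_summands D T"

definition is_complement ::
    "('k, 'o, 'm::comm_monoid_add, 'z) tri_cat_scheme \<Rightarrow> 'o \<Rightarrow> 'o \<Rightarrow> 'o \<Rightarrow> bool" where
  "is_complement D T U Z \<longleftrightarrow>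
     basic D U \<and> almost_rel_cluster_tilting D T U \<and> indecomposable D Z \<and>
     (\<exists>N. is_direct_sum D [U, Z] N \<and> basic D N \<and> rel_cluster_tilting D T N)"

text \<open>\<open>M \<ast> [T[1]]\<close>, given by its objects.\<close>

definition rel_star ::
    "('k, 'o, 'm::comm_monoid_add, 'z) tri_cat_scheme \<Rightarrow> 'o \<Rightarrow> 'o \<Rightarrow> 'o set" where
  "rel_star D T M = {Z. \<exists>M\<^sub>Z C\<^sub>Z m \<eta> c. triangle D M\<^sub>Z Z C\<^sub>Z m \<eta> c \<and>
     M\<^sub>Z \<in> add_closure D M \<and> \<eta> \<in> factoring D (shift D T) Z C\<^sub>Z}"

definition rel_ge ::
    "('k, 'o, 'm::comm_monoid_add, 'z) tri_cat_scheme \<Rightarrow> 'o \<Rightarrow> 'o \<Rightarrow> 'o \<Rightarrow> bool" where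
  "rel_ge D T M N \<longleftrightarrow> rel_star D T M \<supseteq> rel_star D T N"

definition rel_gt ::
    "('k, 'o, 'm::comm_monoid_add, 'z) tri_cat_scheme \<Rightarrow> 'o \<Rightarrow> 'o \<Rightarrow> 'o \<Rightarrow> bool" where
  "rel_gt D T M N \<longleftrightarrow> rel_ge D T M N \<and> \<not> isomorphic D M N"

end

theory Submission
  imports Defs "HOL-Library.Function_Algebras"
begin

text \<open>
  Call a morphism ghost if it vanishes on all morphisms from \<open>T\<close>; these are the morphisms factoring
  through \<open>add T[1]\<close>, and \<open>Z \<in> M * [T[1]]\<close> means that every \<open>T \<rightarrow> Z\<close> factors through \<open>add M\<close>.
  If the last map \<open>h\<close> of the exchange triangle is ghost, then rigidity of \<open>U \<oplus> Y\<close> is a diagram chase, and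
  \<open>Y\<close> is indecomposable because an endomorphism of \<open>Y\<close> extends to the triangle and, by minimality of
  the approximation, is invertible as soon as the induced endomorphism of \<open>X\<close> is.

  In (1), \<open>h\<close> is ghost directly. In (2), let \<open>T \<rightarrow> B \<rightarrow> M' \<rightarrow> T[1]\<close> be the triangle of a right
  \<open>add M\<close>-approximation of \<open>T[1]\<close>. Then \<open>M \<oplus> B\<close> is rigid, so \<open>B \<in> add M\<close> because a rigid object
  has at most \<open>|T|\<close> indecomposable summands. As \<open>X \<notin> U * [T[1]]\<close>, \<open>X\<close> is a summand of \<open>B\<close>, hence not of
  \<open>M'\<close> if the latter is chosen minimal. So every \<open>X \<rightarrow> T[1]\<close> factors through \<open>U\<^sub>2\<close>, and Serre duality
  with \<open>S T \<in> add T[2]\<close> turns this into \<open>h\<close> being ghost.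

  The bound \<open>|M| \<le> |T|\<close> holds because, after enlarging \<open>M\<close>, every summand of \<open>T\<close> has a coresolution
  \<open>T' \<rightarrow> B \<rightarrow> M' \<rightarrow> T'[1]\<close> in \<open>add M\<close>, and the differences \<open>[B] - [M']\<close> generate the split
  Grothendieck group of \<open>add M\<close>.
\<close>

section \<open>Linear categories\<close>

text \<open>The two cases are not dual to each other. A right approximation controls maps into
  \<open>X\<close>, in particular those that come from \<open>T\<close>; a left approximation
  controls maps out of \<open>X\<close>, whereas being ghost is tested on maps from
  \<open>T\<close>. Serre duality bridges this gap: Hom(T, X[1]) is dual to Hom(X[1], S T), and S T
  is a double shift of an object of add T.

  The bound on the number of summands is a rank argument. For rigid \<open>P\<close>, every
  composite M' -> C[1] -> B with \<open>C\<close> in add T, \<open>M'\<close> in add P and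
  \<open>B\<close> in add P[1] vanishes. This splits the pushouts of coresolutions, so the
  difference [B] - [M'] depends only on \<open>C\<close> and is additive in \<open>C\<close>.
  Enlarging \<open>M\<close> is necessary because for a merely rigid \<open>M\<close> the middle
  term of a coresolution need not lie in add M.

  Uniqueness of decompositions enters through a numerical invariant that is additive on direct sums:
  the dimension of Hom(Z, -) minus that of its radical. Linear independence over the reals then
  counts summands.\<close>

context k_linear_category
begin

sublocale vs: vector_space "scale C"
  by (rule vector_space_scale)

lemma zero_in_hom [simp]: "0 \<in> hom C A B"
  using hom_subspace vs.subspace_0 by blast

lemma add_in_hom: "f \<in> hom C A B \<Longrightarrow> g \<in> hom C A B \<Longrightarrow> f + g \<in> hom C A B"
  using hom_subspace vs.subspace_add by blast

lemma scale_in_hom: "f \<in> hom C A B \<Longrightarrow> scale C c f \<in> hom C A B"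
  using hom_subspace vs.subspace_scale by blast

lemma neg_in_hom: "f \<in> hom C A B \<Longrightarrow> - f \<in> hom C A B"
  using hom_subspace vs.subspace_neg by blast

lemma diff_in_hom: "f \<in> hom C A B \<Longrightarrow> g \<in> hom C A B \<Longrightarrow> f - g \<in> hom C A B"
  using hom_subspace vs.subspace_diff by blast

lemma sum_in_hom: "(\<And>i. i \<in> I \<Longrightarrow> f i \<in> hom C A B) \<Longrightarrow> sum f I \<in> hom C A B"
  using hom_subspace vs.subspace_sum by blast

lemmas hom_intros = zero_in_hom ident_in_hom comp_in_hom add_in_hom scale_in_hom neg_in_hom diff_in_hom

lemma comp_zero_left [simp]:
  assumes "f \<in> hom C A B"
  shows "0 \<odot> f = 0"
  using comp_add_left[OF assms, of 0 A 0] by simp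

lemma comp_zero_right [simp]:
  assumes "g \<in> hom C B E"
  shows "g \<odot> 0 = 0"
  using comp_add_right[OF _ _ assms, of 0 B 0] by simp

lemma comp_neg_left: "f \<in> hom C A B \<Longrightarrow> g \<in> hom C B E \<Longrightarrow> (- g) \<odot> f = - (g \<odot> f)"
  using comp_add_left[of f A B g E "- g"] by (simp add: neg_in_hom eq_neg_iff_add_eq_0 add.commute)

lemma comp_neg_right: "f \<in> hom C A B \<Longrightarrow> g \<in> hom C B E \<Longrightarrow> g \<odot> (- f) = - (g \<odot> f)"
  using comp_add_right[of f A B "- f" g E] by (simp add: neg_in_hom eq_neg_iff_add_eq_0 add.commute)

lemma comp_diff_left:
  "f \<in> hom C A B \<Longrightarrow> g \<in> hom C B E \<Longrightarrow> g' \<in> hom C B E \<Longrightarrow> (g - g') \<odot> f = g \<odot> f - g' \<odot> f"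
  using comp_add_left[of f A B g E "- g'"] by (simp add: neg_in_hom comp_neg_left)

lemma comp_diff_right:
  "f \<in> hom C A B \<Longrightarrow> f' \<in> hom C A B \<Longrightarrow> g \<in> hom C B E \<Longrightarrow> g \<odot> (f - f') = g \<odot> f - g \<odot> f'"
  using comp_add_right[of f A B "- f'" g E] by (simp add: neg_in_hom comp_neg_right)

lemma comp_ident_diff:
  assumes "g \<in> hom C A B" "e \<in> hom C A A" "u \<in> hom C B B" "u \<odot> g = g \<odot> e"
  shows "(ident C B - u) \<odot> g = g \<odot> (ident C A - e)"
  using comp_diff_left[OF assms(1) ident_in_hom assms(3)] comp_diff_right[OF ident_in_hom assms(2,1)]
    comp_ident_left[OF assms(1)] comp_ident_right[OF assms(1)] assms(4) by simp

lemma comp_sum_left: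
  assumes "f \<in> hom C A B" "\<And>i. i \<in> I \<Longrightarrow> g i \<in> hom C B E"
  shows "sum g I \<odot> f = (\<Sum>i\<in>I. g i \<odot> f)"
  using assms(2)
proof (induction I rule: infinite_finite_induct)
  case (insert x F)
  then show ?case using comp_add_left[OF assms(1), of "g x" E "sum g F"] by (simp add: sum_in_hom)
qed (use assms(1) in auto)

lemma comp_sum_right:
  assumes "g \<in> hom C B E" "\<And>i. i \<in> I \<Longrightarrow> f i \<in> hom C A B"
  shows "g \<odot> sum f I = (\<Sum>i\<in>I. g \<odot> f i)"
  using assms(2)
proof (induction I rule: infinite_finite_induct)
  case (insert x F)
  then show ?case using comp_add_right[of "f x" A B "sum f F" g E] assms(1) by (simp add: sum_in_hom)
qed (use assms(1) in auto)

lemma is_isoI: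
  "f \<in> hom C A B \<Longrightarrow> g \<in> hom C B A \<Longrightarrow> g \<odot> f = ident C A \<Longrightarrow> f \<odot> g = ident C B \<Longrightarrow> is_iso C A B f"
  unfolding is_iso_def by blast

lemma is_isoE:
  assumes "is_iso C A B f"
  obtains g where "f \<in> hom C A B" "g \<in> hom C B A" "g \<odot> f = ident C A" "f \<odot> g = ident C B"
    "is_iso C B A g"
  using assms unfolding is_iso_def by blast

lemma is_iso_hom: "is_iso C A B f \<Longrightarrow> f \<in> hom C A B"
  unfolding is_iso_def by blast

lemma is_iso_ident: "is_iso C A A (ident C A)"
  by (rule is_isoI) (auto simp: ident_in_hom intro: comp_ident_left[OF ident_in_hom])

lemma comp_inner_cancel:
  assumes "f \<in> hom C A B" "g \<in> hom C B E" "g' \<in> hom C E B" "f' \<in> hom C B A'" "g' \<odot> g = ident C B"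
  shows "(f' \<odot> g') \<odot> (g \<odot> f) = f' \<odot> f"
proof -
  have "(f' \<odot> g') \<odot> (g \<odot> f) = f' \<odot> (g' \<odot> (g \<odot> f))"
    by (rule comp_assoc) (use assms in \<open>auto intro: comp_in_hom\<close>)
  also have "g' \<odot> (g \<odot> f) = (g' \<odot> g) \<odot> f"
    by (rule comp_assoc[symmetric]) (use assms in auto)
  finally show ?thesis using assms by (simp add: comp_ident_left)
qed

lemma is_iso_comp:
  assumes "is_iso C A B f" "is_iso C B E g"
  shows "is_iso C A E (g \<odot> f)"
proof -
  obtain f' where f: "f \<in> hom C A B" "f' \<in> hom C B A" "f' \<odot> f = ident C A" "f \<odot> f' = ident C B"
    using assms(1) by (rule is_isoE)
  obtain g' where g: "g \<in> hom C B E" "g' \<in> hom C E B" "g' \<odot> g = ident C B" "g \<odot> g' = ident C E"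
    using assms(2) by (rule is_isoE)
  show ?thesis
    by (rule is_isoI[of _ _ _ "f' \<odot> g'"])
      (use f g in \<open>auto intro: comp_in_hom simp: comp_inner_cancel\<close>)
qed

text \<open>The unrelated maps \<open>g\<close> and \<open>h\<close> give a left and a right inverse
  of \<open>f\<close>, and these coincide. The triangle arguments produce only such one-sided
  data.\<close>

lemma is_iso_of_two_sided:
  assumes "f \<in> hom C A B" "is_iso C A A (g \<odot> f)" "is_iso C B B (f \<odot> h)" "g \<in> hom C B A" "h \<in> hom C B A"
  shows "is_iso C A B f"
proof -
  obtain p where p: "p \<in> hom C A A" "p \<odot> (g \<odot> f) = ident C A" using assms(2) by (auto elim: is_isoE)
  obtain q where q: "q \<in> hom C B B" "(f \<odot> h) \<odot> q = ident C B" using assms(3) by (auto elim: is_isoE)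
  define l r where "l = p \<odot> g" and "r = h \<odot> q"
  have lh: "l \<in> hom C B A" and rh: "r \<in> hom C B A"
    unfolding l_def r_def using assms p q by (auto intro: comp_in_hom)
  have l: "l \<odot> f = ident C A" unfolding l_def using p assms comp_assoc by metis
  have r: "f \<odot> r = ident C B" unfolding r_def using q assms comp_assoc by metis
  have "l = l \<odot> (f \<odot> r)" using r lh comp_ident_right by simp
  also have "\<dots> = (l \<odot> f) \<odot> r" using comp_assoc[OF rh assms(1) lh] by simp
  also have "\<dots> = r" using l rh comp_ident_left by simp
  finally show ?thesis using is_isoI[OF assms(1) lh l] r by simp
qed

lemma isomorphic_refl: "isomorphic C A A"
  unfolding isomorphic_def using is_iso_ident by blast

lemma isomorphic_sym: "isomorphic C A B \<Longrightarrow> isomorphic C B A"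
  unfolding isomorphic_def by (meson is_isoE)

lemma isomorphic_trans: "isomorphic C A B \<Longrightarrow> isomorphic C B E \<Longrightarrow> isomorphic C A E"
  unfolding isomorphic_def using is_iso_comp by blast

lemma zero_object_iff: "zero_object C Z \<longleftrightarrow> ident C Z = 0"
proof
  assume "zero_object C Z"
  then show "ident C Z = 0" unfolding zero_object_def using ident_in_hom by blast
next
  assume *: "ident C Z = 0"
  show "zero_object C Z" unfolding zero_object_def
  proof (intro allI conjI)
    fix A
    have "f = 0" if "f \<in> hom C A Z" for f
      using comp_ident_left[OF that] comp_zero_left[OF that] * by simp
    then show "hom C A Z = {0}" by auto
    have "f = 0" if "f \<in> hom C Z A" for f
      using comp_ident_right[OF that] comp_zero_right[OF that] * by simp
    then show "hom C Z A = {0}" by auto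
  qed
qed

lemma iso_cancel_left:
  assumes "is_iso C B E b" "f \<in> hom C A B" "g \<in> hom C A B" "b \<odot> f = b \<odot> g"
  shows "f = g"
proof -
  obtain c where c: "b \<in> hom C B E" "c \<in> hom C E B" "c \<odot> b = ident C B" using assms(1) by (rule is_isoE)
  have "(c \<odot> b) \<odot> f = (c \<odot> b) \<odot> g" using comp_assoc[OF _ c(1,2)] assms by simp
  then show ?thesis using c comp_ident_left assms by simp
qed

lemma iso_cancel_right:
  assumes "is_iso C A B b" "f \<in> hom C B E" "g \<in> hom C B E" "f \<odot> b = g \<odot> b"
  shows "f = g"
proof -
  obtain c where c: "b \<in> hom C A B" "c \<in> hom C B A" "b \<odot> c = ident C B" using assms(1) by (rule is_isoE)
  have "f \<odot> (b \<odot> c) = g \<odot> (b \<odot> c)" using comp_assoc[OF c(2,1)] assms by metis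
  then show ?thesis using c comp_ident_right assms by simp
qed

text \<open>The ideal [M](X, Y) in terms of single copies of \<open>M\<close>: n composites through
  \<open>M\<close> add up to one composite through a sum of n copies. The span allows induction on
  one copy at a time, and membership in add M becomes a condition on an identity.\<close>

definition thru :: "'o \<Rightarrow> 'o \<Rightarrow> 'o \<Rightarrow> 'm set" where
  "thru M X Y = vs.span {b \<odot> a | a b. a \<in> hom C X M \<and> b \<in> hom C M Y}"

text \<open>Scalars are absorbed into the second factor \<open>b\<close>, so the step carries no
  coefficient. The invariant \<open>y \<in> hom C X Y\<close> is kept because composition is
  additive only within Hom-spaces.\<close>

lemma thru_induct [consumes 1, case_names zero step]:
  assumes "f \<in> thru M X Y" "P 0"
    and "\<And>a b y. a \<in> hom C X M \<Longrightarrow> b \<in> hom C M Y \<Longrightarrow> y \<in> hom C X Y \<Longrightarrow> P y \<Longrightarrow> P (b \<odot> a + y)"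
  shows "P f"
proof -
  have "f \<in> hom C X Y \<and> P f"
    using assms(1) unfolding thru_def
  proof (induction rule: vs.span_induct_alt)
    case base
    show ?case using assms(2) by simp
  next
    case (step c x y)
    then obtain a b where ab: "x = b \<odot> a" "a \<in> hom C X M" "b \<in> hom C M Y" by blast
    have "scale C c x = scale C c b \<odot> a" using ab comp_scale_left by metis
    moreover have "scale C c b \<in> hom C M Y" using ab scale_in_hom by blast
    ultimately show ?case using assms(3)[OF ab(2), of "scale C c b" y] step ab
      by (auto intro: hom_intros)
  qed
  then show ?thesis by simp
qed

lemma thru_base: "a \<in> hom C X M \<Longrightarrow> b \<in> hom C M Y \<Longrightarrow> b \<odot> a \<in> thru M X Y"
  unfolding thru_def by (rule vs.span_base) blast

lemma thru_zero: "0 \<in> thru M X Y"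
  unfolding thru_def by (rule vs.span_zero)

lemma thru_add: "f \<in> thru M X Y \<Longrightarrow> g \<in> thru M X Y \<Longrightarrow> f + g \<in> thru M X Y"
  unfolding thru_def by (rule vs.span_add)

lemma thru_sum: "(\<And>i. i \<in> I \<Longrightarrow> f i \<in> thru M X Y) \<Longrightarrow> sum f I \<in> thru M X Y"
  unfolding thru_def by (rule vs.span_sum)

lemma thru_comp_left:
  assumes "f \<in> thru M X Y" "g \<in> hom C Y Z"
  shows "g \<odot> f \<in> thru M X Z"
  using assms(1)
proof (induction rule: thru_induct)
  case zero
  then show ?case using assms thru_zero by simp
next
  case (step a b y)
  have "g \<odot> (b \<odot> a + y) = (g \<odot> b) \<odot> a + g \<odot> y"
    using step assms(2) comp_add_right[of "b \<odot> a" X Y y g Z] comp_assoc[of a X M b Y g Z]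
    by (auto intro: hom_intros)
  then show ?case using step assms by (auto intro!: thru_add thru_base intro: hom_intros)
qed

lemma thru_comp_right:
  assumes "f \<in> thru M X Y" "g \<in> hom C W X"
  shows "f \<odot> g \<in> thru M W Y"
  using assms(1)
proof (induction rule: thru_induct)
  case zero
  then show ?case using assms thru_zero by simp
next
  case (step a b y)
  have "(b \<odot> a + y) \<odot> g = b \<odot> (a \<odot> g) + y \<odot> g"
    using step assms(2) comp_add_left[of g W X "b \<odot> a" Y y] comp_assoc[of g W X a M b Y]
    by (auto intro: hom_intros)
  then show ?case using step assms by (auto intro!: thru_add thru_base intro: hom_intros)
qed

text \<open>Inserting the identity of \<open>M\<close> between the two factors reroutes a composite
  through \<open>N\<close>. The premise on \<open>ident C M\<close> will turn out to mean that
  \<open>M\<close> lies in add N.\<close>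

lemma thru_mono:
  assumes "ident C M \<in> thru N M M" "f \<in> thru M X Y"
  shows "f \<in> thru N X Y"
  using assms(2)
proof (induction rule: thru_induct)
  case zero
  then show ?case by (rule thru_zero)
next
  case (step a b y)
  have "b \<odot> (ident C M \<odot> a) \<in> thru N X Y"
    using step assms(1) by (auto intro: thru_comp_left thru_comp_right)
  then show ?case using step comp_ident_left by (auto intro: thru_add)
qed

lemma thru_of_ident_target: "ident C Y \<in> thru M Y Y \<Longrightarrow> f \<in> hom C X Y \<Longrightarrow> f \<in> thru M X Y"
  using thru_comp_right[of "ident C Y" M Y Y f X] comp_ident_left by simp

lemma thru_of_ident_source: "ident C X \<in> thru M X X \<Longrightarrow> f \<in> hom C X Y \<Longrightarrow> f \<in> thru M X Y"
  using thru_comp_left[of "ident C X" M X X f Y] comp_ident_right by simp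

lemma thru_self: "ident C M \<in> thru M M M"
  using thru_base[OF ident_in_hom ident_in_hom] comp_ident_left ident_in_hom by metis

lemma thru_finite_sum:
  assumes "f \<in> thru M X Y"
  shows "\<exists>(n::nat) a b. (\<forall>i<n. a i \<in> hom C X M \<and> b i \<in> hom C M Y) \<and> f = (\<Sum>i<n. b i \<odot> a i)"
  using assms
proof (induction rule: thru_induct)
  case zero
  show ?case by (rule exI[of _ 0]) auto
next
  case (step a b y)
  then obtain n :: nat and a' b' where *: "\<forall>i<n. a' i \<in> hom C X M \<and> b' i \<in> hom C M Y"
    "y = (\<Sum>i<n. b' i \<odot> a' i)" by blast
  have "b \<odot> a + y = (\<Sum>i<Suc n. (b'(n := b)) i \<odot> (a'(n := a)) i)"
    using * by (simp add: add.commute)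
  then show ?case using * step by (intro exI[of _ "Suc n"] exI[of _ "a'(n := a)"] exI[of _ "b'(n := b)"]) auto
qed

section \<open>Biproducts of two objects\<close>

lemma biproductE:
  assumes "is_direct_sum C [A, B] S"
  obtains i p j q where "i \<in> hom C A S" "p \<in> hom C S A" "j \<in> hom C B S" "q \<in> hom C S B"
    "p \<odot> i = ident C A" "q \<odot> j = ident C B" "q \<odot> i = 0" "p \<odot> j = 0"
    "i \<odot> p + j \<odot> q = ident C S"
proof -
  obtain \<iota> \<pi> :: "nat \<Rightarrow> 'm" where
    1: "\<forall>i < 2. \<iota> i \<in> hom C ([A,B] ! i) S \<and> \<pi> i \<in> hom C S ([A,B] ! i)" and
    2: "\<forall>i < 2. \<forall>j < 2. \<pi> j \<odot> \<iota> i = (if i = j then ident C ([A,B] ! i) else 0)" and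
    3: "(\<Sum>i < 2. \<iota> i \<odot> \<pi> i) = ident C S"
    using assms unfolding is_direct_sum_def by (auto simp: numeral_2_eq_2)
  show ?thesis
    by (rule that[of "\<iota> 0" "\<pi> 0" "\<iota> 1" "\<pi> 1"])
      (use 1[rule_format, of 0] 1[rule_format, of 1] 2[rule_format, of 0 0] 2[rule_format, of 1 1]
        2[rule_format, of 0 1] 2[rule_format, of 1 0] 3 in \<open>auto simp: numeral_2_eq_2\<close>)
qed

lemma biproductI:
  assumes "i \<in> hom C A S" "p \<in> hom C S A" "j \<in> hom C B S" "q \<in> hom C S B"
    "p \<odot> i = ident C A" "q \<odot> j = ident C B" "q \<odot> i = 0" "p \<odot> j = 0"
    "i \<odot> p + j \<odot> q = ident C S"
  shows "is_direct_sum C [A, B] S"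
  unfolding is_direct_sum_def
  by (rule exI[of _ "\<lambda>n. if n = 0 then i else j"], rule exI[of _ "\<lambda>n. if n = 0 then p else q"])
    (use assms in \<open>auto simp: less_Suc_eq\<close>)

lemma biproduct_swap: "is_direct_sum C [A, B] S \<Longrightarrow> is_direct_sum C [B, A] S"
proof -
  assume "is_direct_sum C [A, B] S"
  then obtain i p j q where *: "i \<in> hom C A S" "p \<in> hom C S A" "j \<in> hom C B S" "q \<in> hom C S B"
    "p \<odot> i = ident C A" "q \<odot> j = ident C B" "q \<odot> i = 0" "p \<odot> j = 0"
    "i \<odot> p + j \<odot> q = ident C S" by (rule biproductE)
  then have "j \<odot> q + i \<odot> p = ident C S" by (simp add: add.commute)
  with * show ?thesis by (intro biproductI)
qed

lemma biproduct_zero_right: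
  assumes "is_direct_sum C [A, B] S" "zero_object C B"
  shows "isomorphic C A S"
proof -
  obtain i p j q where *: "i \<in> hom C A S" "p \<in> hom C S A" "j \<in> hom C B S" "q \<in> hom C S B"
    "p \<odot> i = ident C A" "i \<odot> p + j \<odot> q = ident C S" using assms(1) by (rule biproductE)
  have "j = 0" using assms(2) * unfolding zero_object_def by blast
  then have "i \<odot> p = ident C S" using * by simp
  then show ?thesis unfolding isomorphic_def using * is_isoI by blast
qed

lemma biproduct_unique:
  assumes "is_direct_sum C [A, B] S" "is_direct_sum C [A, B] S'"
  shows "isomorphic C S S'"
proof -
  obtain i p j q where *: "i \<in> hom C A S" "p \<in> hom C S A" "j \<in> hom C B S" "q \<in> hom C S B"
    "p \<odot> i = ident C A" "q \<odot> j = ident C B" "q \<odot> i = 0" "p \<odot> j = 0"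
    "i \<odot> p + j \<odot> q = ident C S" using assms(1) by (rule biproductE)
  obtain i' p' j' q' where 2: "i' \<in> hom C A S'" "p' \<in> hom C S' A" "j' \<in> hom C B S'" "q' \<in> hom C S' B"
    "p' \<odot> i' = ident C A" "q' \<odot> j' = ident C B" "q' \<odot> i' = 0" "p' \<odot> j' = 0"
    "i' \<odot> p' + j' \<odot> q' = ident C S'" using assms(2) by (rule biproductE)
  \<comment> \<open>Matrix calculus through a biproduct: \<open>r\<close> and \<open>s\<close> are
    dual to \<open>u\<close> and \<open>w\<close>, so the middle object cancels. One instance serves
    for each of the two composites of the comparison maps.\<close>
  have key: "(x \<odot> r + y \<odot> s) \<odot> (u \<odot> v + w \<odot> z) = x \<odot> v + y \<odot> z"
    if "v \<in> hom C R A" "z \<in> hom C R B" "u \<in> hom C A R'" "w \<in> hom C B R'"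
      "r \<in> hom C R' A" "s \<in> hom C R' B" "x \<in> hom C A R''" "y \<in> hom C B R''"
      "r \<odot> u = ident C A" "s \<odot> w = ident C B" "s \<odot> u = 0" "r \<odot> w = 0"
    for u v w z r s x y R R' R''
  proof -
    have h: "u \<odot> v \<in> hom C R R'" "w \<odot> z \<in> hom C R R'" "x \<odot> r \<in> hom C R' R''" "y \<odot> s \<in> hom C R' R''"
      using that by (auto intro: comp_in_hom)
    have 0: "(y \<odot> s) \<odot> (u \<odot> v) = 0"
    proof -
      have "(y \<odot> s) \<odot> (u \<odot> v) = y \<odot> (s \<odot> (u \<odot> v))"
        by (rule comp_assoc) (use that h in auto)
      also have "s \<odot> (u \<odot> v) = 0 \<odot> v" using comp_assoc[of v R A u R' s B] that by simp
      finally show ?thesis using that by simp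
    qed
    have 1: "(x \<odot> r) \<odot> (w \<odot> z) = 0"
    proof -
      have "(x \<odot> r) \<odot> (w \<odot> z) = x \<odot> (r \<odot> (w \<odot> z))"
        by (rule comp_assoc) (use that h in auto)
      also have "r \<odot> (w \<odot> z) = 0 \<odot> z" using comp_assoc[of z R B w R' r A] that by simp
      finally show ?thesis using that by simp
    qed
    have 2: "(x \<odot> r) \<odot> (u \<odot> v) = x \<odot> v" by (rule comp_inner_cancel) (use that in auto)
    have 3: "(y \<odot> s) \<odot> (w \<odot> z) = y \<odot> z" by (rule comp_inner_cancel) (use that in auto)
    have "(x \<odot> r + y \<odot> s) \<odot> (u \<odot> v + w \<odot> z) = (x \<odot> r) \<odot> (u \<odot> v + w \<odot> z) + (y \<odot> s) \<odot> (u \<odot> v + w \<odot> z)"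
      using h by (intro comp_add_left) (auto intro: add_in_hom)
    then show ?thesis
      using comp_add_right[OF h(1,2,3)] comp_add_right[OF h(1,2,4)] 0 1 2 3 by simp
  qed
  show ?thesis unfolding isomorphic_def
  proof
    show "is_iso C S S' (i' \<odot> p + j' \<odot> q)"
      by (rule is_isoI[of _ _ _ "i \<odot> p' + j \<odot> q'"])
        (use * 2 key[of p S q i' S' j' p' q' i S j] key[of p' S' q' i S j p q i' S' j'] in
          \<open>auto intro!: add_in_hom intro: comp_in_hom\<close>)
  qed
qed

end

section \<open>Autoequivalences and direct sums\<close>

context k_linear_category
begin

lemma naturally_iso_to_id_faithful:
  assumes "naturally_isomorphic_to_id C F Fm" "f \<in> hom C A B" "g \<in> hom C A B" "Fm f = Fm g"
  shows "f = g"
proof -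
  obtain \<alpha> where a: "\<forall>A. is_iso C (F A) A (\<alpha> A)"
    "\<forall>A B. \<forall>f \<in> hom C A B. f \<odot> \<alpha> A = \<alpha> B \<odot> Fm f"
    using assms(1) unfolding naturally_isomorphic_to_id_def by blast
  have "f \<odot> \<alpha> A = g \<odot> \<alpha> A" using a(2) assms by metis
  then show ?thesis using iso_cancel_right a(1) assms by blast
qed

lemma autoequivalence_faithful:
  assumes "k_linear_autoequivalence C F Fm" "f \<in> hom C A B" "g \<in> hom C A B" "Fm f = Fm g"
  shows "f = g"
proof -
  obtain G Gm where "naturally_isomorphic_to_id C (G \<circ> F) (Gm \<circ> Fm)"
    using assms(1) unfolding k_linear_autoequivalence_def by blast
  then show ?thesis using naturally_iso_to_id_faithful assms by fastforce
qed

lemma autoequivalence_essentially_surjective: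
  assumes "k_linear_autoequivalence C F Fm"
  shows "\<exists>A. isomorphic C (F A) B"
proof -
  obtain G Gm where "naturally_isomorphic_to_id C (F \<circ> G) (Fm \<circ> Gm)"
    using assms(1) unfolding k_linear_autoequivalence_def by blast
  then show ?thesis unfolding naturally_isomorphic_to_id_def isomorphic_def by fastforce
qed

lemma autoequivalence_full:
  assumes "k_linear_autoequivalence C F Fm" "y \<in> hom C (F A) (F B)"
  shows "\<exists>f \<in> hom C A B. y = Fm f"
proof -
  obtain G Gm where G: "k_linear_endofunctor C G Gm"
    and GF: "naturally_isomorphic_to_id C (G \<circ> F) (Gm \<circ> Fm)"
    and FG: "naturally_isomorphic_to_id C (F \<circ> G) (Fm \<circ> Gm)"
    using assms(1) unfolding k_linear_autoequivalence_def by blast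
  have F: "k_linear_endofunctor C F Fm" using assms(1) unfolding k_linear_autoequivalence_def by blast
  obtain \<alpha> where a: "\<And>A. is_iso C (G (F A)) A (\<alpha> A)"
    "\<And>A B f. f \<in> hom C A B \<Longrightarrow> f \<odot> \<alpha> A = \<alpha> B \<odot> Gm (Fm f)"
    using GF unfolding naturally_isomorphic_to_id_def by (metis comp_apply)
  obtain \<beta> where b: "\<alpha> A \<in> hom C (G (F A)) A" "\<beta> \<in> hom C A (G (F A))" "\<beta> \<odot> \<alpha> A = ident C (G (F A))"
    using a(1) by (rule is_isoE)
  have aB: "\<alpha> B \<in> hom C (G (F B)) B" using a(1) is_iso_hom by blast
  have Gy: "Gm y \<in> hom C (G (F A)) (G (F B))"
    using G assms(2) unfolding k_linear_endofunctor_def by blast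
  \<comment> \<open>The candidate is \<open>Gm y\<close> conjugated by the isomorphism from G F to
    the identity. This gives \<open>Gm (Fm f) = Gm y\<close>, and \<open>G\<close> is faithful
    because F G is isomorphic to the identity as well.\<close>
  define f where "f = \<alpha> B \<odot> Gm y \<odot> \<beta>"
  have f: "f \<in> hom C A B" unfolding f_def using Gy b aB by (auto intro: comp_in_hom)
  have Ff: "Fm f \<in> hom C (F A) (F B)" using F f unfolding k_linear_endofunctor_def by blast
  have GFf: "Gm (Fm f) \<in> hom C (G (F A)) (G (F B))"
    using G Ff unfolding k_linear_endofunctor_def by blast
  have "f \<odot> \<alpha> A = (\<alpha> B \<odot> Gm y) \<odot> (\<beta> \<odot> \<alpha> A)"
    unfolding f_def by (rule comp_assoc) (use b aB Gy in \<open>auto intro: comp_in_hom\<close>)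
  also have "\<dots> = \<alpha> B \<odot> Gm y" using b comp_ident_right[of "\<alpha> B \<odot> Gm y"] aB Gy by (metis comp_in_hom)
  finally have "\<alpha> B \<odot> Gm (Fm f) = \<alpha> B \<odot> Gm y" using a(2)[OF f] by simp
  then have "Gm (Fm f) = Gm y" using iso_cancel_left[OF a(1)[of B] GFf Gy] by simp
  then have "(Fm \<circ> Gm) (Fm f) = (Fm \<circ> Gm) y" by simp
  then have "Fm f = y" using naturally_iso_to_id_faithful[OF FG Ff assms(2)] by blast
  then show ?thesis using f by blast
qed

section \<open>Direct sums of lists of objects\<close>

lemma direct_sum_Nil: "is_direct_sum C [] S \<longleftrightarrow> zero_object C S"
  unfolding is_direct_sum_def zero_object_iff by auto

lemma direct_sumE:
  assumes "is_direct_sum C As S"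
  obtains \<iota> \<pi> :: "nat \<Rightarrow> 'm" where
    "\<forall>i < length As. \<iota> i \<in> hom C (As ! i) S" "\<forall>i < length As. \<pi> i \<in> hom C S (As ! i)"
    "\<forall>i < length As. \<forall>j < length As. \<pi> j \<odot> \<iota> i = (if i = j then ident C (As ! i) else 0)"
    "(\<Sum>i < length As. \<iota> i \<odot> \<pi> i) = ident C S"
  using assms unfolding is_direct_sum_def by blast

text \<open>Matrix multiplication through a direct sum: the families \<open>b\<close> and
  \<open>c\<close> are dual to each other, so the double sum collapses to its diagonal.\<close>

lemma comp_sum_orthogonal:
  assumes "\<And>n. n < length As \<Longrightarrow> a n \<in> hom C (As ! n) Z" "\<And>n. n < length As \<Longrightarrow> b n \<in> hom C Y (As ! n)"
      "\<And>n. n < length As \<Longrightarrow> c n \<in> hom C (As ! n) Y" "\<And>n. n < length As \<Longrightarrow> d n \<in> hom C X (As ! n)"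
      "\<And>n m. n < length As \<Longrightarrow> m < length As \<Longrightarrow> b m \<odot> c n = (if n = m then ident C (As ! n) else 0)"
  shows "(\<Sum>n < length As. a n \<odot> b n) \<odot> (\<Sum>n < length As. c n \<odot> d n) = (\<Sum>n < length As. a n \<odot> d n)"
proof -
  have "(\<Sum>n < length As. a n \<odot> b n) \<odot> (\<Sum>n < length As. c n \<odot> d n) =
      (\<Sum>m < length As. (a m \<odot> b m) \<odot> (\<Sum>n < length As. c n \<odot> d n))"
    by (rule comp_sum_left) (use assms in \<open>auto intro!: sum_in_hom comp_in_hom\<close>)
  also have "\<dots> = (\<Sum>m < length As. a m \<odot> d m)"
  proof (rule sum.cong)
    fix m assume m: "m \<in> {..<length As}"
    have "(a m \<odot> b m) \<odot> (\<Sum>n < length As. c n \<odot> d n) = (\<Sum>n < length As. (a m \<odot> b m) \<odot> (c n \<odot> d n))"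
      by (rule comp_sum_right) (use assms m in \<open>auto intro!: comp_in_hom\<close>)
    also have "\<dots> = (\<Sum>n < length As. if n = m then a m \<odot> d m else 0)"
    proof (rule sum.cong)
      fix n assume n: "n \<in> {..<length As}"
      have "(a m \<odot> b m) \<odot> (c n \<odot> d n) = a m \<odot> (b m \<odot> (c n \<odot> d n))"
        by (rule comp_assoc[of _ X Y _ "As ! m" _ Z]) (use assms m n comp_in_hom[OF assms(4,3)] in auto)
      also have "b m \<odot> (c n \<odot> d n) = (b m \<odot> c n) \<odot> d n"
        by (rule comp_assoc[symmetric]) (use assms m n in auto)
      also have "\<dots> = (if n = m then d m else 0)"
        using assms m n comp_ident_left[of "d m" X "As ! m"] comp_zero_left[of "d n" X "As ! n"] by auto
      finally show "(a m \<odot> b m) \<odot> (c n \<odot> d n) = (if n = m then a m \<odot> d m else 0)"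
        using assms m comp_zero_right[of "a m" "As ! m" Z] by auto
    qed simp
    finally show "(a m \<odot> b m) \<odot> (\<Sum>n < length As. c n \<odot> d n) = a m \<odot> d m" using m by simp
  qed simp
  finally show ?thesis .
qed

lemma direct_sum_compose:
  assumes "is_direct_sum C As S'" "is_direct_sum C [A, S'] S"
  shows "is_direct_sum C (A # As) S"
proof -
  obtain \<iota> \<pi> :: "nat \<Rightarrow> 'm" where
    all1: "\<forall>i < length As. \<iota> i \<in> hom C (As ! i) S'" "\<forall>i < length As. \<pi> i \<in> hom C S' (As ! i)" and
    all2: "\<forall>i < length As. \<forall>j < length As. \<pi> j \<odot> \<iota> i = (if i = j then ident C (As ! i) else 0)" and
    3: "(\<Sum>i < length As. \<iota> i \<odot> \<pi> i) = ident C S'"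
    using assms(1) by (rule direct_sumE)
  note 1 = all1[rule_format] and 2 = all2[rule_format]
  obtain i p j q where *: "i \<in> hom C A S" "p \<in> hom C S A" "j \<in> hom C S' S" "q \<in> hom C S S'"
    "p \<odot> i = ident C A" "q \<odot> j = ident C S'" "q \<odot> i = 0" "p \<odot> j = 0"
    "i \<odot> p + j \<odot> q = ident C S" using assms(2) by (rule biproductE)
  define \<iota>' where "\<iota>' n = (case n of 0 \<Rightarrow> i | Suc n \<Rightarrow> j \<odot> \<iota> n)" for n
  define \<pi>' where "\<pi>' n = (case n of 0 \<Rightarrow> p | Suc n \<Rightarrow> \<pi> n \<odot> q)" for n
  have "(\<Sum>n < length As. (j \<odot> \<iota> n) \<odot> (\<pi> n \<odot> q)) = (\<Sum>n < length As. j \<odot> ((\<iota> n \<odot> \<pi> n) \<odot> q))"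
  proof (rule sum.cong)
    fix n assume n: "n \<in> {..<length As}"
    have "(\<iota> n \<odot> \<pi> n) \<odot> q = \<iota> n \<odot> (\<pi> n \<odot> q)"
      by (rule comp_assoc) (use * 1 n in auto)
    moreover have "(j \<odot> \<iota> n) \<odot> (\<pi> n \<odot> q) = j \<odot> (\<iota> n \<odot> (\<pi> n \<odot> q))"
      by (rule comp_assoc) (use * 1 n in \<open>auto intro: comp_in_hom\<close>)
    ultimately show "(j \<odot> \<iota> n) \<odot> (\<pi> n \<odot> q) = j \<odot> ((\<iota> n \<odot> \<pi> n) \<odot> q)" by simp
  qed simp
  also have "\<dots> = j \<odot> (\<Sum>n < length As. (\<iota> n \<odot> \<pi> n) \<odot> q)"
    by (rule comp_sum_right[symmetric]) (use * 1 in \<open>auto intro!: comp_in_hom\<close>)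
  also have "(\<Sum>n < length As. (\<iota> n \<odot> \<pi> n) \<odot> q) = ident C S' \<odot> q"
    unfolding 3[symmetric]
    by (rule comp_sum_left[symmetric]) (use * 1 in \<open>auto intro!: comp_in_hom\<close>)
  finally have sum: "(\<Sum>n < length As. (j \<odot> \<iota> n) \<odot> (\<pi> n \<odot> q)) = j \<odot> q"
    using * comp_ident_left by simp
  have pi_iota: "\<pi>' n \<odot> \<iota>' m = (if m = n then ident C ((A # As) ! m) else 0)"
    if "m < length (A # As)" "n < length (A # As)" for m n
  proof (cases m; cases n)
    fix n' assume "m = 0" "n = Suc n'"
    then show ?thesis using that * 1 comp_assoc[of i A S q S' "\<pi> n'"] by (auto simp: \<iota>'_def \<pi>'_def)
  next
    fix m' assume "n = 0" "m = Suc m'"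
    then show ?thesis using that * 1 comp_assoc[of "\<iota> m'" _ S' j S p A, symmetric] by (auto simp: \<iota>'_def \<pi>'_def)
  next
    fix m' n' assume "m = Suc m'" "n = Suc n'"
    then show ?thesis using that * 1 2 comp_inner_cancel[of "\<iota> m'" "As ! m'" S' j S q "\<pi> n'" "As ! n'"]
      by (auto simp: \<iota>'_def \<pi>'_def)
  qed (use * in \<open>auto simp: \<iota>'_def \<pi>'_def\<close>)
  show ?thesis unfolding is_direct_sum_def
  proof (intro exI conjI allI impI)
    fix n assume "n < length (A # As)"
    then show "\<iota>' n \<in> hom C ((A # As) ! n) S" "\<pi>' n \<in> hom C S ((A # As) ! n)"
      using * 1 by (auto simp: \<iota>'_def \<pi>'_def nth_Cons intro: comp_in_hom split: nat.splits)
  next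
    show "(\<Sum>i < length (A # As). \<iota>' i \<odot> \<pi>' i) = ident C S"
      using * sum by (simp add: \<iota>'_def \<pi>'_def sum.lessThan_Suc_shift del: sum.lessThan_Suc)
  qed (use pi_iota in auto)
qed

text \<open>The tail sum \<open>S'\<close> is given independently of \<open>S\<close>, so its
  injection and projection are built by comparing the two families of structure maps componentwise.
  With \<open>direct_sum_compose\<close> this permits induction on lists although no direct sums are
  chosen.\<close>

lemma direct_sum_decompose:
  assumes "is_direct_sum C (A # As) S" "is_direct_sum C As S'"
  shows "is_direct_sum C [A, S'] S"
proof -
  obtain \<iota> \<pi> :: "nat \<Rightarrow> 'm" where
    all1: "\<forall>i < length As. \<iota> i \<in> hom C (As ! i) S'" "\<forall>i < length As. \<pi> i \<in> hom C S' (As ! i)" and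
    all2: "\<forall>i < length As. \<forall>j < length As. \<pi> j \<odot> \<iota> i = (if i = j then ident C (As ! i) else 0)" and
    3: "(\<Sum>i < length As. \<iota> i \<odot> \<pi> i) = ident C S'"
    using assms(2) by (rule direct_sumE)
  note 1 = all1[rule_format] and 2 = all2[rule_format]
  obtain \<iota>' \<pi>' :: "nat \<Rightarrow> 'm" where
    all1: "\<forall>i < length (A#As). \<iota>' i \<in> hom C ((A#As) ! i) S" "\<forall>i < length (A#As). \<pi>' i \<in> hom C S ((A#As) ! i)" and
    all2: "\<forall>i < length (A#As). \<forall>j < length (A#As). \<pi>' j \<odot> \<iota>' i = (if i = j then ident C ((A#As) ! i) else 0)" and
    s3: "(\<Sum>i < length (A#As). \<iota>' i \<odot> \<pi>' i) = ident C S"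
    using assms(1) by (rule direct_sumE)
  note s1 = all1[rule_format] and s2 = all2[rule_format]
  define i p where "i = \<iota>' 0" and "p = \<pi>' 0"
  define u where "u n = \<iota>' (Suc n)" for n
  define v where "v n = \<pi>' (Suc n)" for n
  have ip: "i \<in> hom C A S" "p \<in> hom C S A" "p \<odot> i = ident C A"
    unfolding i_def p_def using s1[of 0] s2[of 0 0] by auto
  have uv: "u n \<in> hom C (As ! n) S" "v n \<in> hom C S (As ! n)" "v n \<odot> i = 0" "p \<odot> u n = 0"
    if "n < length As" for n
    unfolding u_def v_def i_def p_def using s1[of "Suc n"] s2[of "Suc n" 0] s2[of 0 "Suc n"] that by auto
  have vu: "v m \<odot> u n = (if n = m then ident C (As ! n) else 0)" if "n < length As" "m < length As" for n m
    unfolding u_def v_def using s2[of "Suc n" "Suc m"] that by auto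
  have s: "i \<odot> p + (\<Sum>n < length As. u n \<odot> v n) = ident C S"
    using s3 by (simp add: i_def p_def u_def v_def sum.lessThan_Suc_shift del: sum.lessThan_Suc)
  define j where "j = (\<Sum>n < length As. u n \<odot> \<pi> n)"
  define q where "q = (\<Sum>n < length As. \<iota> n \<odot> v n)"
  have jq: "j \<in> hom C S' S" "q \<in> hom C S S'" unfolding j_def q_def
    using 1 uv by (auto intro!: sum_in_hom comp_in_hom)
  show ?thesis
  proof (rule biproductI[OF ip(1,2) jq ip(3)])
    show "q \<odot> j = ident C S'" unfolding q_def j_def 3[symmetric]
      by (rule comp_sum_orthogonal) (use 1 uv vu in auto)
    have "j \<odot> q = (\<Sum>n < length As. u n \<odot> v n)" unfolding q_def j_def
      by (rule comp_sum_orthogonal) (use 1 2 uv in auto)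
    then show "i \<odot> p + j \<odot> q = ident C S" using s by simp
    have "q \<odot> i = (\<Sum>n < length As. (\<iota> n \<odot> v n) \<odot> i)" unfolding q_def
      by (rule comp_sum_left) (use ip 1 uv in \<open>auto intro!: comp_in_hom\<close>)
    also have "\<dots> = 0"
      using ip 1 uv by (intro sum.neutral) (auto simp: comp_assoc[OF ip(1) uv(2) 1(1)] uv(3) comp_zero_right[OF 1(1)])
    finally show "q \<odot> i = 0" .
    have "p \<odot> j = (\<Sum>n < length As. p \<odot> (u n \<odot> \<pi> n))" unfolding j_def
      by (rule comp_sum_right) (use ip 1 uv in \<open>auto intro!: comp_in_hom\<close>)
    also have "\<dots> = 0"
      using ip 1 uv by (intro sum.neutral) (auto simp: comp_assoc[OF 1(2) uv(1) ip(2), symmetric] uv(4) comp_zero_left[OF 1(2)])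
    finally show "p \<odot> j = 0" .
  qed
qed

end

section \<open>Triangles\<close>

context k_linear_triangulated_category
begin

lemma shift_endofunctor: "k_linear_endofunctor D (shift D) (shift_mor D)"
  using shift_autoequivalence unfolding k_linear_autoequivalence_def by blast

lemma shift_hom: "f \<in> hom D A B \<Longrightarrow> shift_mor D f \<in> hom D (shift D A) (shift D B)"
  using shift_endofunctor unfolding k_linear_endofunctor_def by blast

lemma shift_ident: "shift_mor D (ident D A) = ident D (shift D A)"
  using shift_endofunctor unfolding k_linear_endofunctor_def by blast

lemma shift_comp:
  "f \<in> hom D A B \<Longrightarrow> g \<in> hom D B E \<Longrightarrow> shift_mor D (g \<odot> f) = shift_mor D g \<odot> shift_mor D f"
  using shift_endofunctor unfolding k_linear_endofunctor_def by blast

lemma shift_add: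
  "f \<in> hom D A B \<Longrightarrow> g \<in> hom D A B \<Longrightarrow> shift_mor D (f + g) = shift_mor D f + shift_mor D g"
  using shift_endofunctor unfolding k_linear_endofunctor_def by blast

lemma shift_zero [simp]: "shift_mor D 0 = 0"
  using shift_add[of 0 undefined undefined 0] by simp

lemma shift_neg: "f \<in> hom D A B \<Longrightarrow> shift_mor D (- f) = - shift_mor D f"
  using shift_add[of f A B "- f"] by (simp add: neg_in_hom eq_neg_iff_add_eq_0 add.commute)

lemma shift_ident_diff:
  "f \<in> hom D A A \<Longrightarrow> shift_mor D (ident D A - f) = ident D (shift D A) - shift_mor D f"
  using shift_add[OF ident_in_hom neg_in_hom, of f A] shift_neg[of f A A] shift_ident by simp

lemma shift_faithful:
  "f \<in> hom D A B \<Longrightarrow> g \<in> hom D A B \<Longrightarrow> shift_mor D f = shift_mor D g \<Longrightarrow> f = g"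
  using autoequivalence_faithful[OF shift_autoequivalence] by blast

lemma shift_full: "y \<in> hom D (shift D A) (shift D B) \<Longrightarrow> \<exists>f \<in> hom D A B. y = shift_mor D f"
  using autoequivalence_full[OF shift_autoequivalence] by blast

lemma shift_zero_object: "zero_object D Z \<Longrightarrow> zero_object D (shift D Z)"
  unfolding zero_object_iff shift_ident[symmetric] by simp

lemma shift_iso_iff:
  assumes "f \<in> hom D A B"
  shows "is_iso D (shift D A) (shift D B) (shift_mor D f) \<longleftrightarrow> is_iso D A B f"
proof
  assume "is_iso D A B f"
  then obtain g where g: "f \<in> hom D A B" "g \<in> hom D B A" "g \<odot> f = ident D A" "f \<odot> g = ident D B"
    by (rule is_isoE)
  show "is_iso D (shift D A) (shift D B) (shift_mor D f)"
    by (rule is_isoI[of _ _ _ "shift_mor D g"])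
      (use g in \<open>auto intro: shift_hom simp: shift_comp[symmetric] shift_ident\<close>)
next
  assume "is_iso D (shift D A) (shift D B) (shift_mor D f)"
  then obtain y where y: "y \<in> hom D (shift D B) (shift D A)"
    "y \<odot> shift_mor D f = ident D (shift D A)" "shift_mor D f \<odot> y = ident D (shift D B)"
    by (rule is_isoE)
  obtain g where g: "g \<in> hom D B A" "y = shift_mor D g" using shift_full y by blast
  have "shift_mor D (g \<odot> f) = shift_mor D (ident D A)" "shift_mor D (f \<odot> g) = shift_mor D (ident D B)"
    using y g assms by (auto simp: shift_comp shift_ident)
  then have "g \<odot> f = ident D A" "f \<odot> g = ident D B"
    using shift_faithful g assms by (meson comp_in_hom ident_in_hom)+
  then show "is_iso D A B f" using is_isoI g assms by blast
qed

text \<open>Full faithfulness of the shift lifts the structure maps and reflects the biproduct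
  equations. The octahedral argument for pushouts splits a triangle only after a shift.\<close>

lemma biproduct_of_shift:
  assumes "is_direct_sum D [shift D A, shift D B] (shift D S)"
  shows "is_direct_sum D [A, B] S"
proof -
  obtain i' p' j' q' where *: "i' \<in> hom D (shift D A) (shift D S)" "p' \<in> hom D (shift D S) (shift D A)"
    "j' \<in> hom D (shift D B) (shift D S)" "q' \<in> hom D (shift D S) (shift D B)"
    "p' \<odot> i' = ident D (shift D A)" "q' \<odot> j' = ident D (shift D B)" "q' \<odot> i' = 0" "p' \<odot> j' = 0"
    "i' \<odot> p' + j' \<odot> q' = ident D (shift D S)" using assms by (rule biproductE)
  obtain i p j q where 1: "i \<in> hom D A S" "p \<in> hom D S A" "j \<in> hom D B S" "q \<in> hom D S B" and
    2: "i' = shift_mor D i" "p' = shift_mor D p" "j' = shift_mor D j" "q' = shift_mor D q"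
    using shift_full[OF *(1)] shift_full[OF *(2)] shift_full[OF *(3)] shift_full[OF *(4)] by blast
  have ip: "i \<odot> p \<in> hom D S S" "j \<odot> q \<in> hom D S S" using 1 by (auto intro: comp_in_hom)
  have "shift_mor D (p \<odot> i) = shift_mor D (ident D A)" "shift_mor D (q \<odot> j) = shift_mor D (ident D B)"
    "shift_mor D (q \<odot> i) = shift_mor D 0" "shift_mor D (p \<odot> j) = shift_mor D 0"
    "shift_mor D (i \<odot> p + j \<odot> q) = shift_mor D (ident D S)"
    using * 1 2 ip by (auto simp: shift_comp shift_add shift_ident)
  then have "p \<odot> i = ident D A" "q \<odot> j = ident D B" "q \<odot> i = 0" "p \<odot> j = 0" "i \<odot> p + j \<odot> q = ident D S"
    using shift_faithful[OF comp_in_hom[OF 1(1,2)] ident_in_hom]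
      shift_faithful[OF comp_in_hom[OF 1(3,4)] ident_in_hom]
      shift_faithful[OF comp_in_hom[OF 1(1,4)] zero_in_hom]
      shift_faithful[OF comp_in_hom[OF 1(3,2)] zero_in_hom]
      shift_faithful[OF add_in_hom[OF ip] ident_in_hom] by auto
  then show ?thesis by (rule biproductI[OF 1])
qed

section \<open>Rotation and exactness of Hom on triangles\<close>

lemma triangle_hom:
  assumes "triangle D X Y Z f g h"
  shows "f \<in> hom D X Y" "g \<in> hom D Y Z" "h \<in> hom D Z (shift D X)"
  using triangle_in_hom[OF assms] by auto

lemma triangle_rotate: "triangle D X Y Z f g h \<Longrightarrow> triangle D Y Z (shift D X) g h (- shift_mor D f)"
  using TR2 triangle_hom by blast

lemma triangle_comp_zero:
  assumes "triangle D X Y Z f g h"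
  shows "g \<odot> f = 0"
proof -
  obtain Z0 where Z0: "zero_object D Z0" using zero_object_exists by blast
  obtain c where c: "c \<in> hom D Z0 Z" "c \<odot> 0 = g \<odot> f"
    using TR3[OF TR1_ident[OF Z0, of X] assms ident_in_hom[of X] triangle_hom(1)[OF assms]] by auto
  then show ?thesis using comp_zero_right by metis
qed

lemma triangle_comp_zero2:
  assumes "triangle D X Y Z f g h"
  shows "h \<odot> g = 0" "shift_mor D f \<odot> h = 0"
proof -
  show "h \<odot> g = 0" using triangle_comp_zero[OF triangle_rotate[OF assms]] .
  have "(- shift_mor D f) \<odot> h = 0" using triangle_comp_zero[OF triangle_rotate[OF triangle_rotate[OF assms]]] .
  then show "shift_mor D f \<odot> h = 0"
    using comp_neg_left triangle_hom[OF assms] shift_hom by (metis neg_equal_0_iff_equal)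
qed

text \<open>Exactness of Hom(E, -) at the middle term. \<open>TR3\<close> completes \<open>x\<close>
  to a morphism from the rotated trivial triangle E -> 0 -> E[1] into the rotated given one; its
  third component is the shift of the factor sought.\<close>

lemma triangle_lift_first:
  assumes "triangle D X Y Z f g h" "x \<in> hom D E Y" "g \<odot> x = 0"
  shows "\<exists>y \<in> hom D E X. x = f \<odot> y"
proof -
  note T = triangle_hom[OF assms(1)]
  obtain Z0 where Z0: "zero_object D Z0" using zero_object_exists by blast
  have t1: "triangle D E Z0 (shift D E) 0 0 (- shift_mor D (ident D E))"
    by (rule triangle_rotate[OF TR1_ident[OF Z0]])
  have eq: "0 \<odot> 0 = g \<odot> x" using assms(3) comp_zero_left[of 0 E Z0] by simp
  obtain c where c: "c \<in> hom D (shift D E) (shift D X)"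
    "shift_mor D x \<odot> (- shift_mor D (ident D E)) = (- shift_mor D f) \<odot> c"
    using TR3[OF t1 triangle_rotate[OF assms(1)] assms(2) zero_in_hom eq] by blast
  obtain y where y: "y \<in> hom D E X" "c = shift_mor D y" using shift_full c by blast
  have "- shift_mor D x = - (shift_mor D f \<odot> c)"
    using c T assms(2) shift_hom comp_ident_right[OF shift_hom[OF assms(2)]]
      comp_neg_right[OF ident_in_hom shift_hom[OF assms(2)]] comp_neg_left[OF c(1) shift_hom[OF T(1)]]
    by (simp add: shift_ident)
  then have "shift_mor D x = shift_mor D (f \<odot> y)" using y T by (simp add: shift_comp)
  then show ?thesis using shift_faithful assms(2) y T comp_in_hom by blast
qed

lemma triangle_lift_second:
  assumes "triangle D X Y Z f g h" "x \<in> hom D E Z" "h \<odot> x = 0"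
  shows "\<exists>y \<in> hom D E Y. x = g \<odot> y"
  using triangle_lift_first[OF triangle_rotate[OF assms(1)] assms(2,3)] .

lemma triangle_lift_third:
  assumes "triangle D X Y Z f g h" "x \<in> hom D E (shift D X)" "shift_mor D f \<odot> x = 0"
  shows "\<exists>y \<in> hom D E Z. x = h \<odot> y"
proof (rule triangle_lift_first[OF triangle_rotate[OF triangle_rotate[OF assms(1)]] assms(2)])
  show "(- shift_mor D f) \<odot> x = 0"
    using comp_neg_left[OF assms(2) shift_hom[OF triangle_hom(1)[OF assms(1)]]] assms(3) by simp
qed

text \<open>Exactness of Hom(-, E), dual to \<open>triangle_lift_first\<close>: \<open>x\<close> is
  completed to a morphism into the trivial triangle 0 -> E -> E.\<close>

lemma triangle_extend_second:
  assumes "triangle D X Y Z f g h" "x \<in> hom D Y E" "x \<odot> f = 0"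
  shows "\<exists>y \<in> hom D Z E. x = y \<odot> g"
proof -
  note T = triangle_hom[OF assms(1)]
  obtain Z0 where Z0: "zero_object D Z0" using zero_object_exists by blast
  have "triangle D Z0 E E 0 (ident D E) 0"
    using TR2[of 0 Z0 E E "ident D E" 0] TR1_ident[OF shift_zero_object[OF Z0], of E] by simp
  moreover have "x \<odot> f = 0 \<odot> 0" using assms(3) comp_zero_left[of 0 X Z0] by simp
  ultimately obtain c where "c \<in> hom D Z E" "c \<odot> g = ident D E \<odot> x"
    using TR3[OF assms(1) _ zero_in_hom assms(2)] by blast
  then show ?thesis using comp_ident_left[OF assms(2)] by auto
qed

lemma triangle_extend_third:
  assumes "triangle D X Y Z f g h" "x \<in> hom D Z E" "x \<odot> g = 0"
  shows "\<exists>y \<in> hom D (shift D X) E. x = y \<odot> h"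
  using triangle_extend_second[OF triangle_rotate[OF assms(1)] assms(2,3)] .

lemma triangle_extend_fourth:
  assumes "triangle D X Y Z f g h" "x \<in> hom D (shift D X) E" "x \<odot> h = 0"
  shows "\<exists>y \<in> hom D (shift D Y) E. x = y \<odot> shift_mor D f"
proof -
  obtain y where y: "y \<in> hom D (shift D Y) E" "x = y \<odot> (- shift_mor D f)"
    using triangle_extend_third[OF triangle_rotate[OF assms(1)] assms(2,3)] by blast
  have "x = (- y) \<odot> shift_mor D f"
    using y comp_neg_left comp_neg_right shift_hom triangle_hom(1)[OF assms(1)] by metis
  then show ?thesis using y neg_in_hom by blast
qed

lemma triangle_extend_first:
  assumes "triangle D X Y Z f g h" "x \<in> hom D X E" "shift_mor D x \<odot> h = 0"
  shows "\<exists>y \<in> hom D Y E. x = y \<odot> f"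
proof -
  note T = triangle_hom[OF assms(1)]
  obtain y where y: "y \<in> hom D (shift D Y) (shift D E)" "shift_mor D x = y \<odot> shift_mor D f"
    using triangle_extend_fourth[OF assms(1) shift_hom[OF assms(2)] assms(3)] by blast
  obtain y' where y': "y' \<in> hom D Y E" "y = shift_mor D y'" using shift_full y by blast
  have "shift_mor D x = shift_mor D (y' \<odot> f)" using y y' T by (simp add: shift_comp)
  then show ?thesis using shift_faithful assms(2) y' T comp_in_hom by blast
qed

text \<open>The shift is only an autoequivalence, so the cone of \<open>w\<close> need not be a
  shift. It is replaced by an isomorphic \<open>shift D Y\<close>; then the other two maps are
  shifts by fullness, and the triangle can be rotated back twice.\<close>

lemma triangle_cocone:
  assumes "w \<in> hom D Z (shift D X)"
  shows "\<exists>Y f g. triangle D X Y Z f g w"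
proof -
  obtain W p q where W: "triangle D Z (shift D X) W w p q" using TR1_cone[OF assms] by blast
  obtain Y i where "is_iso D (shift D Y) W i"
    using autoequivalence_essentially_surjective[OF shift_autoequivalence, of W]
    unfolding isomorphic_def by blast
  then obtain i' where i: "i \<in> hom D (shift D Y) W" "i' \<in> hom D W (shift D Y)" "i' \<odot> i = ident D (shift D Y)"
    "i \<odot> i' = ident D W" and iso: "is_iso D W (shift D Y) i'" by (rule is_isoE)
  note Wh = triangle_hom[OF W]
  have h: "i' \<odot> p \<in> hom D (shift D X) (shift D Y)" "q \<odot> i \<in> hom D (shift D Y) (shift D Z)"
    using Wh i by (auto intro: comp_in_hom)
  have t: "triangle D Z (shift D X) (shift D Y) w (i' \<odot> p) (q \<odot> i)"
  proof (rule TR1_iso[OF W is_iso_ident is_iso_ident iso assms h])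
    show "ident D (shift D X) \<odot> w = w \<odot> ident D Z"
      using comp_ident_left comp_ident_right assms by metis
    show "i' \<odot> p = i' \<odot> p \<odot> ident D (shift D X)"
      using comp_ident_right h by metis
    have "q \<odot> i \<odot> i' = q \<odot> (i \<odot> i')" by (rule comp_assoc[OF i(2,1) Wh(3)])
    then show "shift_mor D (ident D Z) \<odot> q = q \<odot> i \<odot> i'"
      using i comp_ident_right[OF Wh(3)] comp_ident_left[OF Wh(3)] by (simp add: shift_ident)
  qed
  obtain f where f: "f \<in> hom D X Y" "- (i' \<odot> p) = shift_mor D f"
    using shift_full neg_in_hom[OF h(1)] by blast
  obtain g where g: "g \<in> hom D Y Z" "- (q \<odot> i) = shift_mor D g"
    using shift_full neg_in_hom[OF h(2)] by blast
  have "i' \<odot> p = - shift_mor D f" "q \<odot> i = - shift_mor D g" using f g by (metis minus_minus)+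
  then have "triangle D Z (shift D X) (shift D Y) w (- shift_mor D f) (- shift_mor D g)" using t by simp
  then have "triangle D Y Z (shift D X) g w (- shift_mor D f)" using TR2[OF g(1)] by blast
  then show ?thesis using TR2[OF f(1)] by blast
qed

text \<open>The difference \<open>d\<close> of the identity and \<open>e\<close> satisfies
  \<open>d \<odot> g = 0\<close> and \<open>h \<odot> d = 0\<close>. So it factors through
  \<open>h\<close> and has square zero, and 1 + d is the inverse of \<open>e\<close>.\<close>

lemma triangle_endo_iso_aux:
  assumes "triangle D X Y Z f g h" "e \<in> hom D Z Z" "e \<odot> g = g" "h \<odot> e = h"
  shows "is_iso D Z Z e"
proof -
  note T = triangle_hom[OF assms(1)]
  define d where "d = ident D Z - e"
  have d: "d \<in> hom D Z Z" unfolding d_def using assms by (auto intro: hom_intros)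
  have "d \<odot> g = 0" unfolding d_def
    using comp_diff_left[OF T(2) ident_in_hom assms(2)] comp_ident_left[OF T(2)] assms by simp
  then obtain y where y: "y \<in> hom D (shift D X) Z" "d = y \<odot> h"
    using triangle_extend_third[OF assms(1) d] by blast
  have "h \<odot> d = 0" unfolding d_def
    using comp_diff_right[OF ident_in_hom assms(2) T(3)] comp_ident_right[OF T(3)] assms by simp
  then have "d \<odot> d = 0" using y comp_assoc[OF d T(3) y(1)] comp_zero_right by simp
  moreover have "e = ident D Z - d" unfolding d_def by simp
  moreover have "(ident D Z + d) \<odot> (ident D Z - d) = ident D Z - d \<odot> d"
    "(ident D Z - d) \<odot> (ident D Z + d) = ident D Z - d \<odot> d"
    using d comp_add_left[of "ident D Z - d" Z Z "ident D Z" Z d] comp_ident_left[of "ident D Z - d" Z Z]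
      comp_diff_right[of "ident D Z" Z Z d d Z] comp_ident_right[of d Z Z]
      comp_diff_left[of "ident D Z + d" Z Z "ident D Z" Z d] comp_ident_left[of "ident D Z + d" Z Z]
      comp_add_right[of "ident D Z" Z Z d d Z]
    by (auto simp: ident_in_hom add_in_hom diff_in_hom)
  ultimately show ?thesis
    by (intro is_isoI[of e Z Z "ident D Z + d"]) (use assms d in \<open>auto intro: hom_intros\<close>)
qed

text \<open>The five lemma for triangles. \<open>TR3\<close> applied to the inverses of
  \<open>a\<close> and \<open>b\<close> yields a map \<open>c'\<close> that need not be inverse to
  \<open>c\<close>; but both composites are compatible with identities on the other terms, so
  \<open>triangle_endo_iso_aux\<close> makes them invertible.\<close>

lemma triangle_third_iso:
  assumes T: "triangle D X Y Z f g h" and T': "triangle D X' Y' Z' f' g' h'"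
    and "is_iso D X X' a" "is_iso D Y Y' b" "c \<in> hom D Z Z'"
    and "b \<odot> f = f' \<odot> a" "c \<odot> g = g' \<odot> b" "shift_mor D a \<odot> h = h' \<odot> c"
  shows "is_iso D Z Z' c"
proof -
  note t = triangle_hom[OF T] and t' = triangle_hom[OF T']
  obtain a' where a: "a \<in> hom D X X'" "a' \<in> hom D X' X" "a' \<odot> a = ident D X" "a \<odot> a' = ident D X'"
    using assms(3) by (rule is_isoE)
  obtain b' where b: "b \<in> hom D Y Y'" "b' \<in> hom D Y' Y" "b' \<odot> b = ident D Y" "b \<odot> b' = ident D Y'"
    using assms(4) by (rule is_isoE)
  have "b' \<odot> f' = f \<odot> a'"
  proof -
    have "b' \<odot> f' = (b' \<odot> f') \<odot> (a \<odot> a')" using a comp_ident_right comp_in_hom t' b by metis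
    also have "\<dots> = ((b' \<odot> f') \<odot> a) \<odot> a'" using comp_assoc[OF a(2,1) comp_in_hom[OF t'(1) b(2)]] by simp
    also have "(b' \<odot> f') \<odot> a = (b' \<odot> b) \<odot> f"
      using comp_assoc[OF a(1) t'(1) b(2)] comp_assoc[OF t(1) b(1,2)] assms(6) by simp
    also have "\<dots> = f" using b comp_ident_left t by simp
    finally show ?thesis .
  qed
  then obtain c' where c': "c' \<in> hom D Z' Z" "c' \<odot> g' = g \<odot> b'" "shift_mor D a' \<odot> h' = h \<odot> c'"
    using TR3[OF T' T a(2) b(2)] by blast
  have "is_iso D Z Z (c' \<odot> c)"
  proof (rule triangle_endo_iso_aux[OF T comp_in_hom[OF assms(5) c'(1)]])
    show "c' \<odot> c \<odot> g = g"
    proof -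
      have "c' \<odot> c \<odot> g = c' \<odot> (g' \<odot> b)" using comp_assoc[OF t(2) assms(5) c'(1)] assms by simp
      also have "\<dots> = (c' \<odot> g') \<odot> b" using comp_assoc[OF b(1) t'(2) c'(1)] by simp
      also have "\<dots> = g \<odot> (b' \<odot> b)" using comp_assoc[OF b(1,2) t(2)] c' by simp
      finally show ?thesis using b comp_ident_right t by simp
    qed
    show "h \<odot> (c' \<odot> c) = h"
    proof -
      have "h \<odot> (c' \<odot> c) = (shift_mor D a' \<odot> h') \<odot> c" using comp_assoc[OF assms(5) c'(1) t(3)] c' by simp
      also have "\<dots> = shift_mor D a' \<odot> (shift_mor D a \<odot> h)"
        using comp_assoc[OF assms(5) t'(3) shift_hom[OF a(2)]] assms by simp
      also have "\<dots> = shift_mor D (a' \<odot> a) \<odot> h"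
        using comp_assoc[OF t(3) shift_hom[OF a(1)] shift_hom[OF a(2)]] shift_comp[OF a(1,2)] by simp
      finally show ?thesis using a comp_ident_left t by (simp add: shift_ident)
    qed
  qed
  moreover have "is_iso D Z' Z' (c \<odot> c')"
  proof (rule triangle_endo_iso_aux[OF T' comp_in_hom[OF c'(1) assms(5)]])
    show "c \<odot> c' \<odot> g' = g'"
    proof -
      have "c \<odot> c' \<odot> g' = c \<odot> (g \<odot> b')" using comp_assoc[OF t'(2) c'(1) assms(5)] c' by simp
      also have "\<dots> = (c \<odot> g) \<odot> b'" using comp_assoc[OF b(2) t(2) assms(5)] by simp
      also have "\<dots> = g' \<odot> (b \<odot> b')" using comp_assoc[OF b(2,1) t'(2)] assms by simp
      finally show ?thesis using b comp_ident_right t' by simp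
    qed
    show "h' \<odot> (c \<odot> c') = h'"
    proof -
      have "h' \<odot> (c \<odot> c') = (shift_mor D a \<odot> h) \<odot> c'" using comp_assoc[OF c'(1) assms(5) t'(3)] assms by simp
      also have "\<dots> = shift_mor D a \<odot> (shift_mor D a' \<odot> h')"
        using comp_assoc[OF c'(1) t(3) shift_hom[OF a(1)]] c' by simp
      also have "\<dots> = shift_mor D (a \<odot> a') \<odot> h'"
        using comp_assoc[OF t'(3) shift_hom[OF a(2)] shift_hom[OF a(1)]] shift_comp[OF a(2,1)] by simp
      finally show ?thesis using a comp_ident_left t' by (simp add: shift_ident)
    qed
  qed
  ultimately show ?thesis using is_iso_of_two_sided[OF assms(5)] c'(1) by blast
qed

lemma triangle_first_iso:
  assumes T: "triangle D X Y Z f g h" and T': "triangle D X' Y' Z' f' g' h'"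
    and "a \<in> hom D X X'" "is_iso D Y Y' b" "is_iso D Z Z' c"
    and "b \<odot> f = f' \<odot> a" "c \<odot> g = g' \<odot> b" "shift_mor D a \<odot> h = h' \<odot> c"
  shows "is_iso D X X' a"
proof -
  note t = triangle_hom[OF T] and t' = triangle_hom[OF T']
  have b: "b \<in> hom D Y Y'" using assms is_iso_hom by blast
  have "shift_mor D b \<odot> shift_mor D f = shift_mor D f' \<odot> shift_mor D a"
    using assms(3,6) b t(1) t'(1) by (simp add: shift_comp[symmetric])
  then have "shift_mor D b \<odot> (- shift_mor D f) = (- shift_mor D f') \<odot> shift_mor D a"
    using comp_neg_right[OF shift_hom[OF t(1)] shift_hom[OF b]]
      comp_neg_left[OF shift_hom[OF assms(3)] shift_hom[OF t'(1)]] by simp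
  then have "is_iso D (shift D X) (shift D X') (shift_mor D a)"
    by (rule triangle_third_iso[OF triangle_rotate[OF T] triangle_rotate[OF T'] assms(4,5) shift_hom[OF assms(3)]
          assms(7,8)])
  then show ?thesis using shift_iso_iff assms(3) by blast
qed

text \<open>A section of \<open>g\<close> and a retraction of \<open>f\<close> found separately need
  not be orthogonal. The retraction is chosen anew by factoring 1 - s g through \<open>f\<close>;
  the first one serves to cancel \<open>f\<close> on the left.\<close>

lemma biproduct_of_triangle:
  assumes "triangle D X Y Z f g 0"
  shows "\<exists>r s. r \<in> hom D Y X \<and> s \<in> hom D Z Y \<and> r \<odot> f = ident D X \<and> g \<odot> s = ident D Z \<and>
    g \<odot> f = 0 \<and> r \<odot> s = 0 \<and> f \<odot> r + s \<odot> g = ident D Y"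
proof -
  note t = triangle_hom[OF assms]
  obtain s where s: "s \<in> hom D Z Y" "ident D Z = g \<odot> s"
    using triangle_lift_second[OF assms ident_in_hom] comp_zero_left[OF ident_in_hom[of Z]] by blast
  obtain r where r: "r \<in> hom D Y X" "ident D X = r \<odot> f"
    using triangle_extend_first[OF assms ident_in_hom]
      comp_zero_right[OF shift_hom[OF ident_in_hom[of X]]] by blast
  have gf: "g \<odot> f = 0" by (rule triangle_comp_zero[OF assms])
  define d where "d = ident D Y - s \<odot> g"
  have d: "d \<in> hom D Y Y" unfolding d_def using s t by (auto intro: hom_intros)
  have "g \<odot> d = g - g \<odot> (s \<odot> g)" unfolding d_def
    using comp_diff_right[OF ident_in_hom comp_in_hom[OF t(2) s(1)] t(2)] comp_ident_right[OF t(2)] by simp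
  also have "g \<odot> (s \<odot> g) = g" using comp_assoc[OF t(2) s(1) t(2)] s comp_ident_left[OF t(2)] by simp
  finally have "g \<odot> d = 0" by simp
  then obtain r' where r': "r' \<in> hom D Y X" "d = f \<odot> r'"
    using triangle_lift_first[OF assms d] by blast
  have mono: "u = v" if "u \<in> hom D E X" "v \<in> hom D E X" "f \<odot> u = f \<odot> v" for u v E
  proof -
    have "(r \<odot> f) \<odot> u = (r \<odot> f) \<odot> v"
      using comp_assoc[OF that(1) t(1) r(1)] comp_assoc[OF that(2) t(1) r(1)] that by simp
    then show ?thesis using r(2)[symmetric] comp_ident_left that by simp
  qed
  have "f \<odot> (r' \<odot> f) = d \<odot> f" using comp_assoc[OF t(1) r'(1) t(1)] r' by simp
  also have "\<dots> = f - s \<odot> (g \<odot> f)" unfolding d_def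
    using comp_diff_left[OF t(1) ident_in_hom comp_in_hom[OF t(2) s(1)]] comp_ident_left[OF t(1)]
      comp_assoc[OF t(1,2) s(1)] by simp
  also have "\<dots> = f \<odot> ident D X" using gf s t comp_ident_right by simp
  finally have 1: "r' \<odot> f = ident D X" using mono comp_in_hom[OF t(1) r'(1)] ident_in_hom by blast
  have "f \<odot> (r' \<odot> s) = d \<odot> s" using comp_assoc[OF s(1) r'(1) t(1)] r' by simp
  also have "\<dots> = s - s \<odot> (g \<odot> s)" unfolding d_def
    using comp_diff_left[OF s(1) ident_in_hom comp_in_hom[OF t(2) s(1)]] comp_ident_left[OF s(1)]
      comp_assoc[OF s(1) t(2) s(1)] by simp
  also have "\<dots> = f \<odot> 0" using s(2)[symmetric] s(1) t comp_ident_right by simp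
  finally have 2: "r' \<odot> s = 0" using mono[OF comp_in_hom[OF s(1) r'(1)] zero_in_hom] by blast
  have "f \<odot> r' + s \<odot> g = ident D Y" using r'(2) unfolding d_def by (simp add: algebra_simps)
  then show ?thesis using r' s 1 2 gf by metis
qed

lemma split_triangle:
  assumes "triangle D X Y Z f g 0"
  shows "is_direct_sum D [X, Z] Y"
  using biproduct_of_triangle[OF assms] biproductI triangle_hom[OF assms] by metis

lemma split_mono_triangle:
  assumes "triangle D X Y Z f g h" "r \<in> hom D Y X" "r \<odot> f = ident D X"
  shows "h = 0"
proof -
  note t = triangle_hom[OF assms(1)]
  have "h = shift_mor D (r \<odot> f) \<odot> h" using assms(3) t comp_ident_left by (simp add: shift_ident)
  also have "\<dots> = shift_mor D r \<odot> (shift_mor D f \<odot> h)"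
    using comp_assoc[OF t(3) shift_hom[OF t(1)] shift_hom[OF assms(2)]] shift_comp[OF t(1) assms(2)] by simp
  also have "\<dots> = 0" using triangle_comp_zero2(2)[OF assms(1)] comp_zero_right[OF shift_hom[OF assms(2)]] by simp
  finally show ?thesis .
qed

lemma split_epi_triangle:
  assumes "triangle D X Y Z f g h" "s \<in> hom D Z Y" "g \<odot> s = ident D Z"
  shows "h = 0"
proof -
  note t = triangle_hom[OF assms(1)]
  have "h = (h \<odot> g) \<odot> s" using comp_assoc[OF assms(2) t(2,3)] assms(3) comp_ident_right[OF t(3)] by simp
  then show ?thesis using triangle_comp_zero2(1)[OF assms(1)] comp_zero_left[OF assms(2)] by simp
qed

lemma split_mono_direct_sum:
  assumes "f \<in> hom D X Y" "r \<in> hom D Y X" "r \<odot> f = ident D X"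
  shows "\<exists>Z g s r'. is_direct_sum D [X, Z] Y \<and> g \<in> hom D Y Z \<and> s \<in> hom D Z Y \<and> r' \<in> hom D Y X \<and>
    g \<odot> s = ident D Z \<and> f \<odot> r' + s \<odot> g = ident D Y"
proof -
  obtain Z g h where t: "triangle D X Y Z f g h" using TR1_cone[OF assms(1)] by blast
  then have "triangle D X Y Z f g 0" using split_mono_triangle[OF t assms(2,3)] by simp
  then show ?thesis using split_triangle biproduct_of_triangle triangle_hom by metis
qed

lemma summandI:
  assumes "f \<in> hom D X Y" "r \<in> hom D Y X" "r \<odot> f = ident D X"
  shows "direct_summand D X Y"
  using split_mono_direct_sum[OF assms] unfolding direct_summand_def by blast

text \<open>Completing the zero map B -> A[1] gives a triangle whose middle term is a biproduct of
  \<open>A\<close> and \<open>B\<close>; uniqueness of biproducts transports it to the given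
  \<open>S\<close>.\<close>

lemma triangle_of_direct_sum:
  assumes "is_direct_sum D [A, B] S"
  shows "\<exists>i p. triangle D A S B i p 0"
proof -
  obtain S' f g where t: "triangle D A S' B f g 0" using triangle_cocone[OF zero_in_hom] by blast
  note th = triangle_hom[OF t]
  obtain k where "is_iso D S' S k"
    using biproduct_unique[OF split_triangle[OF t] assms] unfolding isomorphic_def by blast
  then obtain l where k: "k \<in> hom D S' S" "l \<in> hom D S S'" "l \<odot> k = ident D S'" "k \<odot> l = ident D S"
    and iso: "is_iso D S' S k" using is_isoE by metis
  have "triangle D A S B (k \<odot> f) (g \<odot> l) 0"
  proof (rule TR1_iso[OF t is_iso_ident iso is_iso_ident])
    show "k \<odot> f = k \<odot> f \<odot> ident D A" using comp_ident_right[OF comp_in_hom[OF th(1) k(1)]] by simp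
    have "g \<odot> l \<odot> k = g" using comp_assoc[OF k(1,2) th(2)] k comp_ident_right[OF th(2)] by simp
    then show "ident D B \<odot> g = g \<odot> l \<odot> k" using comp_ident_left[OF th(2)] by simp
    show "shift_mor D (ident D A) \<odot> 0 = 0 \<odot> ident D B"
      using comp_zero_left[OF ident_in_hom[of B]] comp_zero_right[OF ident_in_hom] shift_ident by metis
  qed (use k th in \<open>auto intro: comp_in_hom\<close>)
  then show ?thesis by blast
qed

lemma direct_sum_list_exists: "\<exists>S. is_direct_sum D As S"
proof (induction As)
  case Nil
  show ?case using zero_object_exists direct_sum_Nil by blast
next
  case (Cons A As)
  then obtain S' where S': "is_direct_sum D As S'" by blast
  obtain S where "is_direct_sum D [A, S'] S" using direct_sum_exists by blast
  then show ?case using direct_sum_compose[OF S'] by blast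
qed

text \<open>Conjugation by minus the identity on the middle object. It repairs signs left by three
  rotations.\<close>

lemma triangle_negate:
  assumes "triangle D X Y Z f g h"
  shows "triangle D X Y Z (- f) (- g) h"
proof (rule TR1_iso[OF assms is_iso_ident _ is_iso_ident])
  note t = triangle_hom[OF assms]
  show "is_iso D Y Y (- ident D Y)"
    by (rule is_isoI[of _ _ _ "- ident D Y"])
      (auto simp: comp_neg_left[OF neg_in_hom[OF ident_in_hom] ident_in_hom]
        comp_neg_right[OF ident_in_hom ident_in_hom] comp_ident_left[OF ident_in_hom]
        intro: neg_in_hom ident_in_hom)
  show "(- ident D Y) \<odot> f = (- f) \<odot> ident D X"
    using comp_neg_left[OF t(1) ident_in_hom] comp_neg_left[OF ident_in_hom t(1)]
      comp_ident_left[OF t(1)] comp_ident_right[OF t(1)] by simp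
  show "ident D Z \<odot> g = (- g) \<odot> (- ident D Y)"
    using comp_neg_left[OF neg_in_hom[OF ident_in_hom] t(2)] comp_neg_right[OF ident_in_hom t(2)]
      comp_ident_left[OF t(2)] comp_ident_right[OF t(2)] by simp
  show "shift_mor D (ident D X) \<odot> h = h \<odot> ident D Z"
    using comp_ident_left[OF t(3)] comp_ident_right[OF t(3)] by (simp add: shift_ident)
qed (use triangle_hom[OF assms] in \<open>auto intro: neg_in_hom\<close>)

text \<open>The octahedral axiom, applied to \<open>M \<rightarrow> A[1] \<rightarrow> C[1]\<close>, yields a triangle
  \<open>B[1] \<rightarrow> F[1] \<rightarrow> Z[1]\<close>, which splits because \<open>Z \<rightarrow> B[1]\<close> vanishes.\<close>

lemma pushout_triangle:
  assumes T1: "triangle D A C Z a c z" and T2: "triangle D A B M b m q"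
    and zero: "shift_mor D b \<odot> z = 0"
  shows "\<exists>F f g. is_direct_sum D [B, Z] F \<and> triangle D C F M f g (shift_mor D a \<odot> q)"
proof -
  note t1 = triangle_hom[OF T1] and t2 = triangle_hom[OF T2]
  have w: "shift_mor D a \<odot> q \<in> hom D M (shift D C)"
    using t1 t2 by (auto intro: comp_in_hom shift_hom)
  obtain F f g where F: "triangle D C F M f g (shift_mor D a \<odot> q)" using triangle_cocone[OF w] by blast
  note R1 = triangle_rotate[OF triangle_rotate[OF T2]]
  \<comment> \<open>Three rotations put a sign on every map. The composite of the first maps of
    \<open>R1\<close> and \<open>R2\<close> has to be the first map
    \<open>shift_mor D a \<odot> q\<close> of \<open>R3\<close>, so the sign on the shift of
    \<open>a\<close> must be removed.\<close>
  note R2 = triangle_negate[OF triangle_rotate[OF triangle_rotate[OF triangle_rotate[OF T1]]], unfolded minus_minus]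
  note R3 = triangle_rotate[OF triangle_rotate[OF F]]
  have zb: "z \<in> hom D Z (shift D A)" "shift_mor D b \<in> hom D (shift D A) (shift D B)"
    using t1 t2 shift_hom by auto
  have "shift_mor D (- shift_mor D b) \<odot> (- shift_mor D z) = shift_mor D (shift_mor D b) \<odot> shift_mor D z"
    using comp_neg_left[OF neg_in_hom[OF shift_hom[OF zb(1)]] shift_hom[OF zb(2)]]
      comp_neg_right[OF shift_hom[OF zb(1)] shift_hom[OF zb(2)]] shift_neg[OF zb(2)] by simp
  also have "\<dots> = 0" using shift_comp[OF zb] zero by simp
  finally have "\<exists>\<alpha> \<beta>. triangle D (shift D B) (shift D F) (shift D Z) \<alpha> \<beta> 0"
    using TR4[OF R1 R2 R3] by metis
  then have "is_direct_sum D [B, Z] F" using split_triangle biproduct_of_shift by blast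
  then show ?thesis using F by blast
qed

end

section \<open>Additive closures and approximations\<close>

context k_linear_triangulated_category
begin

lemma triangle_cocone_second:
  assumes "g \<in> hom D Y Z"
  shows "\<exists>X f h. triangle D X Y Z f g h"
proof -
  obtain W p q where W: "triangle D Y Z W g p q" using TR1_cone[OF assms] by blast
  note Wh = triangle_hom[OF W]
  obtain X i where "is_iso D (shift D X) W i"
    using autoequivalence_essentially_surjective[OF shift_autoequivalence, of W]
    unfolding isomorphic_def by blast
  then obtain i' where i: "i \<in> hom D (shift D X) W" "i' \<in> hom D W (shift D X)" "i \<odot> i' = ident D W"
    and iso: "is_iso D W (shift D X) i'" using is_isoE by metis
  have qi: "q \<odot> i \<in> hom D (shift D X) (shift D Y)" using Wh i by (auto intro: comp_in_hom)
  have t: "triangle D Y Z (shift D X) g (i' \<odot> p) (q \<odot> i)"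
  proof (rule TR1_iso[OF W is_iso_ident is_iso_ident iso assms comp_in_hom[OF Wh(2) i(2)] qi])
    show "ident D Z \<odot> g = g \<odot> ident D Y" using comp_ident_left comp_ident_right assms by metis
    show "i' \<odot> p = i' \<odot> p \<odot> ident D Z"
      using comp_ident_right[OF comp_in_hom[OF Wh(2) i(2)]] by simp
    have "q \<odot> i \<odot> i' = q \<odot> (i \<odot> i')" by (rule comp_assoc[OF i(2,1) Wh(3)])
    then show "shift_mor D (ident D Y) \<odot> q = q \<odot> i \<odot> i'"
      using i comp_ident_right[OF Wh(3)] comp_ident_left[OF Wh(3)] by (simp add: shift_ident)
  qed
  obtain f where f: "f \<in> hom D X Y" "- (q \<odot> i) = shift_mor D f"
    using shift_full neg_in_hom[OF qi] by blast
  then have "q \<odot> i = - shift_mor D f" by (metis minus_minus)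
  then show ?thesis using t TR2[OF f(1)] by metis
qed

lemma power_sumE:
  assumes "is_direct_sum D (replicate n M) S"
  obtains \<iota> \<pi> :: "nat \<Rightarrow> 'm" where "\<forall>i < n. \<iota> i \<in> hom D M S" "\<forall>i < n. \<pi> i \<in> hom D S M"
    "\<forall>i<n. \<forall>j<n. \<pi> j \<odot> \<iota> i = (if i = j then ident D M else 0)"
    "(\<Sum>i < n. \<iota> i \<odot> \<pi> i) = ident D S"
proof -
  from assms obtain \<iota> \<pi> :: "nat \<Rightarrow> 'm" where
    "\<forall>i < length (replicate n M). \<iota> i \<in> hom D (replicate n M ! i) S"
    "\<forall>i < length (replicate n M). \<pi> i \<in> hom D S (replicate n M ! i)"
    "\<forall>i < length (replicate n M). \<forall>j < length (replicate n M).
      \<pi> j \<odot> \<iota> i = (if i = j then ident D (replicate n M ! i) else 0)"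
    "(\<Sum>i < length (replicate n M). \<iota> i \<odot> \<pi> i) = ident D S"
    by (rule direct_sumE)
  then show ?thesis by (intro that[of \<iota> \<pi>]) simp_all
qed

lemma ident_power_thru:
  assumes "is_direct_sum D (replicate n M) S"
  shows "ident D S \<in> thru M S S"
proof -
  obtain \<iota> \<pi> :: "nat \<Rightarrow> 'm" where *: "\<forall>i < n. \<iota> i \<in> hom D M S" "\<forall>i < n. \<pi> i \<in> hom D S M"
    "(\<Sum>i < n. \<iota> i \<odot> \<pi> i) = ident D S" using assms by (rule power_sumE)
  show ?thesis unfolding *(3)[symmetric] by (intro thru_sum thru_base) (use * in auto)
qed

lemma thru_factors_power:
  assumes "f \<in> thru M X Y"
  shows "\<exists>n S. is_direct_sum D (replicate n M) S \<and> (\<exists>a \<in> hom D X S. \<exists>b \<in> hom D S Y. f = b \<odot> a)"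
proof -
  obtain n :: nat and a b where ab: "\<forall>i<n. a i \<in> hom D X M \<and> b i \<in> hom D M Y"
    "f = (\<Sum>i<n. b i \<odot> a i)" using thru_finite_sum[OF assms] by blast
  obtain S where S: "is_direct_sum D (replicate n M) S" using direct_sum_list_exists by blast
  then obtain \<iota> \<pi> :: "nat \<Rightarrow> 'm" where *: "\<forall>i < n. \<iota> i \<in> hom D M S" "\<forall>i < n. \<pi> i \<in> hom D S M"
    "\<forall>i<n. \<forall>j<n. \<pi> j \<odot> \<iota> i = (if i = j then ident D M else 0)"
    by (rule power_sumE)
  have "(\<Sum>i<n. b i \<odot> \<pi> i) \<odot> (\<Sum>i<n. \<iota> i \<odot> a i) = (\<Sum>i<n. b i \<odot> a i)"
    by (rule comp_sum_orthogonal[of "replicate n M" b Y \<pi> S \<iota> a X, unfolded length_replicate])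
      (use * ab in simp_all)
  moreover have "(\<Sum>i<n. \<iota> i \<odot> a i) \<in> hom D X S"
    by (intro sum_in_hom comp_in_hom[of _ _ M]) (use * ab in simp_all)
  moreover have "(\<Sum>i<n. b i \<odot> \<pi> i) \<in> hom D S Y"
    by (intro sum_in_hom comp_in_hom[of _ _ M]) (use * ab in simp_all)
  ultimately show ?thesis using ab(2) S by (intro exI conjI bexI) simp_all
qed

text \<open>If the identity factors through a power of \<open>M\<close>, then \<open>X\<close> is a
  split subobject of that power, and a split monomorphism has a complement, namely its cone. With
  this criterion later arguments about add M manipulate composites instead of direct sums.\<close>

lemma in_add_closure_iff: "X \<in> add_closure D M \<longleftrightarrow> ident D X \<in> thru M X X"
proof
  assume "X \<in> add_closure D M"
  then obtain n S where S: "is_direct_sum D (replicate n M) S" and "direct_summand D X S"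
    unfolding add_closure_def by blast
  then obtain B where "is_direct_sum D [X, B] S" unfolding direct_summand_def by blast
  then obtain i p j q where ip: "i \<in> hom D X S" "p \<in> hom D S X" "j \<in> hom D B S" "q \<in> hom D S B"
    "p \<odot> i = ident D X" by (rule biproductE)
  have "p \<odot> (ident D S \<odot> i) \<in> thru M X X"
    by (rule thru_comp_left[OF thru_comp_right[OF ident_power_thru[OF S] ip(1)] ip(2)])
  then show "ident D X \<in> thru M X X" using ip comp_ident_left by simp
next
  assume "ident D X \<in> thru M X X"
  then obtain n S a b where S: "is_direct_sum D (replicate n M) S" "a \<in> hom D X S" "b \<in> hom D S X"
    "ident D X = b \<odot> a" using thru_factors_power by blast
  then have "direct_summand D X S" using summandI[of a X S b] by simp
  then show "X \<in> add_closure D M" unfolding add_closure_def using S(1) by blast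
qed

lemma power_in_add_closure: "is_direct_sum D (replicate n M) S \<Longrightarrow> S \<in> add_closure D M"
  using ident_power_thru in_add_closure_iff by blast

lemma thru_factors:
  "f \<in> thru M X Y \<Longrightarrow> \<exists>W \<in> add_closure D M. \<exists>a \<in> hom D X W. \<exists>b \<in> hom D W Y. f = b \<odot> a"
  using thru_factors_power power_in_add_closure by blast

lemma thru_via:
  assumes "W \<in> add_closure D M" "a \<in> hom D X W" "b \<in> hom D W Y"
  shows "b \<odot> a \<in> thru M X Y"
proof -
  have "a \<in> thru M X W" using thru_of_ident_target assms in_add_closure_iff by blast
  then show ?thesis using thru_comp_left assms by blast
qed

lemma factoring_eq_thru: "factoring D M X Y = thru M X Y"
  unfolding factoring_def using thru_factors thru_via by blast

lemma add_closure_self: "M \<in> add_closure D M"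
  using in_add_closure_iff thru_self by blast

lemma add_closure_trans: "X \<in> add_closure D M \<Longrightarrow> M \<in> add_closure D N \<Longrightarrow> X \<in> add_closure D N"
  using in_add_closure_iff thru_mono by blast

lemma add_closure_retract:
  assumes "f \<in> hom D X Y" "r \<in> hom D Y X" "r \<odot> f = ident D X" "Y \<in> add_closure D M"
  shows "X \<in> add_closure D M"
  using thru_via[OF assms(4,1,2)] assms(3) in_add_closure_iff by simp

lemma add_closure_summand:
  assumes "is_direct_sum D [A, B] S"
  shows "A \<in> add_closure D S" "B \<in> add_closure D S"
proof -
  obtain i p j q where *: "i \<in> hom D A S" "p \<in> hom D S A" "j \<in> hom D B S" "q \<in> hom D S B"
    "p \<odot> i = ident D A" "q \<odot> j = ident D B" using assms by (rule biproductE)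
  show "A \<in> add_closure D S" by (rule add_closure_retract[OF *(1,2,5) add_closure_self])
  show "B \<in> add_closure D S" by (rule add_closure_retract[OF *(3,4,6) add_closure_self])
qed

lemma add_closure_direct_sum:
  assumes "is_direct_sum D [A, B] S" "A \<in> add_closure D M" "B \<in> add_closure D M"
  shows "S \<in> add_closure D M"
proof -
  obtain i p j q where *: "i \<in> hom D A S" "p \<in> hom D S A" "j \<in> hom D B S" "q \<in> hom D S B"
    "i \<odot> p + j \<odot> q = ident D S" using assms(1) by (rule biproductE)
  then show ?thesis using thru_add[OF thru_via[OF assms(2) *(2,1)] thru_via[OF assms(3) *(4,3)]]
    in_add_closure_iff by simp
qed

lemma zero_object_add_closure: "zero_object D Z \<Longrightarrow> Z \<in> add_closure D M"
  using in_add_closure_iff zero_object_iff thru_zero by metis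

lemma thru_shift: "f \<in> thru M X Y \<Longrightarrow> shift_mor D f \<in> thru (shift D M) (shift D X) (shift D Y)"
proof (induction rule: thru_induct)
  case zero
  show ?case by (simp add: thru_zero)
next
  case (step a b y)
  have "shift_mor D (b \<odot> a + y) = shift_mor D b \<odot> shift_mor D a + shift_mor D y"
    using step shift_add[OF comp_in_hom[OF step(1,2)]] shift_comp by simp
  then show ?case using thru_add[OF thru_base[OF shift_hom[OF step(1)] shift_hom[OF step(2)]] step(4)] by simp
qed

lemma shift_add_closure: "X \<in> add_closure D M \<Longrightarrow> shift D X \<in> add_closure D (shift D M)"
  using in_add_closure_iff thru_shift shift_ident by metis

text \<open>Maps out of add M are sums of composites through \<open>M\<close>, and lifts of such
  composites can be added, so lifting from \<open>M\<close> alone is enough.\<close>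

lemma right_approxI:
  assumes "M0 \<in> add_closure D M" "f \<in> hom D M0 E"
    and "\<And>v. v \<in> hom D M E \<Longrightarrow> \<exists>w \<in> hom D M M0. v = f \<odot> w"
  shows "right_approx D M M0 E f"
proof -
  have "\<exists>w \<in> hom D V M0. v = f \<odot> w" if "v \<in> thru M V E" for V v
    using that
  proof (induction rule: thru_induct)
    case zero
    show ?case using assms(2) comp_zero_right zero_in_hom by metis
  next
    case (step a b y)
    obtain w where w: "w \<in> hom D M M0" "b = f \<odot> w" using assms(3) step by blast
    obtain w' where w': "w' \<in> hom D V M0" "y = f \<odot> w'" using step by blast
    have "b \<odot> a + y = f \<odot> (w \<odot> a + w')"
      using comp_add_right[OF comp_in_hom[OF step(1) w(1)] w'(1) assms(2)]
        comp_assoc[OF step(1) w(1) assms(2)] w w' by simp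
    then show ?case using w w' step by (blast intro: add_in_hom comp_in_hom)
  qed
  then show ?thesis unfolding right_approx_def
    using assms(1,2) thru_of_ident_source in_add_closure_iff by blast
qed

lemma right_approx_exists:
  assumes "hom_finite D"
  shows "\<exists>M0 f. right_approx D M M0 E f"
proof -
  obtain S where S: "finite S" "hom D M E = vs.span S" using assms unfolding hom_finite_def by blast
  obtain xs where xs: "set xs = S" "distinct xs" using finite_distinct_list[OF S(1)] by blast
  define n where "n = length xs"
  have xh: "xs ! i \<in> hom D M E" if "i < n" for i
    using that xs S vs.span_base unfolding n_def by fastforce
  obtain M0 where M0: "is_direct_sum D (replicate n M) M0" using direct_sum_list_exists by blast
  then obtain \<iota> \<pi> :: "nat \<Rightarrow> 'm" where *: "\<forall>i < n. \<iota> i \<in> hom D M M0" "\<forall>i < n. \<pi> i \<in> hom D M0 M"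
    "\<forall>i<n. \<forall>j<n. \<pi> j \<odot> \<iota> i = (if i = j then ident D M else 0)"
    "(\<Sum>i < n. \<iota> i \<odot> \<pi> i) = ident D M0"
    by (rule power_sumE)
  have M0_add: "M0 \<in> add_closure D M" by (rule power_in_add_closure[OF M0])
  \<comment> \<open>The components of \<open>f\<close> run through a finite spanning set of Hom(M,
    E), so a lift of \<open>v\<close> is given by its coefficients times the identity of
    \<open>M\<close>.\<close>
  define f where "f = (\<Sum>i<n. xs ! i \<odot> \<pi> i)"
  have f: "f \<in> hom D M0 E" unfolding f_def
    by (intro sum_in_hom comp_in_hom[of _ _ M]) (use * xh in simp_all)
  have "\<exists>w \<in> hom D M M0. v = f \<odot> w" if v: "v \<in> hom D M E" for v
  proof -
    obtain u where "v = (\<Sum>s\<in>S. scale D (u s) s)" using v S vs.span_finite by auto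
    also have "\<dots> = (\<Sum>i<n. scale D (u (xs ! i)) (xs ! i))"
      using sum.reindex_bij_betw[OF bij_betw_nth[OF xs(2) refl xs(1)[symmetric]],
          of "\<lambda>s. scale D (u s) s"] unfolding n_def by simp
    also have "\<dots> = (\<Sum>i<n. xs ! i \<odot> scale D (u (xs ! i)) (ident D M))"
      by (intro sum.cong) (simp_all add: comp_scale_right[OF ident_in_hom xh] comp_ident_right[OF xh])
    also have "\<dots> = f \<odot> (\<Sum>i<n. \<iota> i \<odot> scale D (u (xs ! i)) (ident D M))"
      unfolding f_def
      by (rule comp_sum_orthogonal[of "replicate n M" "\<lambda>i. xs ! i" E \<pi> M0 \<iota>
            "\<lambda>i. scale D (u (xs ! i)) (ident D M)" M, unfolded length_replicate, symmetric])
        (use * xh in \<open>simp_all add: scale_in_hom ident_in_hom\<close>)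
    finally have "v = f \<odot> (\<Sum>i<n. \<iota> i \<odot> scale D (u (xs ! i)) (ident D M))" .
    moreover have "(\<Sum>i<n. \<iota> i \<odot> scale D (u (xs ! i)) (ident D M)) \<in> hom D M M0"
      by (intro sum_in_hom comp_in_hom[of _ _ M]) (use * in \<open>simp_all add: scale_in_hom ident_in_hom\<close>)
    ultimately show ?thesis by blast
  qed
  then show ?thesis using right_approxI[OF M0_add f] by blast
qed

end

section \<open>Ghost morphisms\<close>

locale krull_schmidt_triangulated_category = k_linear_triangulated_category D
  for D :: "('k::field, 'o, 'm::ab_group_add, 'z) tri_cat_scheme" (structure) +
  assumes krull_schmidt: "krull_schmidt D"
    and hom_finite: "hom_finite D"

locale cluster_tilted_category = krull_schmidt_triangulated_category D
  for D :: "('k::field, 'o, 'm::ab_group_add, 'z) tri_cat_scheme" (structure) +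
  fixes T :: 'o
  assumes cluster_tilting: "cluster_tilting D T"
begin

lemma add_T_iff: "V \<in> add_closure D T \<longleftrightarrow> hom D T (shift D V) = {0}"
  using cluster_tilting unfolding cluster_tilting_def by blast

lemma hom_add_T_shift:
  assumes "W \<in> add_closure D T" "V \<in> add_closure D T" "f \<in> hom D W (shift D V)"
  shows "f = 0"
proof -
  have "f \<in> thru T W (shift D V)" using assms thru_of_ident_source in_add_closure_iff by blast
  then show ?thesis
  proof (induction rule: thru_induct)
    case (step a b y)
    then have "b = 0" using assms(2) add_T_iff by blast
    then show ?case using step comp_zero_left by simp
  qed simp
qed

text \<open>The first syzygy of an add T-approximation stays in add T: a map from \<open>T\<close>
  to T1[1] dies in T0[1], so it comes from a map T -> X, which lifts to \<open>T0\<close> and is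
  killed by the next map of the triangle.\<close>

lemma T_presentation:
  "\<exists>T1 T0 a b c. triangle D T1 T0 X a b c \<and> T1 \<in> add_closure D T \<and> T0 \<in> add_closure D T"
proof -
  obtain T0 f where f: "right_approx D T T0 X f" using right_approx_exists[OF hom_finite] by blast
  then have fh: "f \<in> hom D T0 X" "T0 \<in> add_closure D T" unfolding right_approx_def by auto
  obtain T1 a c where t: "triangle D T1 T0 X a f c" using triangle_cocone_second[OF fh(1)] by blast
  note th = triangle_hom[OF t]
  have "x = 0" if x: "x \<in> hom D T (shift D T1)" for x
  proof -
    have "shift_mor D a \<odot> x = 0"
      using hom_add_T_shift[OF add_closure_self fh(2) comp_in_hom[OF x shift_hom[OF th(1)]]] .
    then obtain y where y: "y \<in> hom D T X" "x = c \<odot> y" using triangle_lift_third[OF t x] by blast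
    then obtain w where w: "w \<in> hom D T T0" "y = f \<odot> w"
      using f add_closure_self unfolding right_approx_def by blast
    have "x = (c \<odot> f) \<odot> w" using y w comp_assoc[OF w(1) th(2,3)] by simp
    then show ?thesis using triangle_comp_zero2[OF t] comp_zero_left w by simp
  qed
  then have "T1 \<in> add_closure D T" using add_T_iff by auto
  then show ?thesis using t fh by blast
qed

definition ghost :: "'o \<Rightarrow> 'o \<Rightarrow> 'm set" where
  "ghost X Y = {f \<in> hom D X Y. \<forall>t \<in> hom D T X. f \<odot> t = 0}"

lemma ghost_hom: "f \<in> ghost X Y \<Longrightarrow> f \<in> hom D X Y"
  unfolding ghost_def by blast

lemma zero_ghost: "0 \<in> ghost X Y"
  unfolding ghost_def by auto

lemma ghost_comp_left:
  assumes "f \<in> ghost X Y" "g \<in> hom D Y Z"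
  shows "g \<odot> f \<in> ghost X Z"
proof -
  have f: "f \<in> hom D X Y" by (rule ghost_hom[OF assms(1)])
  have "(g \<odot> f) \<odot> t = 0" if t: "t \<in> hom D T X" for t
    using comp_assoc[OF t f assms(2)] assms t comp_zero_right[OF assms(2)] unfolding ghost_def by simp
  then show ?thesis using comp_in_hom[OF f assms(2)] unfolding ghost_def by blast
qed

lemma ghost_comp_right:
  assumes "f \<in> ghost X Y" "g \<in> hom D W X"
  shows "f \<odot> g \<in> ghost W Y"
proof -
  have f: "f \<in> hom D X Y" by (rule ghost_hom[OF assms(1)])
  have "(f \<odot> g) \<odot> t = 0" if t: "t \<in> hom D T W" for t
    using comp_assoc[OF t assms(2) f] assms(1) comp_in_hom[OF t assms(2)] unfolding ghost_def by simp
  then show ?thesis using comp_in_hom[OF assms(2) f] unfolding ghost_def by blast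
qed

lemma ghost_into_shift_T: "V \<in> add_closure D T \<Longrightarrow> f \<in> hom D X (shift D V) \<Longrightarrow> f \<in> ghost X (shift D V)"
  unfolding ghost_def using hom_add_T_shift[OF add_closure_self] comp_in_hom by blast

lemma ghost_from_shift_T:
  assumes "V \<in> add_closure D T" "f \<in> hom D (shift D V) X"
  shows "f \<in> ghost (shift D V) X"
proof -
  have "f \<odot> t = 0" if "t \<in> hom D T (shift D V)" for t
    using hom_add_T_shift[OF add_closure_self assms(1) that] assms(2) by simp
  then show ?thesis unfolding ghost_def using assms by blast
qed

lemma ghost_comp_add_T:
  assumes "f \<in> ghost X Y" "V \<in> add_closure D T" "t \<in> hom D V X"
  shows "f \<odot> t = 0"
proof -
  have f: "f \<in> hom D X Y" using assms ghost_hom by blast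
  have "t \<in> thru T V X" using assms thru_of_ident_source in_add_closure_iff by blast
  then show ?thesis
  proof (induction rule: thru_induct)
    case (step a b y)
    have "f \<odot> b = 0" using assms(1) step unfolding ghost_def by blast
    then have "f \<odot> (b \<odot> a) = 0" using comp_assoc[OF step(1,2) f] comp_zero_left[OF step(1)] by simp
    then show ?case using comp_add_right[OF comp_in_hom[OF step(1,2)] step(3) f] step by simp
  qed (use f in simp)
qed

text \<open>In a presentation T1 -> T0 -> X -> T1[1] by objects of add T, a ghost map vanishes on
  \<open>T0\<close> and hence factors through T1[1].\<close>

lemma ghost_factors:
  assumes "f \<in> ghost X Y"
  shows "\<exists>V \<in> add_closure D T. \<exists>a \<in> hom D X (shift D V). \<exists>b \<in> hom D (shift D V) Y. f = b \<odot> a"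
proof -
  obtain T1 T0 a b c where t: "triangle D T1 T0 X a b c" "T1 \<in> add_closure D T" "T0 \<in> add_closure D T"
    using T_presentation by blast
  note th = triangle_hom[OF t(1)]
  have "f \<odot> b = 0" using ghost_comp_add_T assms t(3) th(2) by blast
  then obtain y where "y \<in> hom D (shift D T1) Y" "f = y \<odot> c"
    using triangle_extend_third[OF t(1) ghost_hom[OF assms]] by blast
  then show ?thesis using t th by blast
qed

lemma factoring_shift_T: "factoring D (shift D T) X Y = ghost X Y"
proof
  show "factoring D (shift D T) X Y \<subseteq> ghost X Y" unfolding factoring_eq_thru
  proof
    fix f assume "f \<in> thru (shift D T) X Y"
    then show "f \<in> ghost X Y"
    proof (induction rule: thru_induct)
      case (step a b y)
      have "b \<odot> a \<in> ghost X Y"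
        by (rule ghost_comp_right[OF ghost_from_shift_T[OF add_closure_self step(2)] step(1)])
      then have "b \<odot> a + y \<in> hom D X Y" "\<And>t. t \<in> hom D T X \<Longrightarrow> (b \<odot> a + y) \<odot> t = 0"
        using step(3,4) comp_add_left[of _ T X "b \<odot> a" Y y] unfolding ghost_def
        by (auto intro: add_in_hom)
      then show ?case unfolding ghost_def by blast
    qed (rule zero_ghost)
  qed
  show "ghost X Y \<subseteq> factoring D (shift D T) X Y" unfolding factoring_def
    using ghost_factors shift_add_closure by blast
qed

text \<open>For the converse, the cone of a right add M-approximation of \<open>Z\<close> provides
  the triangle: the map to the cone is ghost because every map from \<open>T\<close> factors through
  the approximation. The criterion mentions only maps from \<open>T\<close>, which makes
  \<open>rel_star\<close> accessible to composition arguments.\<close>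

lemma rel_star_iff: "Z \<in> rel_star D T M \<longleftrightarrow> hom D T Z \<subseteq> thru M T Z"
proof
  assume "Z \<in> rel_star D T M"
  then obtain MZ C m \<eta> c where t: "triangle D MZ Z C m \<eta> c" "MZ \<in> add_closure D M" "\<eta> \<in> ghost Z C"
    unfolding rel_star_def factoring_shift_T by blast
  show "hom D T Z \<subseteq> thru M T Z"
  proof
    fix x assume x: "x \<in> hom D T Z"
    then have "\<eta> \<odot> x = 0" using t unfolding ghost_def by blast
    then obtain y where "y \<in> hom D T MZ" "x = m \<odot> y" using triangle_lift_first[OF t(1) x] by blast
    then show "x \<in> thru M T Z" using thru_via[OF t(2) _ triangle_hom(1)[OF t(1)]] by blast
  qed
next
  assume *: "hom D T Z \<subseteq> thru M T Z"
  obtain MZ m where m: "right_approx D M MZ Z m" using right_approx_exists[OF hom_finite] by blast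
  then have mh: "m \<in> hom D MZ Z" "MZ \<in> add_closure D M" unfolding right_approx_def by auto
  obtain C \<eta> c where t: "triangle D MZ Z C m \<eta> c" using TR1_cone[OF mh(1)] by blast
  note th = triangle_hom[OF t]
  have "\<eta> \<odot> x = 0" if x: "x \<in> hom D T Z" for x
  proof -
    obtain W a b where W: "W \<in> add_closure D M" "a \<in> hom D T W" "b \<in> hom D W Z" "x = b \<odot> a"
      using x * thru_factors by blast
    obtain w where w: "w \<in> hom D W MZ" "b = m \<odot> w" using m W unfolding right_approx_def by blast
    have "x = m \<odot> (w \<odot> a)" using W w comp_assoc[OF W(2) w(1) mh(1)] by simp
    then have "\<eta> \<odot> x = (\<eta> \<odot> m) \<odot> (w \<odot> a)"
      using comp_assoc[OF comp_in_hom[OF W(2) w(1)] th(1,2)] by simp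
    then show ?thesis using triangle_comp_zero[OF t] comp_zero_left[OF comp_in_hom[OF W(2) w(1)]] by simp
  qed
  then have "\<eta> \<in> ghost Z C" unfolding ghost_def using th by blast
  then show "Z \<in> rel_star D T M" unfolding rel_star_def factoring_shift_T using t mh by blast
qed

text \<open>Factorizations compose: maps T -> Z through add N can be rerouted through add M as soon
  as maps T -> N can. So the inclusion of subcategories is tested on one object.\<close>

lemma rel_ge_iff: "rel_ge D T M N \<longleftrightarrow> N \<in> rel_star D T M"
proof
  assume "rel_ge D T M N"
  moreover have "N \<in> rel_star D T N"
    using rel_star_iff thru_of_ident_target[OF thru_self] by blast
  ultimately show "N \<in> rel_star D T M" unfolding rel_ge_def by blast
next
  assume *: "N \<in> rel_star D T M"
  show "rel_ge D T M N" unfolding rel_ge_def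
  proof
    fix Z assume Z: "Z \<in> rel_star D T N"
    show "Z \<in> rel_star D T M" unfolding rel_star_iff
    proof
      fix x assume "x \<in> hom D T Z"
      then have "x \<in> thru N T Z" using Z rel_star_iff by blast
      then show "x \<in> thru M T Z"
      proof (induction rule: thru_induct)
        case (step a b y)
        have "a \<in> thru M T N" using * step(1) rel_star_iff by blast
        then show ?case using thru_comp_left[OF _ step(2)] step(4) by (intro thru_add) blast+
      qed (rule thru_zero)
    qed
  qed
qed

text \<open>Rigidity of \<open>X\<close> is \<open>orth X X\<close>; separating the two arguments of
  this non-symmetric condition lets direct summands be treated one at a time.\<close>

definition orth :: "'o \<Rightarrow> 'o \<Rightarrow> bool" where
  "orth A B \<longleftrightarrow> ghost A (shift D B) = {0}"

lemma rel_rigid_iff: "rel_rigid D T X \<longleftrightarrow> orth X X"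
  unfolding rel_rigid_def orth_def factoring_shift_T by simp

lemma orthI: "(\<And>f. f \<in> ghost A (shift D B) \<Longrightarrow> f = 0) \<Longrightarrow> orth A B"
  unfolding orth_def using zero_ghost by blast

lemma orthD: "orth A B \<Longrightarrow> f \<in> ghost A (shift D B) \<Longrightarrow> f = 0"
  unfolding orth_def by blast

lemma orth_left:
  assumes "orth U B" "A \<in> add_closure D U"
  shows "orth A B"
proof (rule orthI)
  fix f assume f: "f \<in> ghost A (shift D B)"
  have "ident D A \<in> thru U A A" using assms in_add_closure_iff by blast
  then have "f \<odot> ident D A = 0"
  proof (induction rule: thru_induct)
    case zero
    then show ?case using ghost_hom[OF f] by simp
  next
    case (step a b y)
    have "f \<odot> b = 0" using orthD[OF assms(1)] ghost_comp_right[OF f step(2)] by blast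
    then have "f \<odot> (b \<odot> a) = 0"
      using comp_assoc[OF step(1,2) ghost_hom[OF f]] comp_zero_left[OF step(1)] by simp
    then show ?case using comp_add_right[OF comp_in_hom[OF step(1,2)] step(3) ghost_hom[OF f]] step by simp
  qed
  then show "f = 0" using comp_ident_right[OF ghost_hom[OF f]] by simp
qed

lemma orth_right:
  assumes "orth A U" "B \<in> add_closure D U"
  shows "orth A B"
proof (rule orthI)
  fix f assume f: "f \<in> ghost A (shift D B)"
  have "ident D (shift D B) \<in> thru (shift D U) (shift D B) (shift D B)"
    using assms shift_add_closure in_add_closure_iff by blast
  then have "ident D (shift D B) \<odot> f = 0"
  proof (induction rule: thru_induct)
    case zero
    then show ?case using ghost_hom[OF f] by simp
  next
    case (step a b y)
    have "a \<odot> f = 0" using orthD[OF assms(1)] ghost_comp_left[OF f step(1)] by blast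
    then have "(b \<odot> a) \<odot> f = 0"
      using comp_assoc[OF ghost_hom[OF f] step(1,2)] comp_zero_right[OF step(2)] by simp
    then show ?case using comp_add_left[OF ghost_hom[OF f] comp_in_hom[OF step(1,2)] step(3)] step by simp
  qed
  then show "f = 0" using comp_ident_left[OF ghost_hom[OF f]] by simp
qed

lemma orth_direct_sum_left:
  assumes "is_direct_sum D [A, B] S" "orth A E" "orth B E"
  shows "orth S E"
proof (rule orthI)
  fix f assume f: "f \<in> ghost S (shift D E)"
  obtain i p j q where *: "i \<in> hom D A S" "p \<in> hom D S A" "j \<in> hom D B S" "q \<in> hom D S B"
    "i \<odot> p + j \<odot> q = ident D S" using assms(1) by (rule biproductE)
  have "f \<odot> i = 0" "f \<odot> j = 0"
    using orthD[OF assms(2) ghost_comp_right[OF f *(1)]] orthD[OF assms(3) ghost_comp_right[OF f *(3)]] by auto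
  then have "f \<odot> (i \<odot> p) = 0" "f \<odot> (j \<odot> q) = 0"
    using comp_assoc[OF *(2,1) ghost_hom[OF f]] comp_assoc[OF *(4,3) ghost_hom[OF f]] * by auto
  then have "f \<odot> ident D S = 0"
    using comp_add_right[OF comp_in_hom[OF *(2,1)] comp_in_hom[OF *(4,3)] ghost_hom[OF f]] * by simp
  then show "f = 0" using comp_ident_right[OF ghost_hom[OF f]] by simp
qed

lemma orth_direct_sum_right:
  assumes "is_direct_sum D [A, B] S" "orth E A" "orth E B"
  shows "orth E S"
proof (rule orthI)
  fix f assume f: "f \<in> ghost E (shift D S)"
  obtain i p j q where *: "i \<in> hom D A S" "p \<in> hom D S A" "j \<in> hom D B S" "q \<in> hom D S B"
    "i \<odot> p + j \<odot> q = ident D S" using assms(1) by (rule biproductE)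
  note sh = *(1-4)[THEN shift_hom]
  have "shift_mor D p \<odot> f = 0" "shift_mor D q \<odot> f = 0"
    using orthD[OF assms(2) ghost_comp_left[OF f sh(2)]] orthD[OF assms(3) ghost_comp_left[OF f sh(4)]] by auto
  then have "(shift_mor D i \<odot> shift_mor D p) \<odot> f = 0" "(shift_mor D j \<odot> shift_mor D q) \<odot> f = 0"
    using comp_assoc[OF ghost_hom[OF f] sh(2,1)] comp_assoc[OF ghost_hom[OF f] sh(4,3)] sh by auto
  then have "shift_mor D (i \<odot> p + j \<odot> q) \<odot> f = 0"
    using shift_add[OF comp_in_hom[OF *(2,1)] comp_in_hom[OF *(4,3)]] shift_comp *
      comp_add_left[OF ghost_hom[OF f] comp_in_hom[OF sh(2,1)] comp_in_hom[OF sh(4,3)]] by simp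
  then show "f = 0" using comp_ident_left[OF ghost_hom[OF f]] *(5) shift_ident by simp
qed

lemma orth_direct_sum:
  assumes "is_direct_sum D [A, B] S" "orth A A" "orth A B" "orth B A" "orth B B"
  shows "orth S S"
  by (rule orth_direct_sum_left[OF assms(1) orth_direct_sum_right[OF assms(1,2,3)] orth_direct_sum_right[OF assms(1,4,5)]])

end

section \<open>Dimensions and local endomorphism rings\<close>

context vector_space
begin

lemma independent_Un_of_Int_span:
  assumes "finite B" "independent A" "independent B" "span A \<inter> span B = {0}"
  shows "independent (A \<union> B)"
  using assms(1,3,4)
proof (induction B)
  case empty
  then show ?case using assms(2) by simp
next
  case (insert b B)
  have sub: "span B \<subseteq> span (insert b B)" by (rule span_mono) auto
  have b: "b \<in> span (insert b B)" by (rule span_base) simp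
  have ind: "independent B" "b \<notin> span B" using insert independent_insert[of b B] by auto
  have "independent (A \<union> B)"
    using insert.IH[OF ind(1)] insert.prems(2) sub span_zero by blast
  moreover have "b \<notin> span (A \<union> B)"
  proof
    assume "b \<in> span (A \<union> B)"
    then obtain x y where xy: "x \<in> span A" "y \<in> span B" "b = x + y" using span_Un[of A B] by blast
    have "x = b - y" using xy by simp
    then have "x \<in> span (insert b B)" using span_diff b sub xy by blast
    then have "x = 0" using insert.prems(2) xy by blast
    then show False using ind xy by simp
  qed
  ultimately show ?case using independent_insertI by simp
qed

text \<open>Composition with a fixed map is known to be linear only on a Hom-space, not on the
  ambient space. So \<open>f\<close> is replaced by a globally linear \<open>g\<close> that agrees
  with it on \<open>span B\<close>.\<close>

lemma independent_image_of_span: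
  assumes B: "independent B" and "f 0 = 0"
    and lin: "\<And>c x y. x \<in> B \<Longrightarrow> y \<in> span B \<Longrightarrow> f (scale c x + y) = scale c (f x) + f y"
    and inj: "\<And>x. x \<in> span B \<Longrightarrow> f x = 0 \<Longrightarrow> x = 0"
  shows "independent (f ` B)" "span (f ` B) = f ` span B" "inj_on f B"
proof -
  interpret p: vector_space_pair scale scale ..
  obtain g where g: "Vector_Spaces.linear scale scale g" "\<forall>x\<in>B. g x = f x"
    using p.linear_independent_extend[OF B] by blast
  interpret g: Vector_Spaces.linear scale scale g by (rule g(1))
  have "y \<in> span B \<and> g y = f y" if "y \<in> span B" for y
    using that
  proof (induction rule: span_induct_alt)
    case base
    show ?case using assms(2) span_zero by simp
  next
    case (step c x y)
    then show ?case using lin g(2) by (auto simp: g.add g.scale intro: span_add span_scale span_base)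
  qed
  then have eq: "g y = f y" if "y \<in> span B" for y using that by blast
  have inj: "inj_on g (span B)"
  proof (rule inj_onI)
    fix x y assume xy: "x \<in> span B" "y \<in> span B" "g x = g y"
    then have "g (x - y) = 0" by (simp add: g.diff)
    then have "x - y = 0" using inj[of "x - y"] eq[of "x - y"] span_diff xy by simp
    then show "x = y" by simp
  qed
  have im: "g ` B = f ` B" "g ` span B = f ` span B" using g(2) eq by auto
  show "independent (f ` B)" using g.independent_injective_image[OF B inj] im by simp
  show "span (f ` B) = f ` span B" using g.span_image[of B] im by simp
  show "inj_on f B" using inj g(2) span_superset by (metis inj_on_cong inj_on_subset)
qed

text \<open>The finite spanning set guards against infinite bases, whose \<open>card\<close> is
  0.\<close>

lemma dim_le_of_subset:
  assumes "V \<subseteq> W" "finite S" "W \<subseteq> span S"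
  shows "dim V \<le> dim W"
proof -
  obtain B where B: "B \<subseteq> V" "independent B" "V \<subseteq> span B" "card B = dim V" using basis_exists by blast
  obtain C where C: "C \<subseteq> W" "independent C" "W \<subseteq> span C" "card C = dim W" using basis_exists by blast
  have "finite C" using independent_span_bound[OF assms(2) C(2)] C(1) assms(3) by blast
  then show ?thesis using independent_span_bound[of C B] B C assms by auto
qed

lemma dim_less_of_psubset:
  assumes "V \<subset> W" "subspace V" "finite S" "W \<subseteq> span S"
  shows "dim V < dim W"
proof -
  obtain B where B: "B \<subseteq> V" "independent B" "V \<subseteq> span B" "card B = dim V" using basis_exists by blast
  obtain C where C: "C \<subseteq> W" "independent C" "W \<subseteq> span C" "card C = dim W" using basis_exists by blast
  have fC: "finite C" using independent_span_bound[OF assms(3) C(2)] C(1) assms(4) by blast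
  obtain w where w: "w \<in> W" "w \<notin> V" using assms(1) by blast
  have "span B \<subseteq> V" using span_minimal[OF B(1) assms(2)] .
  then have ind: "independent (insert w B)" "w \<notin> B" using w B independent_insertI by auto
  have fB: "finite B" using independent_span_bound[OF fC B(2)] B(1) C(3) assms(1) by blast
  have "card (insert w B) \<le> card C"
    using independent_span_bound[OF fC ind(1)] B(1) C(3) assms(1) w by blast
  then show ?thesis using ind fB B C by simp
qed

end

context k_linear_category
begin

lemma zero_object_iso: "isomorphic C A B \<Longrightarrow> zero_object C A \<Longrightarrow> zero_object C B"
  unfolding zero_object_iff isomorphic_def
proof (elim exE)
  fix f assume "ident C A = 0" "is_iso C A B f"
  then obtain g where g: "f \<in> hom C A B" "g \<in> hom C B A" "f \<odot> g = ident C B" using is_isoE by metis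
  have "f = 0" using comp_ident_right[OF g(1)] comp_zero_right[OF g(1)] \<open>ident C A = 0\<close> by simp
  then show "ident C B = 0" using g comp_zero_left[OF g(2)] by simp
qed

lemma biproduct_iso_target:
  assumes "is_direct_sum C [A, B] S" "isomorphic C S S'"
  shows "is_direct_sum C [A, B] S'"
proof -
  obtain i p j q where *: "i \<in> hom C A S" "p \<in> hom C S A" "j \<in> hom C B S" "q \<in> hom C S B"
    "p \<odot> i = ident C A" "q \<odot> j = ident C B" "q \<odot> i = 0" "p \<odot> j = 0"
    "i \<odot> p + j \<odot> q = ident C S" using assms(1) by (rule biproductE)
  obtain f where "is_iso C S S' f" using assms(2) by (auto simp: isomorphic_def)
  then obtain g where f: "f \<in> hom C S S'" "g \<in> hom C S' S" "g \<odot> f = ident C S" "f \<odot> g = ident C S'"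
    by (rule is_isoE)
  have conj: "f \<odot> x \<odot> (y \<odot> g) = f \<odot> (x \<odot> y) \<odot> g" if "x \<in> hom C E S" "y \<in> hom C S E" for x y E
    using comp_assoc[OF comp_in_hom[OF f(2) that(2)] that(1) f(1)]
      comp_assoc[OF f(2) comp_in_hom[OF that(2,1)] f(1)] comp_assoc[OF f(2) that(2,1)] by simp
  show ?thesis
  proof (rule biproductI[of "f \<odot> i" _ _ "p \<odot> g" "f \<odot> j" _ "q \<odot> g"])
    show "p \<odot> g \<odot> (f \<odot> i) = ident C A" "q \<odot> g \<odot> (f \<odot> j) = ident C B"
      "q \<odot> g \<odot> (f \<odot> i) = 0" "p \<odot> g \<odot> (f \<odot> j) = 0"
      using comp_inner_cancel[OF *(1) f(1,2) *(2) f(3)] comp_inner_cancel[OF *(3) f(1,2) *(4) f(3)]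
        comp_inner_cancel[OF *(1) f(1,2) *(4) f(3)] comp_inner_cancel[OF *(3) f(1,2) *(2) f(3)] * by auto
    have "f \<odot> i \<odot> (p \<odot> g) + f \<odot> j \<odot> (q \<odot> g) = f \<odot> (i \<odot> p) \<odot> g + f \<odot> (j \<odot> q) \<odot> g"
      using conj[OF *(1,2)] conj[OF *(3,4)] by simp
    also have "\<dots> = (f \<odot> (i \<odot> p) + f \<odot> (j \<odot> q)) \<odot> g"
      by (rule comp_add_left[symmetric, OF f(2) comp_in_hom[OF comp_in_hom[OF *(2,1)] f(1)]
            comp_in_hom[OF comp_in_hom[OF *(4,3)] f(1)]])
    also have "f \<odot> (i \<odot> p) + f \<odot> (j \<odot> q) = f \<odot> ident C S"
      using comp_add_right[OF comp_in_hom[OF *(2,1)] comp_in_hom[OF *(4,3)] f(1)] *(9) by simp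
    finally show "f \<odot> i \<odot> (p \<odot> g) + f \<odot> j \<odot> (q \<odot> g) = ident C S'"
      using comp_ident_right[OF f(1)] f(4) by simp
  qed (use * f comp_in_hom[OF *(1) f(1)] comp_in_hom[OF f(2) *(2)] comp_in_hom[OF *(3) f(1)]
      comp_in_hom[OF f(2) *(4)] in auto)
qed

lemma indecomposable_iso:
  assumes "indecomposable C X" "isomorphic C X Y"
  shows "indecomposable C Y"
  unfolding indecomposable_def
proof (intro conjI allI impI)
  show "\<not> zero_object C Y"
    using assms zero_object_iso isomorphic_sym unfolding indecomposable_def by blast
  fix A B assume "is_direct_sum C [A, B] Y"
  then have "is_direct_sum C [A, B] X" using biproduct_iso_target isomorphic_sym[OF assms(2)] by blast
  then show "zero_object C A \<or> zero_object C B" using assms(1) unfolding indecomposable_def by blast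
qed

lemma local_endo_ring_iso:
  assumes "local_endo_ring C A" "isomorphic C A X"
  shows "local_endo_ring C X"
proof -
  obtain k where k_iso: "is_iso C A X k" using assms(2) by (auto simp: isomorphic_def)
  then obtain l where k: "k \<in> hom C A X" "l \<in> hom C X A" "l \<odot> k = ident C A" "k \<odot> l = ident C X"
    and l_iso: "is_iso C X A l" using is_isoE by metis
  have A: "ident C A \<noteq> 0" "\<And>f g. f \<in> hom C A A \<Longrightarrow> g \<in> hom C A A \<Longrightarrow> \<not> is_iso C A A f \<Longrightarrow>
      \<not> is_iso C A A g \<Longrightarrow> \<not> is_iso C A A (f + g)"
    using assms(1) unfolding local_endo_ring_def by auto
  have h: "l \<odot> (f \<odot> k) \<in> hom C A A" if "f \<in> hom C X X" for f
    using comp_in_hom[OF comp_in_hom[OF k(1) that] k(2)] .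
  have recover: "k \<odot> ((l \<odot> (f \<odot> k)) \<odot> l) = f" if f: "f \<in> hom C X X" for f
  proof -
    have "(l \<odot> (f \<odot> k)) \<odot> l = l \<odot> ((f \<odot> k) \<odot> l)"
      by (rule comp_assoc[OF k(2) comp_in_hom[OF k(1) f] k(2)])
    also have "(f \<odot> k) \<odot> l = f" using comp_assoc[OF k(2,1) f] k comp_ident_right[OF f] by simp
    finally show ?thesis using comp_assoc[OF f k(2,1)] k comp_ident_left[OF f] by simp
  qed
  have iff: "is_iso C X X f \<longleftrightarrow> is_iso C A A (l \<odot> (f \<odot> k))" if f: "f \<in> hom C X X" for f
  proof
    assume "is_iso C X X f"
    then show "is_iso C A A (l \<odot> (f \<odot> k))" using is_iso_comp[OF is_iso_comp[OF k_iso] l_iso] by blast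
  next
    assume "is_iso C A A (l \<odot> (f \<odot> k))"
    then have "is_iso C X X (k \<odot> ((l \<odot> (f \<odot> k)) \<odot> l))" using is_iso_comp[OF is_iso_comp[OF l_iso] k_iso] by blast
    then show "is_iso C X X f" using recover[OF f] by simp
  qed
  have add: "l \<odot> ((f + g) \<odot> k) = l \<odot> (f \<odot> k) + l \<odot> (g \<odot> k)" if "f \<in> hom C X X" "g \<in> hom C X X" for f g
    using comp_add_left[OF k(1) that] comp_add_right[OF comp_in_hom[OF k(1) that(1)] comp_in_hom[OF k(1) that(2)] k(2)]
    by simp
  show ?thesis unfolding local_endo_ring_def
  proof (intro conjI ballI impI)
    show "ident C X \<noteq> 0" using A(1) assms(2) zero_object_iff zero_object_iso isomorphic_sym by blast
    fix f g assume fg: "f \<in> hom C X X" "g \<in> hom C X X" "\<not> is_iso C X X f" "\<not> is_iso C X X g"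
    then show "\<not> is_iso C X X (f + g)"
      using A(2)[OF h h] iff add add_in_hom by simp
  qed
qed

lemma local_iso_or_complement:
  assumes "local_endo_ring C X" "f \<in> hom C X X"
  shows "is_iso C X X f \<or> is_iso C X X (ident C X - f)"
proof -
  have "f + (ident C X - f) = ident C X" by simp
  then show ?thesis using assms is_iso_ident diff_in_hom[OF ident_in_hom assms(2)]
    unfolding local_endo_ring_def by metis
qed

text \<open>A decomposition of \<open>X\<close> yields the idempotent \<open>i \<odot> p\<close>
  with complement \<open>j \<odot> q\<close>; if one of them is invertible, the summand belonging to
  the other is zero. Both exchange triangles verify indecomposability of \<open>Y\<close> in this
  form.\<close>

lemma indecomposable_of_iso_or_complement:
  assumes "ident C X \<noteq> 0"
    and "\<And>f. f \<in> hom C X X \<Longrightarrow> is_iso C X X f \<or> is_iso C X X (ident C X - f)"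
  shows "indecomposable C X"
  unfolding indecomposable_def
proof (intro conjI allI impI)
  show "\<not> zero_object C X" using assms zero_object_iff by blast
  fix A B assume "is_direct_sum C [A, B] X"
  then obtain i p j q where *: "i \<in> hom C A X" "p \<in> hom C X A" "j \<in> hom C B X" "q \<in> hom C X B"
    "p \<odot> i = ident C A" "q \<odot> j = ident C B" "q \<odot> i = 0" "p \<odot> j = 0"
    "i \<odot> p + j \<odot> q = ident C X" by (rule biproductE)
  have "ident C X - i \<odot> p = j \<odot> q" using *(9) by (simp add: algebra_simps)
  then have "is_iso C X X (i \<odot> p) \<or> is_iso C X X (j \<odot> q)" using assms(2)[OF comp_in_hom[OF *(2,1)]] by simp
  moreover have "zero_object C B" if "is_iso C X X (i \<odot> p)"
  proof -
    have "q \<odot> (i \<odot> p) = 0 \<odot> (i \<odot> p)"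
      using comp_assoc[OF *(2,1,4)] * comp_zero_left[OF comp_in_hom[OF *(2,1)]] comp_zero_left[OF *(2)] by simp
    then have "q = 0" using iso_cancel_right[OF that *(4) zero_in_hom] by blast
    then show ?thesis using * comp_zero_left[OF *(3)] zero_object_iff by simp
  qed
  moreover have "zero_object C A" if "is_iso C X X (j \<odot> q)"
  proof -
    have "p \<odot> (j \<odot> q) = 0 \<odot> (j \<odot> q)"
      using comp_assoc[OF *(4,3,2)] * comp_zero_left[OF comp_in_hom[OF *(4,3)]] comp_zero_left[OF *(4)] by simp
    then have "p = 0" using iso_cancel_right[OF that *(2) zero_in_hom] by blast
    then show ?thesis using * comp_zero_left[OF *(1)] zero_object_iff by simp
  qed
  ultimately show "zero_object C A \<or> zero_object C B" by blast
qed

lemma indecomposable_of_local: "local_endo_ring C X \<Longrightarrow> indecomposable C X"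
  using indecomposable_of_iso_or_complement local_iso_or_complement
  unfolding local_endo_ring_def by blast

end

section \<open>Multiplicities of indecomposable summands\<close>

context krull_schmidt_triangulated_category
begin

lemma direct_sum_indecomposable_cases:
  "is_direct_sum D As X \<Longrightarrow> indecomposable D X \<Longrightarrow> \<exists>A \<in> set As. isomorphic D A X"
proof (induction As arbitrary: X)
  case Nil
  then show ?case unfolding direct_sum_Nil indecomposable_def by blast
next
  case (Cons A As)
  obtain S' where S': "is_direct_sum D As S'" using direct_sum_list_exists by blast
  then have sum: "is_direct_sum D [A, S'] X" using direct_sum_decompose Cons.prems by blast
  then consider "zero_object D A" | "zero_object D S'" using Cons.prems unfolding indecomposable_def by blast
  then show ?case
  proof cases
    case 1
    then have iso: "isomorphic D S' X" using biproduct_zero_right biproduct_swap[OF sum] by blast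
    then have "indecomposable D S'" using indecomposable_iso[OF Cons.prems(2)] isomorphic_sym by blast
    then show ?thesis using Cons.IH[OF S'] isomorphic_trans[OF _ iso] by auto
  next
    case 2
    then show ?thesis using biproduct_zero_right[OF sum] by auto
  qed
qed

lemma indecomposable_decomposition:
  "\<exists>As. is_direct_sum D As X \<and> (\<forall>A \<in> set As. indecomposable D A)"
  using krull_schmidt indecomposable_of_local unfolding krull_schmidt_def by blast

text \<open>The Krull-Schmidt property decomposes \<open>X\<close> into objects with local
  endomorphism rings, and an indecomposable \<open>X\<close> is isomorphic to one of them.\<close>

lemma indecomposable_local:
  assumes "indecomposable D X"
  shows "local_endo_ring D X"
proof -
  obtain As where "is_direct_sum D As X" "\<forall>A \<in> set As. local_endo_ring D A"
    using krull_schmidt unfolding krull_schmidt_def by blast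
  then show ?thesis using direct_sum_indecomposable_cases[OF _ assms] local_endo_ring_iso by blast
qed

lemma indecomposable_ident_nonzero: "indecomposable D X \<Longrightarrow> ident D X \<noteq> 0"
  unfolding indecomposable_def zero_object_iff by blast

lemma indecomposable_noniso_add:
  "indecomposable D X \<Longrightarrow> f \<in> hom D X X \<Longrightarrow> g \<in> hom D X X \<Longrightarrow> is_iso D X X (f + g) \<Longrightarrow>
    is_iso D X X f \<or> is_iso D X X g"
  using indecomposable_local unfolding local_endo_ring_def by blast

lemma split_mono_indecomposable:
  assumes "indecomposable D X" "\<not> zero_object D Z" "f \<in> hom D Z X" "r \<in> hom D X Z" "r \<odot> f = ident D Z"
  shows "isomorphic D Z X"
proof -
  obtain B where B: "is_direct_sum D [Z, B] X"
    using split_mono_direct_sum[OF assms(3-5)] by blast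
  then have "zero_object D B" using assms(1,2) unfolding indecomposable_def by blast
  then show ?thesis using biproduct_zero_right[OF B] by blast
qed

text \<open>For indecomposable \<open>Z\<close> this is the radical of the category: the maps Z -> X
  that are not split monomorphisms.\<close>

definition rad :: "'o \<Rightarrow> 'o \<Rightarrow> 'm set" where
  "rad Z X = {f \<in> hom D Z X. \<forall>g \<in> hom D X Z. \<not> is_iso D Z Z (g \<odot> f)}"

text \<open>Closure under addition is where locality of the endomorphism ring of \<open>Z\<close>
  enters: if a sum of two endomorphisms is invertible, then one of them is.\<close>

lemma rad_subspace:
  assumes "indecomposable D Z"
  shows "vs.subspace (rad Z X)"
  unfolding vs.subspace_def
proof (intro conjI ballI allI)
  have "\<not> is_iso D Z Z 0"
  proof
    assume "is_iso D Z Z 0"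
    then obtain g where "g \<in> hom D Z Z" "g \<odot> 0 = ident D Z" using is_isoE by metis
    then show False using indecomposable_ident_nonzero[OF assms] comp_zero_right by simp
  qed
  then show "0 \<in> rad Z X" unfolding rad_def by simp
next
  fix f g assume fg: "f \<in> rad Z X" "g \<in> rad Z X"
  then have h: "f \<in> hom D Z X" "g \<in> hom D Z X" unfolding rad_def by auto
  have "\<not> is_iso D Z Z (u \<odot> (f + g))" if u: "u \<in> hom D X Z" for u
  proof -
    have "u \<odot> (f + g) = u \<odot> f + u \<odot> g" by (rule comp_add_right[OF h u])
    then show ?thesis
      using indecomposable_noniso_add[OF assms comp_in_hom[OF h(1) u] comp_in_hom[OF h(2) u]] fg u
      unfolding rad_def by auto
  qed
  then show "f + g \<in> rad Z X" unfolding rad_def using add_in_hom[OF h] by blast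
next
  fix c f assume f: "f \<in> rad Z X"
  then have h: "f \<in> hom D Z X" unfolding rad_def by auto
  have "\<not> is_iso D Z Z (u \<odot> scale D c f)" if u: "u \<in> hom D X Z" for u
  proof -
    have "u \<odot> scale D c f = scale D c u \<odot> f" using comp_scale_right[OF h u] comp_scale_left[OF h u] by simp
    then show ?thesis using f scale_in_hom[OF u] unfolding rad_def by auto
  qed
  then show "scale D c f \<in> rad Z X" unfolding rad_def using scale_in_hom[OF h] by blast
qed

lemma rad_comp_left:
  assumes "f \<in> rad Z X" "h \<in> hom D X Y"
  shows "h \<odot> f \<in> rad Z Y"
proof -
  have f: "f \<in> hom D Z X" using assms unfolding rad_def by blast
  have "\<not> is_iso D Z Z (u \<odot> (h \<odot> f))" if u: "u \<in> hom D Y Z" for u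
    using comp_assoc[OF f assms(2) u] comp_in_hom[OF assms(2) u] assms(1) unfolding rad_def by auto
  then show ?thesis unfolding rad_def using comp_in_hom[OF f assms(2)] by blast
qed

text \<open>Stated for an arbitrary subfunctor of \<open>Hom(Z, -)\<close>, so that it applies to \<open>Hom(Z, -)\<close> itself
  and to its radical.\<close>

lemma dim_subfunctor_direct_sum:
  assumes sub: "\<And>X. vs.subspace (F X)" "\<And>X. F X \<subseteq> hom D Z X"
    and comp: "\<And>X Y f h. f \<in> F X \<Longrightarrow> h \<in> hom D X Y \<Longrightarrow> h \<odot> f \<in> F Y"
    and sum: "is_direct_sum D [A, B] S"
  shows "vs.dim (F S) = vs.dim (F A) + vs.dim (F B)"
proof -
  obtain i p j q where *: "i \<in> hom D A S" "p \<in> hom D S A" "j \<in> hom D B S" "q \<in> hom D S B"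
    "p \<odot> i = ident D A" "q \<odot> j = ident D B" "q \<odot> i = 0" "p \<odot> j = 0"
    "i \<odot> p + j \<odot> q = ident D S" using sum by (rule biproductE)
  have basis: "\<exists>Bs. finite Bs \<and> vs.independent Bs \<and> vs.span Bs = F X \<and> card Bs = vs.dim (F X)" for X
  proof -
    obtain K where K: "finite K" "hom D Z X = vs.span K" using hom_finite unfolding hom_finite_def by blast
    obtain Bs where Bs: "Bs \<subseteq> F X" "vs.independent Bs" "F X \<subseteq> vs.span Bs" "card Bs = vs.dim (F X)"
      using vs.basis_exists by blast
    have "Bs \<subseteq> vs.span K" using Bs(1) sub(2)[of X] unfolding K(2) by (rule subset_trans)
    then have "finite Bs" using vs.independent_span_bound[OF K(1) Bs(2)] by simp
    moreover have "vs.span Bs = F X" using vs.span_minimal[OF Bs(1) sub(1)] Bs(3) by (rule equalityI)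
    ultimately show ?thesis using Bs by blast
  qed
  obtain BA where BA: "finite BA" "vs.independent BA" "vs.span BA = F A" "card BA = vs.dim (F A)"
    using basis by blast
  obtain BB where BB: "finite BB" "vs.independent BB" "vs.span BB = F B" "card BB = vs.dim (F B)"
    using basis by blast
  have image: "vs.independent ((\<odot>) u ` Bs) \<and> vs.span ((\<odot>) u ` Bs) = (\<odot>) u ` F X \<and> inj_on ((\<odot>) u) Bs"
    if "vs.independent Bs" "vs.span Bs = F X" "u \<in> hom D X S" "v \<in> hom D S X" "v \<odot> u = ident D X"
    for Bs X u v
  proof -
    have h: "x \<in> hom D Z X" if "x \<in> vs.span Bs" for x
      using that sub(2)[of X] unfolding \<open>vs.span Bs = F X\<close> by (rule subsetD[rotated])
    have lin: "u \<odot> (scale D c x + y) = scale D c (u \<odot> x) + u \<odot> y" if "x \<in> Bs" "y \<in> vs.span Bs" for c x y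
    proof -
      have x: "x \<in> hom D Z X" and y: "y \<in> hom D Z X"
        using h[OF vs.span_base[OF that(1)]] h[OF that(2)] by auto
      then show ?thesis
        using comp_add_right[OF scale_in_hom[OF x] y \<open>u \<in> hom D X S\<close>] comp_scale_right[OF x \<open>u \<in> hom D X S\<close>]
        by simp
    qed
    have inj: "x = 0" if "x \<in> vs.span Bs" "u \<odot> x = 0" for x
    proof -
      have "x = (v \<odot> u) \<odot> x" using comp_ident_left[OF h[OF that(1)]] \<open>v \<odot> u = ident D X\<close> by simp
      also have "\<dots> = v \<odot> (u \<odot> x)" by (rule comp_assoc[OF h[OF that(1)] \<open>u \<in> hom D X S\<close> \<open>v \<in> hom D S X\<close>])
      finally show ?thesis using that(2) comp_zero_right[OF \<open>v \<in> hom D S X\<close>] by simp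
    qed
    note im = vs.independent_image_of_span[of Bs "(\<odot>) u", OF that(1) comp_zero_right[OF that(3)] lin inj]
    show ?thesis unfolding that(2)[symmetric] by (intro conjI im)
  qed
  note iA = image[OF BA(2,3) *(1,2,5)] and iB = image[OF BB(2,3) *(3,4,6)]
  define C where "C = (\<odot>) i ` BA \<union> (\<odot>) j ` BB"
  have disj: "vs.span ((\<odot>) i ` BA) \<inter> vs.span ((\<odot>) j ` BB) = {0}"
  proof -
    have zero: "w = 0" if "x \<in> F A" "y \<in> F B" "w = i \<odot> x" "w = j \<odot> y" for w x y
    proof -
      have xy: "x \<in> hom D Z A" "y \<in> hom D Z B" using that sub(2) by auto
      have "x = p \<odot> (i \<odot> x)" using comp_assoc[OF xy(1) *(1,2)] *(5) comp_ident_left[OF xy(1)] by simp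
      also have "\<dots> = (p \<odot> j) \<odot> y" using comp_assoc[OF xy(2) *(3,2)] that by simp
      finally show ?thesis using *(8) that comp_zero_left[OF xy(2)] comp_zero_right[OF *(1)] by simp
    qed
    have "(\<odot>) i ` F A \<inter> (\<odot>) j ` F B \<subseteq> {0}"
    proof (intro subsetI, elim IntE imageE)
      fix w x y assume "w = i \<odot> x" "x \<in> F A" "w = j \<odot> y" "y \<in> F B"
      then show "w \<in> {0}" using zero[of x y w] by simp
    qed
    then have "vs.span ((\<odot>) i ` BA) \<inter> vs.span ((\<odot>) j ` BB) \<subseteq> {0}"
      by (simp only: iA iB)
    moreover have "{0} \<subseteq> vs.span ((\<odot>) i ` BA) \<inter> vs.span ((\<odot>) j ` BB)"
      by (simp add: vs.span_zero del: vs.span_eq_iff)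
    ultimately show ?thesis by (rule equalityI)
  qed
  have C_ind: "vs.independent C" unfolding C_def
    by (rule vs.independent_Un_of_Int_span[OF _ _ _ disj]) (simp_all add: iA iB BB(1))
  have "(\<odot>) i ` BA \<inter> (\<odot>) j ` BB = {}"
  proof -
    have general: "X \<inter> Y = {}" if "0 \<notin> X" "X \<inter> Y \<subseteq> {0}" for X Y :: "'m set" using that by blast
    have "0 \<notin> (\<odot>) i ` BA" using iA vs.dependent_zero by metis
    moreover have "(\<odot>) i ` BA \<inter> (\<odot>) j ` BB \<subseteq> {0}"
      unfolding disj[symmetric] by (intro Int_mono vs.span_superset)
    ultimately show ?thesis by (rule general)
  qed
  then have card: "card C = card BA + card BB"
    unfolding C_def using iA iB BA(1) BB(1) by (simp add: card_Un_disjoint card_image)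
  have "C \<subseteq> F S"
  proof -
    have "BA \<subseteq> F A" "BB \<subseteq> F B" using BA(3) BB(3) vs.span_superset by metis+
    then show ?thesis unfolding C_def using comp[OF _ *(1)] comp[OF _ *(3)] by auto
  qed
  moreover have "F S \<subseteq> vs.span C"
  proof
    fix x assume x: "x \<in> F S"
    then have xh: "x \<in> hom D Z S" using sub(2) by blast
    have "x = (i \<odot> p + j \<odot> q) \<odot> x" using *(9) comp_ident_left[OF xh] by simp
    also have "\<dots> = i \<odot> (p \<odot> x) + j \<odot> (q \<odot> x)"
      using comp_add_left[OF xh comp_in_hom[OF *(2,1)] comp_in_hom[OF *(4,3)]]
        comp_assoc[OF xh *(2,1)] comp_assoc[OF xh *(4,3)] by simp
    finally have "x = i \<odot> (p \<odot> x) + j \<odot> (q \<odot> x)" .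
    moreover have "i \<odot> (p \<odot> x) \<in> vs.span ((\<odot>) i ` BA)" "j \<odot> (q \<odot> x) \<in> vs.span ((\<odot>) j ` BB)"
      using iA iB comp[OF x *(2)] comp[OF x *(4)] by (simp_all add: image_eqI)
    ultimately show "x \<in> vs.span C" unfolding C_def
      using vs.span_add[OF subsetD[OF vs.span_mono[OF Un_upper1]] subsetD[OF vs.span_mono[OF Un_upper2]]] by metis
  qed
  ultimately have "card C = vs.dim (F S)" using vs.basis_card_eq_dim C_ind by blast
  then show ?thesis using card BA BB by simp
qed

text \<open>The dimension of Hom(Z, X) modulo its radical, which is the number of copies of
  \<open>Z\<close> in \<open>X\<close> times \<open>mult Z Z\<close>; counts are therefore compared
  with \<open>mult Z Z\<close> instead of 1. Additivity on direct sums takes the place of uniqueness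
  of decompositions. Real values allow differences and linear algebra.\<close>

definition mult :: "'o \<Rightarrow> 'o \<Rightarrow> real" where
  "mult Z X = real (vs.dim (hom D Z X)) - real (vs.dim (rad Z X))"

context
  fixes Z assumes Z: "indecomposable D Z"
begin

lemma mult_direct_sum: "is_direct_sum D [A, B] S \<Longrightarrow> mult Z S = mult Z A + mult Z B"
  unfolding mult_def
  using dim_subfunctor_direct_sum[of "hom D Z" Z A B S]
    dim_subfunctor_direct_sum[of "rad Z" Z A B S] rad_subspace[OF Z] rad_comp_left hom_subspace
  by (auto simp: comp_in_hom rad_def)

lemma mult_nonneg: "mult Z X \<ge> 0"
proof -
  obtain K where K: "finite K" "hom D Z X = vs.span K" using hom_finite unfolding hom_finite_def by blast
  have "vs.dim (rad Z X) \<le> vs.dim (hom D Z X)"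
    by (rule vs.dim_le_of_subset[OF _ K(1)]) (use K(2) in \<open>auto simp: rad_def\<close>)
  then show ?thesis unfolding mult_def by simp
qed

lemma mult_zero_object: "zero_object D X \<Longrightarrow> mult Z X = 0"
proof -
  assume X: "zero_object D X"
  then have "hom D Z X = {0}" unfolding zero_object_def by blast
  moreover have "rad Z X = {0}"
    using rad_subspace[OF Z, of X] calculation vs.subspace_0 unfolding rad_def by blast
  ultimately show ?thesis unfolding mult_def by simp
qed

lemma mult_iso:
  assumes "isomorphic D X Y"
  shows "mult Z X = mult Z Y"
proof -
  obtain Z0 where Z0: "zero_object D Z0" using zero_object_exists by blast
  have "is_direct_sum D [X, Z0] X"
    by (rule biproductI[of "ident D X" _ _ "ident D X" 0 _ 0])
      (use Z0 comp_zero_left[OF zero_in_hom[of X Z0]] comp_ident_left[OF ident_in_hom[of X]]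
        comp_zero_left[OF zero_in_hom[of Z0 X]] comp_zero_left[OF ident_in_hom[of X]]
        comp_zero_right[OF ident_in_hom[of X]] in \<open>auto simp: ident_in_hom zero_object_iff\<close>)
  then have "is_direct_sum D [X, Z0] Y" using biproduct_iso_target assms by blast
  then show ?thesis using mult_direct_sum mult_zero_object[OF Z0] by fastforce
qed

lemma mult_self_pos: "mult Z Z > 0"
proof -
  obtain K where K: "finite K" "hom D Z Z = vs.span K" using hom_finite unfolding hom_finite_def by blast
  have "ident D Z \<notin> rad Z Z"
    unfolding rad_def using is_iso_ident ident_in_hom comp_ident_left[OF ident_in_hom[of Z]] by force
  then have "rad Z Z \<subset> hom D Z Z" unfolding rad_def using ident_in_hom by blast
  then have "vs.dim (rad Z Z) < vs.dim (hom D Z Z)"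
    by (rule vs.dim_less_of_psubset[OF _ rad_subspace[OF Z] K(1)]) (use K(2) in auto)
  then show ?thesis unfolding mult_def by simp
qed

text \<open>For a map outside the radical some composite back to \<open>Z\<close> is invertible, and
  correcting by its inverse gives a retraction.\<close>

lemma mult_nonzero_summand:
  assumes "mult Z X \<noteq> 0"
  shows "\<exists>f \<in> hom D Z X. \<exists>r \<in> hom D X Z. r \<odot> f = ident D Z"
proof -
  have "rad Z X \<noteq> hom D Z X" using assms unfolding mult_def by auto
  then obtain f g where fg: "f \<in> hom D Z X" "g \<in> hom D X Z" "is_iso D Z Z (g \<odot> f)"
    unfolding rad_def by blast
  obtain u where u: "u \<in> hom D Z Z" "u \<odot> (g \<odot> f) = ident D Z" using fg(3) is_isoE by metis
  have "(u \<odot> g) \<odot> f = ident D Z" using comp_assoc[OF fg(1,2) u(1)] u by simp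
  then show ?thesis using fg u comp_in_hom by blast
qed

lemma mult_summand_pos:
  assumes "direct_summand D Z X"
  shows "mult Z X > 0"
proof -
  obtain B where "is_direct_sum D [Z, B] X" using assms unfolding direct_summand_def by blast
  then show ?thesis using mult_direct_sum mult_self_pos mult_nonneg[of B] by fastforce
qed

lemma mult_noniso:
  assumes "indecomposable D X" "\<not> isomorphic D Z X"
  shows "mult Z X = 0"
proof (rule ccontr)
  assume "mult Z X \<noteq> 0"
  then obtain f r where fr: "f \<in> hom D Z X" "r \<in> hom D X Z" "r \<odot> f = ident D Z"
    using mult_nonzero_summand by blast
  have "\<not> zero_object D Z" using Z unfolding indecomposable_def by blast
  then show False using split_mono_indecomposable[OF assms(1) _ fr] assms(2) by blast
qed

lemma mult_list: "is_direct_sum D As X \<Longrightarrow> mult Z X = (\<Sum>i < length As. mult Z (As ! i))"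
proof (induction As arbitrary: X)
  case Nil
  then show ?case using mult_zero_object direct_sum_Nil by simp
next
  case (Cons A As)
  obtain S' where S': "is_direct_sum D As S'" using direct_sum_list_exists by blast
  then have "mult Z X = mult Z A + mult Z S'" using direct_sum_decompose Cons.prems mult_direct_sum by blast
  then show ?case using Cons.IH[OF S'] by (simp add: sum.lessThan_Suc_shift del: sum.lessThan_Suc)
qed

text \<open>By additivity the multiplicity of \<open>Z\<close> in a sum of n copies of
  \<open>X\<close> is n times that in \<open>X\<close>, so the latter is nonzero when the former
  is.\<close>

lemma summand_of_add_closure:
  assumes "Z \<in> add_closure D X"
  shows "direct_summand D Z X"
proof -
  obtain n S where S: "is_direct_sum D (replicate n X) S" "direct_summand D Z S"
    using assms unfolding add_closure_def by blast
  have "mult Z S = (\<Sum>i<n. mult Z X)" using mult_list[OF S(1)] by simp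
  moreover have "mult Z S > 0" using mult_summand_pos S by blast
  ultimately have "mult Z X \<noteq> 0" by auto
  then show ?thesis using mult_nonzero_summand summandI by blast
qed

lemma mult_pos_iff: "mult Z X > 0 \<longleftrightarrow> Z \<in> add_closure D X"
proof
  assume "mult Z X > 0"
  then show "Z \<in> add_closure D X"
    using mult_nonzero_summand[of X] add_closure_retract[OF _ _ _ add_closure_self] by (metis less_irrefl)
next
  assume "Z \<in> add_closure D X"
  then show "mult Z X > 0" using summand_of_add_closure mult_summand_pos by blast
qed

end

section \<open>Basic objects and numbers of summands via multiplicities\<close>

lemma direct_summand_iff: "indecomposable D A \<Longrightarrow> direct_summand D A X \<longleftrightarrow> A \<in> add_closure D X"
  using summand_of_add_closure mult_summand_pos mult_pos_iff by blast

lemma add_closure_by_indecomposables: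
  assumes "\<And>A. indecomposable D A \<Longrightarrow> A \<in> add_closure D P \<Longrightarrow> A \<in> add_closure D U"
  shows "P \<in> add_closure D U"
proof -
  obtain As where As: "is_direct_sum D As P" "\<forall>A \<in> set As. indecomposable D A"
    using indecomposable_decomposition by blast
  obtain \<iota> \<pi> :: "nat \<Rightarrow> 'm" where
    *: "\<forall>i < length As. \<iota> i \<in> hom D (As ! i) P" "\<forall>i < length As. \<pi> i \<in> hom D P (As ! i)"
    "\<forall>i < length As. \<forall>j < length As. \<pi> j \<odot> \<iota> i = (if i = j then ident D (As ! i) else 0)"
    "(\<Sum>i < length As. \<iota> i \<odot> \<pi> i) = ident D P" using As(1) by (rule direct_sumE)
  have "\<iota> i \<odot> \<pi> i \<in> thru U P P" if i: "i < length As" for i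
  proof -
    have "As ! i \<in> add_closure D P"
      by (rule add_closure_retract[of "\<iota> i" _ P "\<pi> i"]) (use * i add_closure_self in auto)
    then have "As ! i \<in> add_closure D U" using assms As(2) i by simp
    then show ?thesis by (rule thru_via) (use * i in auto)
  qed
  then have "(\<Sum>i < length As. \<iota> i \<odot> \<pi> i) \<in> thru U P P" by (intro thru_sum) simp
  then show ?thesis using *(4) in_add_closure_iff by simp
qed

text \<open>Two isomorphic copies of \<open>Z\<close> would contribute twice
  \<open>mult Z Z\<close>, while in a basic object at most one summand contributes. This form does
  not depend on a decomposition.\<close>

lemma basic_iff: "basic D X \<longleftrightarrow> (\<forall>Z. indecomposable D Z \<longrightarrow> mult Z X \<le> mult Z Z)"
proof (intro iffI allI impI)
  fix Z assume b: "basic D X" and Z: "indecomposable D Z"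
  obtain As where As: "is_direct_sum D As X" "\<forall>A \<in> set As. indecomposable D A"
    using indecomposable_decomposition by blast
  then have non: "\<not> isomorphic D (As ! i) (As ! j)" if "i < length As" "j < length As" "i \<noteq> j" for i j
    using b that unfolding basic_def by blast
  show "mult Z X \<le> mult Z Z"
  proof (cases "\<exists>i < length As. isomorphic D Z (As ! i)")
    case True
    then obtain i where i: "i < length As" "isomorphic D Z (As ! i)" by blast
    have "mult Z (As ! j) = 0" if "j < length As" "j \<noteq> i" for j
    proof (rule mult_noniso[OF Z])
      show "indecomposable D (As ! j)" using As that by simp
      show "\<not> isomorphic D Z (As ! j)"
        using non[OF i(1) that(1)] that i isomorphic_trans isomorphic_sym by blast
    qed
    then have "(\<Sum>j < length As. mult Z (As ! j)) = (\<Sum>j < length As. if j = i then mult Z (As ! i) else 0)"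
      by (intro sum.cong) auto
    also have "\<dots> = mult Z (As ! i)" using i by simp
    finally have "(\<Sum>j < length As. mult Z (As ! j)) = mult Z (As ! i)" .
    then show ?thesis using mult_list[OF Z As(1)] mult_iso[OF Z i(2)] by simp
  next
    case False
    then have "mult Z (As ! j) = 0" if "j < length As" for j
      using mult_noniso[OF Z] As that by simp
    then show ?thesis using mult_list[OF Z As(1)] mult_self_pos[OF Z] by simp
  qed
next
  assume *: "\<forall>Z. indecomposable D Z \<longrightarrow> mult Z X \<le> mult Z Z"
  show "basic D X" unfolding basic_def
  proof (intro allI impI notI, elim conjE)
    fix As i j
    assume As: "is_direct_sum D As X" "\<forall>A\<in>set As. indecomposable D A" "i < length As" "j < length As"
      "i \<noteq> j" "isomorphic D (As ! i) (As ! j)"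
    define Z where "Z = As ! i"
    have Z: "indecomposable D Z" unfolding Z_def using As by simp
    have "(\<Sum>l \<in> {i, j}. mult Z (As ! l)) \<le> (\<Sum>l < length As. mult Z (As ! l))"
      by (rule sum_mono2) (use As mult_nonneg[OF Z] in auto)
    then have "mult Z Z + mult Z Z \<le> mult Z X"
      using mult_list[OF Z As(1)] As(5) mult_iso[OF Z As(6)[folded Z_def]] unfolding Z_def by simp
    then show False using * Z mult_self_pos[OF Z] by force
  qed
qed

text \<open>The classes counted by \<open>num_summands\<close>, phrased with membership in add X
  because this makes monotonicity immediate.\<close>

definition iso_classes :: "'o \<Rightarrow> 'o set set" where
  "iso_classes X = {{B. isomorphic D A B} | A. indecomposable D A \<and> A \<in> add_closure D X}"

lemma num_summands_eq: "num_summands D X = card (iso_classes X)"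
  unfolding num_summands_def iso_classes_def using direct_summand_iff by (metis (no_types, lifting))

lemma iso_class_eq_iff: "{E. isomorphic D A E} = {E. isomorphic D B E} \<longleftrightarrow> isomorphic D A B"
  using isomorphic_refl isomorphic_sym isomorphic_trans by blast

lemma iso_classes_mem_iff:
  "indecomposable D A \<Longrightarrow> {B. isomorphic D A B} \<in> iso_classes X \<longleftrightarrow> A \<in> add_closure D X"
proof
  assume "{B. isomorphic D A B} \<in> iso_classes X"
  then obtain A' where A': "isomorphic D A A'" "A' \<in> add_closure D X"
    unfolding iso_classes_def using iso_class_eq_iff by auto
  then obtain f where "is_iso D A A' f" by (auto simp: isomorphic_def)
  then obtain r where "f \<in> hom D A A'" "r \<in> hom D A' A" "r \<odot> f = ident D A" using is_isoE by metis
  then show "A \<in> add_closure D X" using add_closure_retract A'(2) by blast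
qed (auto simp: iso_classes_def)

lemma finite_iso_classes: "finite (iso_classes X)"
proof -
  obtain As where As: "is_direct_sum D As X" "\<forall>A \<in> set As. indecomposable D A"
    using indecomposable_decomposition by blast
  have "iso_classes X \<subseteq> (\<lambda>A. {B. isomorphic D A B}) ` set As"
  proof
    fix c assume "c \<in> iso_classes X"
    then obtain A where A: "c = {B. isomorphic D A B}" "indecomposable D A" "A \<in> add_closure D X"
      unfolding iso_classes_def by blast
    have "\<exists>i < length As. isomorphic D A (As ! i)"
    proof (rule ccontr)
      assume "\<not> ?thesis"
      then have "mult A X = 0" using mult_list[OF A(2) As(1)] mult_noniso[OF A(2)] As(2) by simp
      then show False using mult_pos_iff[OF A(2), of X] A(3) by simp
    qed
    then show "c \<in> (\<lambda>A. {B. isomorphic D A B}) ` set As" using A(1) iso_class_eq_iff by auto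
  qed
  then show ?thesis using finite_subset by blast
qed

lemma iso_classes_mono: "X \<in> add_closure D Y \<Longrightarrow> iso_classes X \<subseteq> iso_classes Y"
  unfolding iso_classes_def using add_closure_trans by blast

text \<open>The two finite sets of isomorphism classes are nested, so the count makes them equal,
  and an object lies in add X once its indecomposable summands do.\<close>

lemma add_closure_of_num_summands:
  assumes "X \<in> add_closure D Y" "num_summands D Y \<le> num_summands D X"
  shows "Y \<in> add_closure D X"
proof (rule add_closure_by_indecomposables)
  have "iso_classes X = iso_classes Y"
    using card_seteq[OF finite_iso_classes iso_classes_mono[OF assms(1)]] assms(2) num_summands_eq by simp
  then show "A \<in> add_closure D X" if "indecomposable D A" "A \<in> add_closure D Y" for A
    using iso_classes_mem_iff that by metis
qed

lemma add_closure_direct_sum_cases: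
  assumes "is_direct_sum D [A, B] S" "indecomposable D Z" "Z \<in> add_closure D S"
  shows "Z \<in> add_closure D A \<or> Z \<in> add_closure D B"
proof -
  have "mult Z S > 0" using mult_pos_iff[OF assms(2), of S] assms(3) by blast
  then have "0 < mult Z A \<or> 0 < mult Z B" using mult_direct_sum[OF assms(2,1)] by linarith
  then show ?thesis using mult_pos_iff[OF assms(2), of A] mult_pos_iff[OF assms(2), of B] by blast
qed

lemma add_closure_indecomposable_iff:
  assumes "indecomposable D A" "indecomposable D B"
  shows "A \<in> add_closure D B \<longleftrightarrow> isomorphic D A B"
proof
  assume "A \<in> add_closure D B"
  then show "isomorphic D A B"
    using mult_noniso[OF assms] mult_pos_iff[OF assms(1), of B] by fastforce
next
  assume "isomorphic D A B"
  then show "A \<in> add_closure D B"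
    using mult_iso[OF assms(1), of A B] mult_self_pos[OF assms(1)] mult_pos_iff[OF assms(1), of B] by simp
qed

lemma num_summands_direct_sum:
  assumes "is_direct_sum D [U, Y] N" "indecomposable D Y" "Y \<notin> add_closure D U"
  shows "num_summands D N = num_summands D U + 1"
proof -
  have "iso_classes N = insert {B. isomorphic D Y B} (iso_classes U)"
  proof
    show "iso_classes N \<subseteq> insert {B. isomorphic D Y B} (iso_classes U)"
    proof
      fix c assume "c \<in> iso_classes N"
      then obtain A where A: "c = {B. isomorphic D A B}" "indecomposable D A" "A \<in> add_closure D N"
        unfolding iso_classes_def by blast
      then have "A \<in> add_closure D U \<or> isomorphic D A Y"
        using add_closure_direct_sum_cases[OF assms(1)] add_closure_indecomposable_iff[OF A(2) assms(2)] by blast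
      then show "c \<in> insert {B. isomorphic D Y B} (iso_classes U)"
        using A iso_class_eq_iff iso_classes_mem_iff by blast
    qed
    show "insert {B. isomorphic D Y B} (iso_classes U) \<subseteq> iso_classes N"
      using iso_classes_mem_iff[OF assms(2)] add_closure_summand[OF assms(1)] iso_classes_mono by blast
  qed
  moreover have "{B. isomorphic D Y B} \<notin> iso_classes U" using iso_classes_mem_iff assms by blast
  ultimately show ?thesis using finite_iso_classes num_summands_eq by simp
qed

lemma basic_direct_sum_iff:
  assumes "is_direct_sum D [U, Y] N" "indecomposable D Y"
  shows "basic D N \<longleftrightarrow> basic D U \<and> Y \<notin> add_closure D U"
proof -
  have N: "mult Z N = mult Z U + mult Z Y" if "indecomposable D Z" for Z
    by (rule mult_direct_sum[OF that assms(1)])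
  show ?thesis
  proof
    assume b: "basic D N"
    have "basic D U" unfolding basic_iff
    proof (intro allI impI)
      fix Z assume Z: "indecomposable D Z"
      then show "mult Z U \<le> mult Z Z" using b N[OF Z] mult_nonneg[OF Z, of Y] unfolding basic_iff by force
    qed
    moreover have "mult Y U \<le> 0" using b N[OF assms(2)] assms(2) unfolding basic_iff by force
    ultimately show "basic D U \<and> Y \<notin> add_closure D U" using mult_pos_iff[OF assms(2), of U] by simp
  next
    assume *: "basic D U \<and> Y \<notin> add_closure D U"
    show "basic D N" unfolding basic_iff
    proof (intro allI impI)
      fix Z assume Z: "indecomposable D Z"
      show "mult Z N \<le> mult Z Z"
      proof (cases "isomorphic D Z Y")
        case True
        then have "mult Z Y = mult Z Z" using mult_iso[OF Z isomorphic_sym[OF True]] by simp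
        moreover have "Z \<notin> add_closure D U"
          using * add_closure_indecomposable_iff[OF assms(2) Z] isomorphic_sym[OF True] add_closure_trans by blast
        then have "mult Z U = 0" using mult_pos_iff[OF Z, of U] mult_nonneg[OF Z, of U] by linarith
        ultimately show ?thesis using N[OF Z] by simp
      next
        case False
        then show ?thesis using N[OF Z] mult_noniso[OF Z assms(2)] * Z unfolding basic_iff by simp
      qed
    qed
  qed
qed

end

section \<open>Coresolutions by rigid objects\<close>

context cluster_tilted_category
begin

text \<open>In a ghost map B -> V[1] -> E[1] with \<open>V\<close> in add T the first factor
  vanishes on \<open>T'\<close>, since Hom(T', V[1]) = 0. So it descends to \<open>M'\<close>, and
  M' -> V[1] -> E[1] is ghost, hence zero.\<close>

lemma approx_orth_left:
  assumes T': "T' \<in> add_closure D T" and M': "M' \<in> add_closure D M"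
    and tri: "triangle D T' B M' b m p" and "orth M E"
  shows "orth B E"
proof (rule orthI)
  note th = triangle_hom[OF tri]
  fix f assume f: "f \<in> ghost B (shift D E)"
  obtain V a c where V: "V \<in> add_closure D T" "a \<in> hom D B (shift D V)" "c \<in> hom D (shift D V) (shift D E)"
    "f = c \<odot> a" using ghost_factors[OF f] by blast
  have "a \<odot> b = 0" by (rule hom_add_T_shift[OF T' V(1) comp_in_hom[OF th(1) V(2)]])
  then obtain a' where a': "a' \<in> hom D M' (shift D V)" "a = a' \<odot> m"
    using triangle_extend_second[OF tri V(2)] by blast
  have "c \<odot> a' \<in> ghost M' (shift D E)"
    by (rule ghost_comp_left[OF ghost_into_shift_T[OF V(1) a'(1)] V(3)])
  then have "c \<odot> a' = 0" using orthD[OF orth_left[OF assms(4) M']] by blast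
  then show "f = 0" using V(4) a'(2) comp_assoc[OF th(2) a'(1) V(3)] comp_zero_left[OF th(2)] by simp
qed

text \<open>A ghost map M -> B[1] dies in M'[1] by rigidity, so it comes from a map M -> T'[1]. That
  map factors through the approximation \<open>p\<close>, and T'[1] -> B[1] kills
  \<open>p\<close>.\<close>

lemma approx_orth_right:
  assumes p: "right_approx D M M' (shift D T') p" and tri: "triangle D T' B M' b m p" and "orth M M"
  shows "orth M B"
proof (rule orthI)
  note th = triangle_hom[OF tri]
  have M': "M' \<in> add_closure D M" using p unfolding right_approx_def by blast
  fix f assume f: "f \<in> ghost M (shift D B)"
  have "shift_mor D m \<odot> f = 0"
    using orthD[OF orth_right[OF assms(3) M'] ghost_comp_left[OF f shift_hom[OF th(2)]]] .
  then obtain y where y: "y \<in> hom D M (shift D T')" "f = (- shift_mor D b) \<odot> y"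
    using triangle_lift_third[OF triangle_rotate[OF tri] ghost_hom[OF f]] by blast
  obtain w where w: "w \<in> hom D M M'" "y = p \<odot> w"
    using p y(1) add_closure_self unfolding right_approx_def by blast
  have "shift_mor D b \<odot> y = 0"
    using comp_assoc[OF w(1) th(3) shift_hom[OF th(1)]] w(2) triangle_comp_zero2(2)[OF tri]
      comp_zero_left[OF w(1)] by simp
  then show "f = 0" using y(2) comp_neg_left[OF y(1) shift_hom[OF th(1)]] by simp
qed

lemma approx_completion_rigid:
  assumes T': "T' \<in> add_closure D T" and p: "right_approx D M M' (shift D T') p"
    and tri: "triangle D T' B M' b m p" and "orth M M" and "is_direct_sum D [M, B] P"
  shows "orth P P"
proof -
  have M': "M' \<in> add_closure D M" using p unfolding right_approx_def by blast
  \<comment> \<open>This comes first because \<open>orth B B\<close> is obtained from it, by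
    \<open>approx_orth_left\<close> with \<open>B\<close> in the place of \<open>E\<close>.\<close>
  have MB: "orth M B" by (rule approx_orth_right[OF p tri assms(4)])
  show ?thesis
    by (rule orth_direct_sum[OF assms(5,4) MB approx_orth_left[OF T' M' tri assms(4)]
          approx_orth_left[OF T' M' tri MB]])
qed

text \<open>Later only the class difference [B] - [M] matters, so the maps are not recorded.
  \<open>C\<close> is meant to lie in add T.\<close>

definition coresolution :: "'o \<Rightarrow> 'o \<Rightarrow> 'o \<Rightarrow> 'o \<Rightarrow> bool" where
  "coresolution P C B M \<longleftrightarrow> B \<in> add_closure D P \<and> M \<in> add_closure D P \<and>
     (\<exists>b m q. triangle D C B M b m q)"

lemma coresolution_completion:
  assumes "orth M M" "T' \<in> add_closure D T"
  shows "\<exists>P B M'. M \<in> add_closure D P \<and> orth P P \<and> coresolution P T' B M'"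
proof -
  obtain M' p where p: "right_approx D M M' (shift D T') p" using right_approx_exists[OF hom_finite] by blast
  then have ph: "p \<in> hom D M' (shift D T')" "M' \<in> add_closure D M" unfolding right_approx_def by auto
  obtain B b m where tri: "triangle D T' B M' b m p" using triangle_cocone[OF ph(1)] by blast
  obtain P where P: "is_direct_sum D [M, B] P" using direct_sum_exists by blast
  have "orth P P" by (rule approx_completion_rigid[OF assms(2) p tri assms(1) P])
  moreover have "coresolution P T' B M'"
    unfolding coresolution_def using add_closure_summand[OF P] add_closure_trans[OF ph(2)] tri by blast
  ultimately show ?thesis using add_closure_summand[OF P] by blast
qed

lemma coresolution_mono:
  "coresolution P C B M \<Longrightarrow> P \<in> add_closure D Q \<Longrightarrow> coresolution Q C B M"
  unfolding coresolution_def using add_closure_trans by blast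

text \<open>Enlarging \<open>P\<close> for a further object keeps the coresolutions already found,
  so finitely many objects can be treated one after the other.\<close>

lemma coresolution_completion_list:
  assumes "orth M M" "set Ts \<subseteq> add_closure D T"
  shows "\<exists>P. M \<in> add_closure D P \<and> orth P P \<and> (\<forall>T' \<in> set Ts. \<exists>B M'. coresolution P T' B M')"
  using assms(2)
proof (induction Ts)
  case Nil
  then show ?case using assms(1) add_closure_self by auto
next
  case (Cons T' Ts)
  then obtain P where P: "M \<in> add_closure D P" "orth P P"
    "\<forall>T' \<in> set Ts. \<exists>B M'. coresolution P T' B M'" by auto
  obtain Q B M' where Q: "P \<in> add_closure D Q" "orth Q Q" "coresolution Q T' B M'"
    using coresolution_completion[OF P(2), of T'] Cons.prems by auto
  have "\<exists>B M'. coresolution Q t B M'" if "t \<in> set (T' # Ts)" for t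
    using that Q(3) P(3) coresolution_mono[OF _ Q(1)] by fastforce
  then show ?case using Q(2) add_closure_trans[OF P(1) Q(1)] by blast
qed

lemma coresolution_iso:
  assumes "coresolution P C B M" "isomorphic D C C'"
  shows "coresolution P C' B M"
proof -
  obtain b m q where t: "triangle D C B M b m q" using assms(1) unfolding coresolution_def by blast
  note th = triangle_hom[OF t]
  obtain a where a: "is_iso D C C' a" using assms(2) by (auto simp: isomorphic_def)
  then obtain a' where a': "a \<in> hom D C C'" "a' \<in> hom D C' C" "a' \<odot> a = ident D C" using is_isoE by metis
  have "triangle D C' B M (b \<odot> a') m (shift_mor D a \<odot> q)"
  proof (rule TR1_iso[OF t a is_iso_ident is_iso_ident comp_in_hom[OF a'(2) th(1)] th(2)
        comp_in_hom[OF th(3) shift_hom[OF a'(1)]]])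
    show "ident D B \<odot> b = b \<odot> a' \<odot> a"
      using comp_assoc[OF a'(1,2) th(1)] a'(3) comp_ident_left[OF th(1)] comp_ident_right[OF th(1)] by simp
    show "ident D M \<odot> m = m \<odot> ident D B"
      using comp_ident_left[OF th(2)] comp_ident_right[OF th(2)] by simp
    show "shift_mor D a \<odot> q = shift_mor D a \<odot> q \<odot> ident D M"
      using comp_ident_right[OF comp_in_hom[OF th(3) shift_hom[OF a'(1)]]] by simp
  qed
  then show ?thesis using assms(1) unfolding coresolution_def by blast
qed

context
  fixes P assumes rigid: "orth P P"
begin

text \<open>The composite M -> C[1] -> B[1] passes through add T[1], so it is ghost, and rigidity of
  \<open>P\<close> applies to its ends. This vanishing splits the pushout triangles below.\<close>

lemma shift_T_comp_zero:
  assumes "C \<in> add_closure D T" "B \<in> add_closure D P" "M \<in> add_closure D P"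
    and "q \<in> hom D M (shift D C)" "b \<in> hom D C B"
  shows "shift_mor D b \<odot> q = 0"
  by (rule orthD[OF orth_left[OF orth_right[OF rigid assms(2)] assms(3)]
        ghost_comp_right[OF ghost_from_shift_T[OF assms(1) shift_hom[OF assms(5)]] assms(4)]])

text \<open>The argument of Schanuel's lemma: the pushout \<open>F\<close> of \<open>B1\<close> and
  \<open>B2\<close> over \<open>C\<close> lies in two split triangles, so it is the direct sum of
  \<open>B2\<close> and \<open>M1\<close> and also that of \<open>B1\<close> and
  \<open>M2\<close>.\<close>

lemma coresolution_unique:
  assumes C: "C \<in> add_closure D T" and "coresolution P C B1 M1" "coresolution P C B2 M2"
    and Z: "indecomposable D Z"
  shows "mult Z B1 - mult Z M1 = mult Z B2 - mult Z M2"
proof -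
  obtain b1 m1 q1 where t1: "triangle D C B1 M1 b1 m1 q1" and a1: "B1 \<in> add_closure D P" "M1 \<in> add_closure D P"
    using assms(2) unfolding coresolution_def by blast
  obtain b2 m2 q2 where t2: "triangle D C B2 M2 b2 m2 q2" and a2: "B2 \<in> add_closure D P" "M2 \<in> add_closure D P"
    using assms(3) unfolding coresolution_def by blast
  obtain F f g where F: "is_direct_sum D [B2, M1] F" "triangle D B1 F M2 f g (shift_mor D b1 \<odot> q2)"
    using pushout_triangle[OF t1 t2 shift_T_comp_zero[OF C a2(1) a1(2) triangle_hom(3)[OF t1] triangle_hom(1)[OF t2]]]
    by blast
  have "triangle D B1 F M2 f g 0"
    using F(2) shift_T_comp_zero[OF C a1(1) a2(2) triangle_hom(3)[OF t2] triangle_hom(1)[OF t1]] by simp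
  then show ?thesis
    using mult_direct_sum[OF Z F(1)] mult_direct_sum[OF Z split_triangle] by fastforce
qed

text \<open>The sum of two triangles, assembled from pushouts. Pushing \<open>C\<close> out along A
  -> B1 gives C -> F1, where \<open>F1\<close> is the sum of \<open>B1\<close> and \<open>S\<close>;
  pushing \<open>F1\<close> out along S -> B2 gives F1 -> F2, where \<open>F2\<close> is the sum of
  \<open>B2\<close> and \<open>B1\<close>. The octahedral axiom makes the cone \<open>W\<close> of C
  -> F2 the middle of a triangle M1 -> W -> M2, which rigidity splits.\<close>

lemma coresolution_direct_sum:
  assumes "A \<in> add_closure D T" "S \<in> add_closure D T" "is_direct_sum D [A, S] C"
    and "coresolution P A B1 M1" "coresolution P S B2 M2"
  shows "\<exists>B M. coresolution P C B M \<and> is_direct_sum D [B2, B1] B \<and> is_direct_sum D [M1, M2] M"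
proof -
  obtain b1 m1 q1 where t1: "triangle D A B1 M1 b1 m1 q1" and a1: "B1 \<in> add_closure D P" "M1 \<in> add_closure D P"
    using assms(4) unfolding coresolution_def by blast
  obtain b2 m2 q2 where t2: "triangle D S B2 M2 b2 m2 q2" and a2: "B2 \<in> add_closure D P" "M2 \<in> add_closure D P"
    using assms(5) unfolding coresolution_def by blast
  note th1 = triangle_hom[OF t1] and th2 = triangle_hom[OF t2]
  obtain a c where tC: "triangle D A C S a c 0" using triangle_of_direct_sum[OF assms(3)] by blast
  obtain F1 f1 g1 where F1: "is_direct_sum D [B1, S] F1" "triangle D C F1 M1 f1 g1 (shift_mor D a \<odot> q1)"
    using pushout_triangle[OF tC t1 comp_zero_right[OF shift_hom[OF th1(1)]]] by blast
  obtain s r where tS: "triangle D S F1 B1 s r 0"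
    using triangle_of_direct_sum[OF biproduct_swap[OF F1(1)]] by blast
  obtain F2 f2 g2 where F2: "is_direct_sum D [B2, B1] F2" "triangle D F1 F2 M2 f2 g2 (shift_mor D s \<odot> q2)"
    using pushout_triangle[OF tS t2 comp_zero_right[OF shift_hom[OF th2(1)]]] by blast
  note s = triangle_hom(1)[OF tS] and g1 = triangle_hom(2)[OF F1(2)]
  obtain W u v where W: "triangle D C F2 W (f2 \<odot> f1) u v"
    using TR1_cone[OF comp_in_hom[OF triangle_hom(1)[OF F1(2)] triangle_hom(1)[OF F2(2)]]] by blast
  have "\<exists>\<alpha> \<beta>. triangle D M1 W M2 \<alpha> \<beta> (shift_mor D g1 \<odot> (shift_mor D s \<odot> q2))"
    using TR4[OF F1(2) F2(2) W] by blast
  moreover have "shift_mor D g1 \<odot> (shift_mor D s \<odot> q2) = 0"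
    using comp_assoc[OF th2(3) shift_hom[OF s] shift_hom[OF g1]] shift_comp[OF s g1]
      shift_T_comp_zero[OF assms(2) a1(2) a2(2) th2(3) comp_in_hom[OF s g1]] by simp
  ultimately have sumW: "is_direct_sum D [M1, M2] W" using split_triangle by auto
  have "coresolution P C F2 W" unfolding coresolution_def
    using W add_closure_direct_sum[OF F2(1) a2(1) a1(1)] add_closure_direct_sum[OF sumW a1(2) a2(2)] by blast
  then show ?thesis using F2(1) sumW by blast
qed

end

text \<open>The class of \<open>X\<close> in the split Grothendieck group, realised as a function on
  all objects. The value 0 at decomposable \<open>Z\<close> is there because additivity of
  \<open>mult Z\<close> is established for indecomposable \<open>Z\<close>.\<close>

definition mult_vector :: "'o \<Rightarrow> 'o \<Rightarrow> real" where
  "mult_vector X Z = (if indecomposable D Z then mult Z X else 0)"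

text \<open>A real vector space turns generation by few classes into an inequality between
  cardinalities.\<close>

interpretation fv: vector_space "\<lambda>(c::real) (f::'o \<Rightarrow> real) x. c * f x"
  by unfold_locales (auto simp: algebra_simps)

lemma mult_vector_direct_sum:
  "is_direct_sum D [A, B] S \<Longrightarrow> mult_vector S = mult_vector A + mult_vector B"
  by (rule ext) (simp add: mult_vector_def mult_direct_sum)

text \<open>The classes of the indecomposable summands of a rigid object are integral combinations of the
  differences \<open>[B] - [M]\<close> attached to coresolutions of the indecomposable summands of \<open>T\<close>.\<close>

lemma coresolution_in_span:
  assumes rigid: "orth P P"
    and G: "\<And>A. indecomposable D A \<Longrightarrow> A \<in> add_closure D T \<Longrightarrow>
      \<exists>B M. coresolution P A B M \<and> mult_vector B - mult_vector M \<in> fv.span G"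
    and C: "C \<in> add_closure D T"
  shows "\<exists>B M. coresolution P C B M \<and> mult_vector B - mult_vector M \<in> fv.span G"
proof -
  have "\<exists>B M. coresolution P C B M \<and> mult_vector B - mult_vector M \<in> fv.span G"
    if "is_direct_sum D As C" "\<forall>A \<in> set As. indecomposable D A" "C \<in> add_closure D T" for As C
    using that
  proof (induction As arbitrary: C)
    case Nil
    then have C: "zero_object D C" using direct_sum_Nil by blast
    then have "coresolution P C C C"
      unfolding coresolution_def using TR1_ident[OF C, of C] zero_object_add_closure[OF C] by blast
    moreover have "mult_vector C - mult_vector C \<in> fv.span G" unfolding diff_self by (rule fv.span_zero)
    ultimately show ?case by blast
  next
    case (Cons A As)
    obtain S where S: "is_direct_sum D As S" using direct_sum_list_exists by blast
    then have sum: "is_direct_sum D [A, S] C" using direct_sum_decompose Cons.prems by blast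
    have add: "A \<in> add_closure D T" "S \<in> add_closure D T"
      using add_closure_summand[OF sum] add_closure_trans Cons.prems(3) by blast+
    obtain B1 M1 where 1: "coresolution P A B1 M1" "mult_vector B1 - mult_vector M1 \<in> fv.span G"
      using G[OF _ add(1)] Cons.prems(2) by (meson list.set_intros(1))
    obtain B2 M2 where 2: "coresolution P S B2 M2" "mult_vector B2 - mult_vector M2 \<in> fv.span G"
      using Cons.IH[OF S _ add(2)] Cons.prems(2) by (meson list.set_intros(2))
    obtain B M where BM: "coresolution P C B M" "is_direct_sum D [B2, B1] B" "is_direct_sum D [M1, M2] M"
      using coresolution_direct_sum[OF rigid add sum 1(1) 2(1)] by blast
    have "mult_vector B - mult_vector M = (mult_vector B1 - mult_vector M1) + (mult_vector B2 - mult_vector M2)"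
      using mult_vector_direct_sum[OF BM(2)] mult_vector_direct_sum[OF BM(3)] by simp
    then show ?case using BM(1) fv.span_add[OF 1(2) 2(2)] by metis
  qed
  then show ?thesis using indecomposable_decomposition[of C] C by blast
qed

text \<open>Pushing a presentation T1 -> T0 -> Z out along a coresolution T1 -> B1 -> M1 gives a
  coresolution of \<open>T0\<close> with middle term the sum of \<open>B1\<close> and
  \<open>Z\<close>, and with last term \<open>M1\<close>. Hence the class of \<open>Z\<close> is the
  difference of the classes attached to \<open>T0\<close> and \<open>T1\<close>.\<close>

lemma mult_vector_in_span:
  assumes rigid: "orth P P"
    and G: "\<And>A. indecomposable D A \<Longrightarrow> A \<in> add_closure D T \<Longrightarrow>
      \<exists>B M. coresolution P A B M \<and> mult_vector B - mult_vector M \<in> fv.span G"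
    and Z: "Z \<in> add_closure D P"
  shows "mult_vector Z \<in> fv.span G"
proof -
  obtain T1 T0 a b c where t: "triangle D T1 T0 Z a b c" "T1 \<in> add_closure D T" "T0 \<in> add_closure D T"
    using T_presentation by blast
  obtain B1 M1 where 1: "coresolution P T1 B1 M1" "mult_vector B1 - mult_vector M1 \<in> fv.span G"
    using coresolution_in_span[OF rigid G t(2)] by blast
  obtain B0 M0 where 0: "coresolution P T0 B0 M0" "mult_vector B0 - mult_vector M0 \<in> fv.span G"
    using coresolution_in_span[OF rigid G t(3)] by blast
  obtain b1 m1 q1 where t1: "triangle D T1 B1 M1 b1 m1 q1" and a1: "B1 \<in> add_closure D P" "M1 \<in> add_closure D P"
    using 1(1) unfolding coresolution_def by blast
  obtain F f g where F: "is_direct_sum D [B1, Z] F" "triangle D T0 F M1 f g (shift_mor D a \<odot> q1)"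
    using pushout_triangle[OF t(1) t1 shift_T_comp_zero[OF rigid t(2) a1(1) Z triangle_hom(3)[OF t(1)]
          triangle_hom(1)[OF t1]]] by blast
  have "coresolution P T0 F M1" unfolding coresolution_def
    using F(2) add_closure_direct_sum[OF F(1) a1(1) Z] a1(2) by blast
  then have "mult_vector F - mult_vector M1 = mult_vector B0 - mult_vector M0"
    using coresolution_unique[OF rigid t(3) _ 0(1)] by (intro ext) (simp add: mult_vector_def)
  moreover have "mult_vector Z = (mult_vector F - mult_vector M1) - (mult_vector B1 - mult_vector M1)"
    using mult_vector_direct_sum[OF F(1)] by simp
  ultimately show ?thesis using fv.span_diff[OF 0(2) 1(2)] by simp
qed

lemma iso_class_representatives:
  "\<exists>R. finite R \<and> card R = num_summands D X \<and> (\<forall>A \<in> R. indecomposable D A \<and> A \<in> add_closure D X) \<and>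
    (\<forall>A. indecomposable D A \<longrightarrow> A \<in> add_closure D X \<longrightarrow> (\<exists>A' \<in> R. isomorphic D A' A)) \<and>
    (\<forall>A \<in> R. \<forall>A' \<in> R. isomorphic D A A' \<longrightarrow> A = A')"
proof -
  have "\<forall>c \<in> iso_classes X. \<exists>A. c = {B. isomorphic D A B} \<and> indecomposable D A \<and> A \<in> add_closure D X"
    unfolding iso_classes_def by blast
  then obtain r where r: "\<And>c. c \<in> iso_classes X \<Longrightarrow> c = {B. isomorphic D (r c) B}"
    "\<And>c. c \<in> iso_classes X \<Longrightarrow> indecomposable D (r c)" "\<And>c. c \<in> iso_classes X \<Longrightarrow> r c \<in> add_closure D X"
    by metis
  have eq: "c = c'" if "c \<in> iso_classes X" "c' \<in> iso_classes X" "isomorphic D (r c) (r c')" for c c'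
    using r(1)[OF that(1)] r(1)[OF that(2)] iso_class_eq_iff that(3) by metis
  have "inj_on r (iso_classes X)"
    using eq isomorphic_refl by (metis inj_onI)
  then have "card (r ` iso_classes X) = num_summands D X" using num_summands_eq card_image by metis
  moreover have "\<exists>A' \<in> r ` iso_classes X. isomorphic D A' A" if "indecomposable D A" "A \<in> add_closure D X" for A
  proof -
    have c: "{B. isomorphic D A B} \<in> iso_classes X" using iso_classes_mem_iff that by blast
    have "{B. isomorphic D A B} = {B. isomorphic D (r {B. isomorphic D A B}) B}" by (rule r(1)[OF c])
    then have "isomorphic D (r {B. isomorphic D A B}) A" using iso_class_eq_iff isomorphic_sym by blast
    then show ?thesis using c by blast
  qed
  moreover have "A = A'" if "A \<in> r ` iso_classes X" "A' \<in> r ` iso_classes X" "isomorphic D A A'" for A A'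
    using that eq by (metis imageE)
  ultimately show ?thesis
    using r(2,3) finite_iso_classes[of X] by (intro exI[of _ "r ` iso_classes X"]) auto
qed

theorem num_summands_rigid_le:
  assumes "orth M M"
  shows "num_summands D M \<le> num_summands D T"
proof -
  obtain R where R: "finite R" "card R = num_summands D T"
    "\<forall>A \<in> R. indecomposable D A \<and> A \<in> add_closure D T"
    "\<forall>A. indecomposable D A \<longrightarrow> A \<in> add_closure D T \<longrightarrow> (\<exists>A' \<in> R. isomorphic D A' A)"
    using iso_class_representatives[of T] by blast
  obtain Ts where Ts: "set Ts = R" using finite_list[OF R(1)] by blast
  then have "set Ts \<subseteq> add_closure D T" using R(3) by blast
  then obtain P where P: "M \<in> add_closure D P" "orth P P" "\<forall>A \<in> R. \<exists>B M'. coresolution P A B M'"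
    using coresolution_completion_list[OF assms] Ts by blast
  obtain B N where BN: "\<And>A. A \<in> R \<Longrightarrow> coresolution P A (B A) (N A)" using P(3) by metis
  \<comment> \<open>One generator for each isomorphism class of indecomposable summands of
    \<open>T\<close>: the source of the bound.\<close>
  define G where "G = (\<lambda>A. mult_vector (B A) - mult_vector (N A)) ` R"
  have G: "\<exists>B M. coresolution P A B M \<and> mult_vector B - mult_vector M \<in> fv.span G"
    if A: "indecomposable D A" "A \<in> add_closure D T" for A
  proof -
    obtain A' where A': "A' \<in> R" "isomorphic D A' A" using R(4) A by blast
    then have "mult_vector (B A') - mult_vector (N A') \<in> fv.span G"
      unfolding G_def by (intro fv.span_base) blast
    then show ?thesis using coresolution_iso[OF BN[OF A'(1)] A'(2)] by blast
  qed
  obtain Q where Q: "finite Q" "card Q = num_summands D M"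
    "\<forall>A \<in> Q. indecomposable D A \<and> A \<in> add_closure D M"
    "\<forall>A \<in> Q. \<forall>A' \<in> Q. isomorphic D A A' \<longrightarrow> A = A'"
    using iso_class_representatives[of M] by blast
  \<comment> \<open>On the representatives in \<open>Q\<close> the vectors form a diagonal matrix
    with positive entries; injectivity and independence are both read off from it.\<close>
  have val: "mult_vector A A' = (if A = A' then mult A A else 0)" if "A \<in> Q" "A' \<in> Q" for A A'
    using that Q(3,4) mult_noniso[of A' A] isomorphic_sym unfolding mult_vector_def by auto
  have inj: "inj_on mult_vector Q"
  proof (rule inj_onI)
    fix A A' assume "A \<in> Q" "A' \<in> Q" "mult_vector A = mult_vector A'"
    then show "A = A'" using val[of A A] val[of A' A] mult_self_pos Q(3) by (metis less_irrefl)
  qed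
  have sum_apply: "sum g S z = (\<Sum>x\<in>S. g x z)" for g and S :: "('o \<Rightarrow> real) set" and z :: 'o
    by (induction S rule: infinite_finite_induct) auto
  have "fv.independent (mult_vector ` Q)"
  proof (rule fv.independent_if_scalars_zero)
    fix u v assume *: "(\<Sum>x\<in>mult_vector ` Q. (\<lambda>z. u x * x z)) = 0" "v \<in> mult_vector ` Q"
    obtain A where A: "A \<in> Q" "v = mult_vector A" using *(2) by blast
    have "0 = (\<Sum>x\<in>mult_vector ` Q. (\<lambda>z. u x * x z)) A" using *(1) by simp
    also have "\<dots> = (\<Sum>x\<in>mult_vector ` Q. u x * x A)" by (rule sum_apply)
    also have "\<dots> = (\<Sum>A'\<in>Q. u (mult_vector A') * mult_vector A' A)" using sum.reindex[OF inj] by simp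
    also have "\<dots> = (\<Sum>A'\<in>Q. if A' = A then u v * mult A A else 0)"
      by (intro sum.cong) (use val A in auto)
    also have "\<dots> = u v * mult A A" using A(1) Q(1) by simp
    finally show "u v = 0" using mult_self_pos[of A] Q(3) A(1) by simp
  qed (use Q(1) in simp)
  moreover have "mult_vector ` Q \<subseteq> fv.span G"
    using mult_vector_in_span[OF P(2) G] add_closure_trans[OF _ P(1)] Q(3) by blast
  moreover have "finite G" unfolding G_def using R(1) by simp
  ultimately have "card (mult_vector ` Q) \<le> card G" using fv.independent_span_bound by blast
  also have "card G \<le> card R" unfolding G_def using card_image_le R(1) by blast
  finally show ?thesis using card_image[OF inj] Q(2) R(2) by simp
qed

lemma rel_cluster_tilting_coresolution:
  assumes "rel_cluster_tilting D T M" "T' \<in> add_closure D T"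
    and "right_approx D M M' (shift D T') p" "triangle D T' B M' b m p"
  shows "B \<in> add_closure D M"
proof -
  have M: "orth M M" "num_summands D M = num_summands D T"
    using assms(1) rel_rigid_iff unfolding rel_cluster_tilting_def by auto
  obtain P where P: "is_direct_sum D [M, B] P" using direct_sum_exists by blast
  have "num_summands D P \<le> num_summands D M"
    using num_summands_rigid_le[OF approx_completion_rigid[OF assms(2-4) M(1) P]] M(2) by simp
  then have "P \<in> add_closure D M"
    using add_closure_of_num_summands add_closure_summand(1)[OF P] by blast
  then show ?thesis using add_closure_trans add_closure_summand(2)[OF P] by blast
qed

end

section \<open>Exchange triangles\<close>

context cluster_tilted_category
begin

lemma orth_of_direct_sum:
  assumes "orth M M" "is_direct_sum D [U, X] M"
  shows "orth U U" "orth U X" "orth X U" "orth X X"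
  using add_closure_summand[OF assms(2)] orth_left[OF orth_right[OF assms(1)]] by blast+

text \<open>Maps T -> X through add U factor through the approximation \<open>f\<close>, and
  \<open>h \<odot> f = 0\<close>.\<close>

lemma ghost_of_rel_star:
  assumes "X \<in> rel_star D T U" "right_approx D U U1 X f" "triangle D Y U1 X g f h"
  shows "h \<in> ghost X (shift D Y)"
proof -
  note th = triangle_hom[OF assms(3)]
  have "h \<odot> t = 0" if t: "t \<in> hom D T X" for t
  proof -
    have "t \<in> thru U T X" using assms(1) t rel_star_iff by blast
    then obtain W a b where W: "W \<in> add_closure D U" "a \<in> hom D T W" "b \<in> hom D W X" "t = b \<odot> a"
      using thru_factors by blast
    then obtain w where w: "w \<in> hom D W U1" "b = f \<odot> w" using assms(2) unfolding right_approx_def by blast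
    have "t = f \<odot> (w \<odot> a)" using W w comp_assoc[OF W(2) w(1) th(2)] by simp
    then have "h \<odot> t = (h \<odot> f) \<odot> (w \<odot> a)" using comp_assoc[OF comp_in_hom[OF W(2) w(1)] th(2,3)] by simp
    then show ?thesis using triangle_comp_zero2(1)[OF assms(3)] comp_zero_left[OF comp_in_hom[OF W(2) w(1)]] by simp
  qed
  then show ?thesis unfolding ghost_def using th by blast
qed

text \<open>The rotated triangle U2 -> Y -> X[1] is itself a witness. This supplies the order
  relation in the second case.\<close>

lemma ghost_triangle_rel_star:
  assumes "triangle D X U2 Y g f h" "U2 \<in> add_closure D U" "h \<in> ghost Y (shift D X)"
  shows "Y \<in> rel_star D T U"
  unfolding rel_star_def factoring_shift_T
  by (intro CollectI exI conjI) (rule triangle_rotate[OF assms(1)] assms(2,3))+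

text \<open>The map \<open>h\<close> factors through W[1] with \<open>W\<close> in add T, and the
  resulting W -> Y -> V[1] is zero since Hom(W, V[1]) = 0. The equation is the condition for
  extending \<open>y\<close> along \<open>g\<close>.\<close>

lemma shift_comp_ghost_zero:
  assumes "h \<in> ghost X (shift D Y)" "V \<in> add_closure D T" "y \<in> hom D Y (shift D V)"
  shows "shift_mor D y \<odot> h = 0"
proof -
  obtain W a b where W: "W \<in> add_closure D T" "a \<in> hom D X (shift D W)" "b \<in> hom D (shift D W) (shift D Y)"
    "h = b \<odot> a" using ghost_factors[OF assms(1)] by blast
  obtain b' where b': "b' \<in> hom D W Y" "b = shift_mor D b'" using shift_full W(3) by blast
  have "y \<odot> b' = 0" by (rule hom_add_T_shift[OF W(1) assms(2) comp_in_hom[OF b'(1) assms(3)]])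
  then have "shift_mor D y \<odot> b = 0" using shift_comp[OF b'(1) assms(3)] b'(2) by simp
  then show ?thesis
    using comp_assoc[OF W(2,3) shift_hom[OF assms(3)]] W(4) comp_zero_left[OF W(2)] by simp
qed

subsection \<open>The exchange triangle ending in \<open>X\<close>\<close>

context
  fixes U U1 X Y g f h
  assumes tri: "triangle D Y U1 X g f h" and h_ghost: "h \<in> ghost X (shift D Y)"
    and f_approx: "right_approx D U U1 X f"
begin

text \<open>In a ghost map Y -> V[1] -> E[1] the first factor extends along \<open>g\<close> to
  \<open>U1\<close>; then U1 -> V[1] -> E[1] is ghost and therefore zero.\<close>

lemma left_exchange_orth_left:
  assumes "orth U E"
  shows "orth Y E"
proof (rule orthI)
  note th = triangle_hom[OF tri]
  fix a assume a: "a \<in> ghost Y (shift D E)"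
  obtain V y c where V: "V \<in> add_closure D T" "y \<in> hom D Y (shift D V)" "c \<in> hom D (shift D V) (shift D E)"
    "a = c \<odot> y" using ghost_factors[OF a] by blast
  obtain z where z: "z \<in> hom D U1 (shift D V)" "y = z \<odot> g"
    using triangle_extend_first[OF tri V(2) shift_comp_ghost_zero[OF h_ghost V(1,2)]] by blast
  have "U1 \<in> add_closure D U" using f_approx unfolding right_approx_def by blast
  then have "c \<odot> z = 0"
    using orthD[OF orth_left[OF assms]] ghost_comp_left[OF ghost_into_shift_T[OF V(1) z(1)] V(3)] by blast
  then show "a = 0" using V(4) z(2) comp_assoc[OF th(1) z(1) V(3)] comp_zero_left[OF th(1)] by simp
qed

text \<open>By rigidity of \<open>U\<close> a ghost map U -> Y[1] dies in U1[1], so it comes from a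
  map U -> X. This lifts through \<open>f\<close>, and \<open>h \<odot> f = 0\<close>.\<close>

lemma left_exchange_orth_right:
  assumes "orth U U"
  shows "orth U Y"
proof (rule orthI)
  note th = triangle_hom[OF tri]
  have U1: "U1 \<in> add_closure D U" using f_approx unfolding right_approx_def by blast
  fix a assume a: "a \<in> ghost U (shift D Y)"
  have "shift_mor D g \<odot> a = 0"
    by (rule orthD[OF orth_right[OF assms U1] ghost_comp_left[OF a shift_hom[OF th(1)]]])
  then obtain b where b: "b \<in> hom D U X" "a = h \<odot> b"
    using triangle_lift_third[OF tri ghost_hom[OF a]] by blast
  obtain w where w: "w \<in> hom D U U1" "b = f \<odot> w"
    using f_approx b(1) add_closure_self unfolding right_approx_def by blast
  show "a = 0"
    using b(2) w(2) comp_assoc[OF w(1) th(2,3)] triangle_comp_zero2(1)[OF tri] comp_zero_left[OF w(1)] by simp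
qed

text \<open>The obstruction to extending \<open>v\<close> along \<open>g\<close> is a ghost map X ->
  Y[1] -> E[1].\<close>

lemma left_exchange_extend:
  assumes "orth X E" "v \<in> hom D Y E"
  shows "\<exists>w \<in> hom D U1 E. v = w \<odot> g"
  by (rule triangle_extend_first[OF tri assms(2)
        orthD[OF assms(1) ghost_comp_left[OF h_ghost shift_hom[OF assms(2)]]]])

text \<open>Otherwise the identity of \<open>Y\<close> extends along \<open>g\<close>, the triangle
  splits, and \<open>X\<close> becomes a summand of \<open>U1\<close>.\<close>

lemma left_exchange_not_in_add_closure:
  assumes "orth X M" "X \<notin> add_closure D U"
  shows "Y \<notin> add_closure D M"
proof
  assume "Y \<in> add_closure D M"
  then obtain w where w: "w \<in> hom D U1 Y" "ident D Y = w \<odot> g"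
    using left_exchange_extend[OF orth_right[OF assms(1)] ident_in_hom] by blast
  then have "triangle D Y U1 X g f 0" using split_mono_triangle[OF tri w(1)] tri by simp
  then have "X \<in> add_closure D U1" using add_closure_summand(2)[OF split_triangle] by blast
  then show False using add_closure_trans f_approx assms(2) unfolding right_approx_def by blast
qed

text \<open>Lifting the inverse of \<open>x\<close> through the approximation gives \<open>w\<close>
  such that \<open>w \<odot> u\<close> and \<open>u \<odot> w\<close> both fix \<open>f\<close>.
  Minimality makes them invertible, hence \<open>u\<close> too, and the five lemma passes this on to
  \<open>e\<close>.\<close>

lemma left_exchange_endo_iso:
  assumes minimal: "\<And>\<phi>. \<phi> \<in> hom D U1 U1 \<Longrightarrow> f \<odot> \<phi> = f \<Longrightarrow> is_iso D U1 U1 \<phi>"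
    and eux: "e \<in> hom D Y Y" "u \<in> hom D U1 U1" "is_iso D X X x"
      "u \<odot> g = g \<odot> e" "x \<odot> f = f \<odot> u" "shift_mor D e \<odot> h = h \<odot> x"
  shows "is_iso D Y Y e"
proof -
  note th = triangle_hom[OF tri]
  obtain x' where x: "x \<in> hom D X X" "x' \<in> hom D X X" "x' \<odot> x = ident D X" "x \<odot> x' = ident D X"
    using eux(3) by (rule is_isoE)
  obtain w where w: "w \<in> hom D U1 U1" "x' \<odot> f = f \<odot> w"
    using f_approx comp_in_hom[OF th(2) x(2)] unfolding right_approx_def by blast
  have "f \<odot> (w \<odot> u) = (x' \<odot> f) \<odot> u" using comp_assoc[OF eux(2) w(1) th(2)] w(2) by simp
  also have "\<dots> = x' \<odot> (x \<odot> f)" using comp_assoc[OF eux(2) th(2) x(2)] eux(5) by simp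
  also have "\<dots> = f" using comp_assoc[OF th(2) x(1,2)] x(3) comp_ident_left[OF th(2)] by simp
  finally have wu: "is_iso D U1 U1 (w \<odot> u)" using minimal comp_in_hom[OF eux(2) w(1)] by blast
  have "f \<odot> (u \<odot> w) = (x \<odot> f) \<odot> w" using comp_assoc[OF w(1) eux(2) th(2)] eux(5) by simp
  also have "\<dots> = x \<odot> (x' \<odot> f)" using comp_assoc[OF w(1) th(2) x(1)] w(2) by simp
  also have "\<dots> = f" using comp_assoc[OF th(2) x(2,1)] x(4) comp_ident_left[OF th(2)] by simp
  finally have "is_iso D U1 U1 (u \<odot> w)" using minimal comp_in_hom[OF w(1) eux(2)] by blast
  then have "is_iso D U1 U1 u" using is_iso_of_two_sided[OF eux(2) wu _ w(1) w(1)] by blast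
  then show ?thesis using triangle_first_iso[OF tri tri eux(1) _ eux(3,4,5,6)] by blast
qed

text \<open>Locality is transferred as an alternative, not by a ring map: the induced
  \<open>x\<close> is a choice, but with (e, u, x) also (1 - e, 1 - u, 1 - x) is an endomorphism of
  the triangle, and \<open>x\<close> or 1 - x is invertible.\<close>

lemma left_exchange_indecomposable:
  assumes X: "indecomposable D X" and orths: "orth X M" "U \<in> add_closure D M" "X \<notin> add_closure D U"
    and minimal: "\<And>\<phi>. \<phi> \<in> hom D U1 U1 \<Longrightarrow> f \<odot> \<phi> = f \<Longrightarrow> is_iso D U1 U1 \<phi>"
  shows "indecomposable D Y"
proof (rule indecomposable_of_iso_or_complement)
  note th = triangle_hom[OF tri]
  have U1: "U1 \<in> add_closure D M" using f_approx orths(2) add_closure_trans unfolding right_approx_def by blast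
  show "ident D Y \<noteq> 0"
    using left_exchange_not_in_add_closure[OF orths(1,3)] zero_object_add_closure zero_object_iff by blast
  fix e assume e: "e \<in> hom D Y Y"
  obtain u where u: "u \<in> hom D U1 U1" "g \<odot> e = u \<odot> g"
    using left_exchange_extend[OF orth_right[OF orths(1) U1] comp_in_hom[OF e th(1)]] by blast
  obtain x where x: "x \<in> hom D X X" "x \<odot> f = f \<odot> u" "shift_mor D e \<odot> h = h \<odot> x"
    using TR3[OF tri tri e u(1) u(2)[symmetric]] by blast
  consider "is_iso D X X x" | "is_iso D X X (ident D X - x)"
    using local_iso_or_complement[OF indecomposable_local[OF X] x(1)] by blast
  then show "is_iso D Y Y e \<or> is_iso D Y Y (ident D Y - e)"
  proof cases
    case 1
    then show ?thesis using left_exchange_endo_iso[OF minimal e u(1) _ u(2)[symmetric] x(2,3)] by blast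
  next
    case 2
    have "is_iso D Y Y (ident D Y - e)"
    proof (rule left_exchange_endo_iso[OF minimal _ _ 2])
      show "ident D Y - e \<in> hom D Y Y" by (rule diff_in_hom[OF ident_in_hom e])
      show "ident D U1 - u \<in> hom D U1 U1" by (rule diff_in_hom[OF ident_in_hom u(1)])
      show "(ident D U1 - u) \<odot> g = g \<odot> (ident D Y - e)"
        by (rule comp_ident_diff[OF th(1) e u(1) u(2)[symmetric]])
      show "(ident D X - x) \<odot> f = f \<odot> (ident D U1 - u)"
        by (rule comp_ident_diff[OF th(2) u(1) x(1,2)])
      show "shift_mor D (ident D Y - e) \<odot> h = h \<odot> (ident D X - x)"
        unfolding shift_ident_diff[OF e] by (rule comp_ident_diff[OF th(3) x(1) shift_hom[OF e] x(3)])
    qed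
    then show ?thesis by blast
  qed
qed

end

subsection \<open>The exchange triangle starting in \<open>X\<close>\<close>

context
  fixes U U2 X Y g f h
  assumes tri: "triangle D X U2 Y g f h" and h_ghost: "h \<in> ghost Y (shift D X)"
    and g_approx: "left_approx D U X U2 g"
begin

text \<open>In a ghost map E -> V[1] -> Y[1] the second factor is the shift of a map V -> Y, which
  \<open>h\<close> kills and which therefore lifts to \<open>U2\<close>. Then E -> V[1] -> U2[1] is
  ghost, so it is zero.\<close>

lemma right_exchange_orth_right:
  assumes "orth E U"
  shows "orth E Y"
proof (rule orthI)
  note th = triangle_hom[OF tri]
  fix a assume a: "a \<in> ghost E (shift D Y)"
  obtain V y c where V: "V \<in> add_closure D T" "y \<in> hom D E (shift D V)" "c \<in> hom D (shift D V) (shift D Y)"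
    "a = c \<odot> y" using ghost_factors[OF a] by blast
  obtain c' where c': "c' \<in> hom D V Y" "c = shift_mor D c'" using shift_full V(3) by blast
  obtain d where d: "d \<in> hom D V U2" "c' = f \<odot> d"
    using triangle_lift_second[OF tri c'(1) ghost_comp_add_T[OF h_ghost V(1) c'(1)]] by blast
  have "U2 \<in> add_closure D U" using g_approx unfolding left_approx_def by blast
  then have "shift_mor D d \<odot> y = 0"
    using orthD[OF orth_right[OF assms]] ghost_comp_left[OF ghost_into_shift_T[OF V(1,2)] shift_hom[OF d(1)]] by blast
  then show "a = 0"
    using V(4) c'(2) d(2) shift_comp[OF d(1) th(2)] comp_assoc[OF V(2) shift_hom[OF d(1)] shift_hom[OF th(2)]]
      comp_zero_right[OF shift_hom[OF th(2)]] by simp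
qed

text \<open>A ghost map Y -> U[1] vanishes on \<open>U2\<close>, so it is \<open>h\<close> followed
  by the shift of some X -> U. That map factors through \<open>g\<close>, and the shift of
  \<open>g\<close> after \<open>h\<close> is zero.\<close>

lemma right_exchange_orth_left:
  assumes "orth U U"
  shows "orth Y U"
proof (rule orthI)
  note th = triangle_hom[OF tri]
  have U2: "U2 \<in> add_closure D U" using g_approx unfolding left_approx_def by blast
  fix a assume a: "a \<in> ghost Y (shift D U)"
  have "a \<odot> f = 0" by (rule orthD[OF orth_left[OF assms U2] ghost_comp_right[OF a th(2)]])
  then obtain b where b: "b \<in> hom D (shift D X) (shift D U)" "a = b \<odot> h"
    using triangle_extend_third[OF tri ghost_hom[OF a]] by blast
  obtain b' where b': "b' \<in> hom D X U" "b = shift_mor D b'" using shift_full b(1) by blast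
  obtain w where w: "w \<in> hom D U2 U" "b' = w \<odot> g"
    using g_approx b'(1) add_closure_self unfolding left_approx_def by blast
  show "a = 0"
    using b(2) b'(2) w(2) shift_comp[OF th(1) w(1)] comp_assoc[OF th(3) shift_hom[OF th(1)] shift_hom[OF w(1)]]
      triangle_comp_zero2(2)[OF tri] comp_zero_right[OF shift_hom[OF w(1)]] by simp
qed

lemma right_exchange_lift:
  assumes "orth E X" "v \<in> hom D E Y"
  shows "\<exists>w \<in> hom D E U2. v = f \<odot> w"
  by (rule triangle_lift_second[OF tri assms(2) orthD[OF assms(1) ghost_comp_right[OF h_ghost assms(2)]]])

lemma right_exchange_not_in_add_closure:
  assumes "orth M X" "X \<notin> add_closure D U"
  shows "Y \<notin> add_closure D M"
proof
  assume "Y \<in> add_closure D M"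
  then obtain w where w: "w \<in> hom D Y U2" "ident D Y = f \<odot> w"
    using right_exchange_lift[OF orth_left[OF assms(1)] ident_in_hom] by blast
  then have "triangle D X U2 Y g f 0" using split_epi_triangle[OF tri w(1)] tri by simp
  then have "X \<in> add_closure D U2" using add_closure_summand(1)[OF split_triangle] by blast
  then show False using add_closure_trans g_approx assms(2) unfolding left_approx_def by blast
qed

lemma right_exchange_endo_iso:
  assumes minimal: "\<And>\<phi>. \<phi> \<in> hom D U2 U2 \<Longrightarrow> \<phi> \<odot> g = g \<Longrightarrow> is_iso D U2 U2 \<phi>"
    and xue: "is_iso D X X x" "u \<in> hom D U2 U2" "e \<in> hom D Y Y"
      "u \<odot> g = g \<odot> x" "e \<odot> f = f \<odot> u" "shift_mor D x \<odot> h = h \<odot> e"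
  shows "is_iso D Y Y e"
proof -
  note th = triangle_hom[OF tri]
  obtain x' where x: "x \<in> hom D X X" "x' \<in> hom D X X" "x' \<odot> x = ident D X" "x \<odot> x' = ident D X"
    using xue(1) by (rule is_isoE)
  obtain w where w: "w \<in> hom D U2 U2" "g \<odot> x' = w \<odot> g"
    using g_approx comp_in_hom[OF x(2) th(1)] unfolding left_approx_def by blast
  have "(u \<odot> w) \<odot> g = u \<odot> (g \<odot> x')" using comp_assoc[OF th(1) w(1) xue(2)] w(2) by simp
  also have "\<dots> = (g \<odot> x) \<odot> x'" using comp_assoc[OF x(2) th(1) xue(2)] xue(4) by simp
  also have "\<dots> = g" using comp_assoc[OF x(2,1) th(1)] x(4) comp_ident_right[OF th(1)] by simp
  finally have uw: "is_iso D U2 U2 (u \<odot> w)" using minimal comp_in_hom[OF w(1) xue(2)] by blast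
  have "(w \<odot> u) \<odot> g = w \<odot> (g \<odot> x)" using comp_assoc[OF th(1) xue(2) w(1)] xue(4) by simp
  also have "\<dots> = (g \<odot> x') \<odot> x" using comp_assoc[OF x(1) th(1) w(1)] w(2) by simp
  also have "\<dots> = g" using comp_assoc[OF x(1,2) th(1)] x(3) comp_ident_right[OF th(1)] by simp
  finally have "is_iso D U2 U2 (w \<odot> u)" using minimal comp_in_hom[OF xue(2) w(1)] by blast
  then have "is_iso D U2 U2 u" using is_iso_of_two_sided[OF xue(2) _ uw w(1) w(1)] by blast
  then show ?thesis using triangle_third_iso[OF tri tri xue(1) _ xue(3,4,5,6)] by blast
qed

lemma right_exchange_indecomposable:
  assumes X: "indecomposable D X" and orths: "orth M X" "U \<in> add_closure D M" "X \<notin> add_closure D U"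
    and minimal: "\<And>\<phi>. \<phi> \<in> hom D U2 U2 \<Longrightarrow> \<phi> \<odot> g = g \<Longrightarrow> is_iso D U2 U2 \<phi>"
  shows "indecomposable D Y"
proof (rule indecomposable_of_iso_or_complement)
  note th = triangle_hom[OF tri]
  have U2: "U2 \<in> add_closure D M" using g_approx orths(2) add_closure_trans unfolding left_approx_def by blast
  show "ident D Y \<noteq> 0"
    using right_exchange_not_in_add_closure[OF orths(1,3)] zero_object_add_closure zero_object_iff by blast
  fix e assume e: "e \<in> hom D Y Y"
  obtain u where u: "u \<in> hom D U2 U2" "e \<odot> f = f \<odot> u"
    using right_exchange_lift[OF orth_left[OF orths(1) U2] comp_in_hom[OF th(2) e]] by blast
  \<comment> \<open>The known square joins the second and third terms, so \<open>TR3\<close> is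
    applied after a rotation and returns the component on X[1]; fullness of the shift brings it back
    to \<open>X\<close>.\<close>
  obtain c where c: "c \<in> hom D (shift D X) (shift D X)" "c \<odot> h = h \<odot> e"
    "shift_mor D u \<odot> (- shift_mor D g) = (- shift_mor D g) \<odot> c"
    using TR3[OF triangle_rotate[OF tri] triangle_rotate[OF tri] u(1) e u(2)] by blast
  obtain x where x: "x \<in> hom D X X" "c = shift_mor D x" using shift_full c(1) by blast
  have "- shift_mor D (u \<odot> g) = - shift_mor D (g \<odot> x)"
    using c(3) x(2) comp_neg_left[OF c(1) shift_hom[OF th(1)]]
      comp_neg_right[OF shift_hom[OF th(1)] shift_hom[OF u(1)]]
      shift_comp[OF th(1) u(1)] shift_comp[OF x(1) th(1)] by simp
  then have ug: "u \<odot> g = g \<odot> x"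
    using shift_faithful[OF comp_in_hom[OF th(1) u(1)] comp_in_hom[OF x(1) th(1)]] by simp
  have xh: "shift_mor D x \<odot> h = h \<odot> e" using c(2) x(2) by simp
  consider "is_iso D X X x" | "is_iso D X X (ident D X - x)"
    using local_iso_or_complement[OF indecomposable_local[OF X] x(1)] by blast
  then show "is_iso D Y Y e \<or> is_iso D Y Y (ident D Y - e)"
  proof cases
    case 1
    then show ?thesis using right_exchange_endo_iso[OF minimal _ u(1) e ug u(2) xh] by blast
  next
    case 2
    have "is_iso D Y Y (ident D Y - e)"
    proof (rule right_exchange_endo_iso[OF minimal 2])
      show "ident D Y - e \<in> hom D Y Y" by (rule diff_in_hom[OF ident_in_hom e])
      show "ident D U2 - u \<in> hom D U2 U2" by (rule diff_in_hom[OF ident_in_hom u(1)])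
      show "(ident D U2 - u) \<odot> g = g \<odot> (ident D X - x)"
        by (rule comp_ident_diff[OF th(1) x(1) u(1) ug])
      show "(ident D Y - e) \<odot> f = f \<odot> (ident D U2 - u)"
        by (rule comp_ident_diff[OF th(2) u(1) e u(2)])
      show "shift_mor D (ident D X - x) \<odot> h = h \<odot> (ident D Y - e)"
        unfolding shift_ident_diff[OF x(1)] by (rule comp_ident_diff[OF th(3) e shift_hom[OF x(1)] xh])
    qed
    then show ?thesis by blast
  qed
qed

end

subsection \<open>Serre duality\<close>

text \<open>By essential surjectivity S T is isomorphic to some V[2]. Then Hom(T, V[1]) is
  isomorphic to Hom(T[1], S T), whose dual is Hom(T, T[1]) = 0, so cluster tilting puts
  \<open>V\<close> into add T.\<close>

lemma serre_dual_T:
  assumes "serre_functor D S Sm"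
  shows "\<exists>V \<in> add_closure D T. isomorphic D (shift D (shift D V)) (S T)"
proof -
  obtain W where W: "isomorphic D (shift D W) (S T)"
    using autoequivalence_essentially_surjective[OF shift_autoequivalence] by blast
  obtain V where V: "isomorphic D (shift D V) W"
    using autoequivalence_essentially_surjective[OF shift_autoequivalence] by blast
  have "isomorphic D (shift D (shift D V)) (shift D W)"
    using V shift_iso_iff is_iso_hom unfolding isomorphic_def by blast
  then have iso: "isomorphic D (shift D (shift D V)) (S T)" using isomorphic_trans W by blast
  then obtain \<phi> where \<phi>: "is_iso D (shift D (shift D V)) (S T) \<phi>" by (auto simp: isomorphic_def)
  obtain \<eta> :: "'o \<Rightarrow> 'o \<Rightarrow> 'm \<Rightarrow> 'm \<Rightarrow> 'k"
    where "\<forall>A B. bij_betw (\<eta> A B) (hom D A B) (hom_dual D B (S A))"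
    using assms[unfolded serre_functor_def] by (elim conjE exE) (rule that)
  then have "bij_betw (\<eta> T (shift D T)) (hom D T (shift D T)) (hom_dual D (shift D T) (S T))" by simp
  moreover have "hom D T (shift D T) = {0}" using add_T_iff add_closure_self by blast
  ultimately have dual: "\<exists>z. hom_dual D (shift D T) (S T) = {z}" unfolding bij_betw_def by auto
  \<comment> \<open>The dual of Hom(T[1], S T) has a single element, but a nonzero \<open>y\<close>
    would be separated from 0 by a linear functional, cut off outside the Hom-space to meet the
    normalisation.\<close>
  have zero: "y = 0" if y: "y \<in> hom D (shift D T) (S T)" for y
  proof (rule ccontr)
    assume "y \<noteq> 0"
    interpret k: vector_space "(*) :: 'k \<Rightarrow> 'k \<Rightarrow> 'k" by unfold_locales (auto simp: algebra_simps)
    interpret p: vector_space_pair "scale D" "(*) :: 'k \<Rightarrow> 'k \<Rightarrow> 'k" ..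
    have "vs.independent {y}" using \<open>y \<noteq> 0\<close> by simp
    then obtain l where l: "Vector_Spaces.linear (scale D) ((*) :: 'k \<Rightarrow> 'k \<Rightarrow> 'k) l" "l y = 1"
      using p.linear_independent_extend[of "{y}" "\<lambda>_. 1"] by auto
    interpret l: Vector_Spaces.linear "scale D" "(*) :: 'k \<Rightarrow> 'k \<Rightarrow> 'k" l by (rule l(1))
    define l' where "l' x = (if x \<in> hom D (shift D T) (S T) then l x else 0)" for x
    have "l' \<in> hom_dual D (shift D T) (S T)" unfolding hom_dual_def l'_def
      by (auto simp: l.add l.scale intro: add_in_hom scale_in_hom)
    moreover have "(\<lambda>_. 0) \<in> hom_dual D (shift D T) (S T)" unfolding hom_dual_def by auto
    ultimately have "l' = (\<lambda>_. 0)" using dual by auto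
    then show False using l(2) y unfolding l'_def by (metis zero_neq_one)
  qed
  have "u = 0" if u: "u \<in> hom D T (shift D V)" for u
  proof -
    have "\<phi> \<odot> shift_mor D u = \<phi> \<odot> 0"
      using zero[OF comp_in_hom[OF shift_hom[OF u] is_iso_hom[OF \<phi>]]] comp_zero_right[OF is_iso_hom[OF \<phi>]] by simp
    then have "shift_mor D u = shift_mor D 0" using iso_cancel_left[OF \<phi> shift_hom[OF u] zero_in_hom] by simp
    then show ?thesis using shift_faithful[OF u zero_in_hom] by blast
  qed
  then have "V \<in> add_closure D T" using add_T_iff by auto
  then show ?thesis using iso by blast
qed

text \<open>By naturality the functional of \<open>h \<odot> t\<close> takes at z: X[1] -> S T the
  value that the functional of \<open>t\<close> takes at \<open>z \<odot> h\<close>. Up to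
  isomorphism \<open>z\<close> is the shift of a map X -> V[1] with \<open>V\<close> in add T, which
  extends along \<open>g\<close>; as the shift of \<open>g\<close> kills \<open>h\<close>, so does
  \<open>z\<close>.\<close>

lemma ghost_by_serre_duality:
  assumes S: "serre_functor D S Sm" and tri: "triangle D X E Y g f h"
    and ext: "\<And>x. x \<in> hom D X (shift D T) \<Longrightarrow> \<exists>v \<in> hom D E (shift D T). x = v \<odot> g"
  shows "h \<in> ghost Y (shift D X)"
proof -
  note th = triangle_hom[OF tri]
  obtain V where V: "V \<in> add_closure D T" "isomorphic D (shift D (shift D V)) (S T)"
    using serre_dual_T[OF S] by blast
  \<comment> \<open>The hypothesis concerns T[1] itself; it passes to V[1] by writing the identity
    of V[1] as a sum of composites through T[1].\<close>
  have extV: "\<exists>v \<in> hom D E (shift D V). x = v \<odot> g" if x: "x \<in> hom D X (shift D V)" for x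
  proof -
    have "ident D (shift D V) \<in> thru (shift D T) (shift D V) (shift D V)"
      using shift_add_closure[OF V(1)] in_add_closure_iff by blast
    then have "\<exists>v \<in> hom D E (shift D V). ident D (shift D V) \<odot> x = v \<odot> g"
    proof (induction rule: thru_induct)
      case zero
      show ?case by (rule bexI[of _ 0]) (use comp_zero_left[OF x] comp_zero_left[OF th(1)] in auto)
    next
      case (step a b y)
      obtain v where v: "v \<in> hom D E (shift D T)" "a \<odot> x = v \<odot> g" using ext[OF comp_in_hom[OF x step(1)]] by blast
      obtain w where w: "w \<in> hom D E (shift D V)" "y \<odot> x = w \<odot> g" using step by blast
      have "(b \<odot> a + y) \<odot> x = (b \<odot> v + w) \<odot> g"
        using comp_add_left[OF x comp_in_hom[OF step(1,2)] step(3)] comp_assoc[OF x step(1,2)] v(2) w(2)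
          comp_add_left[OF th(1) comp_in_hom[OF v(1) step(2)] w(1)] comp_assoc[OF th(1) v(1) step(2)] by simp
      then show ?case using add_in_hom[OF comp_in_hom[OF v(1) step(2)] w(1)] by blast
    qed
    then show ?thesis using comp_ident_left[OF x] by simp
  qed
  have zeroV: "z \<odot> h = 0" if z: "z \<in> hom D (shift D X) (shift D (shift D V))" for z
  proof -
    obtain x where x: "x \<in> hom D X (shift D V)" "z = shift_mor D x" using shift_full z by blast
    obtain v where v: "v \<in> hom D E (shift D V)" "x = v \<odot> g" using extV[OF x(1)] by blast
    show ?thesis
      using x(2) v(2) shift_comp[OF th(1) v(1)] comp_assoc[OF th(3) shift_hom[OF th(1)] shift_hom[OF v(1)]]
        triangle_comp_zero2(2)[OF tri] comp_zero_right[OF shift_hom[OF v(1)]] by simp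
  qed
  have zero: "z \<odot> h = 0" if z: "z \<in> hom D (shift D X) (S T)" for z
  proof -
    obtain k where k: "is_iso D (S T) (shift D (shift D V)) k"
      using isomorphic_sym[OF V(2)] by (auto simp: isomorphic_def)
    have kh: "k \<in> hom D (S T) (shift D (shift D V))" by (rule is_iso_hom[OF k])
    have "k \<odot> (z \<odot> h) = k \<odot> 0"
      using comp_assoc[OF th(3) z kh] zeroV[OF comp_in_hom[OF z kh]] comp_zero_right[OF kh] by simp
    then show ?thesis using iso_cancel_left[OF k comp_in_hom[OF th(3) z] zero_in_hom] by blast
  qed
  obtain \<eta> :: "'o \<Rightarrow> 'o \<Rightarrow> 'm \<Rightarrow> 'm \<Rightarrow> 'k" where
    bij: "\<forall>A B. bij_betw (\<eta> A B) (hom D A B) (hom_dual D B (S A))" and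
    add: "\<forall>A B. \<forall>f \<in> hom D A B. \<forall>g \<in> hom D A B. \<forall>x. \<eta> A B (f + g) x = \<eta> A B f x + \<eta> A B g x" and
    nat: "\<forall>A A' B B'. \<forall>a \<in> hom D A' A. \<forall>b \<in> hom D B B'. \<forall>f \<in> hom D A B. \<forall>x \<in> hom D B' (S A').
           \<eta> A' B' (b \<odot> f \<odot> a) x = \<eta> A B f (Sm a \<odot> x \<odot> b)"
    using S[unfolded serre_functor_def] by (elim conjE exE) (rule that)
  have Sm: "Sm (ident D T) = ident D (S T)"
  proof -
    have "k_linear_autoequivalence D S Sm" using S unfolding serre_functor_def by (rule conjunct1)
    then have "k_linear_endofunctor D S Sm" unfolding k_linear_autoequivalence_def by (rule conjunct1)
    then show ?thesis unfolding k_linear_endofunctor_def by blast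
  qed
  have eta0: "\<eta> A B 0 x = 0" for A B x
  proof -
    have "\<eta> A B 0 x = \<eta> A B 0 x + \<eta> A B 0 x" using add[rule_format, of 0 A B 0 x] by simp
    then show ?thesis using add_cancel_right_right by blast
  qed
  have "h \<odot> t = 0" if t: "t \<in> hom D T Y" for t
  proof -
    have ht: "h \<odot> t \<in> hom D T (shift D X)" by (rule comp_in_hom[OF t th(3)])
    have "\<eta> T (shift D X) (h \<odot> t) x = 0" for x
    proof (cases "x \<in> hom D (shift D X) (S T)")
      case True
      have "\<eta> T (shift D X) (h \<odot> t \<odot> ident D T) x = \<eta> T Y t (Sm (ident D T) \<odot> x \<odot> h)"
        using nat[rule_format, OF ident_in_hom th(3) t True] .
      also have "Sm (ident D T) \<odot> x \<odot> h = 0" using zero[OF True] Sm comp_ident_left[OF True] by simp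
      finally have *: "\<eta> T (shift D X) (h \<odot> t \<odot> ident D T) x = \<eta> T Y t 0" .
      have "\<eta> T Y t \<in> hom_dual D Y (S T)" using bij t unfolding bij_betw_def by blast
      then have "\<eta> T Y t (0 + 0) = \<eta> T Y t 0 + \<eta> T Y t 0" unfolding hom_dual_def using zero_in_hom by blast
      then have "\<eta> T Y t 0 = \<eta> T Y t 0 + \<eta> T Y t 0" by (simp only: add_0_left)
      then have "\<eta> T Y t 0 = 0" using add_cancel_right_right by blast
      then show ?thesis using * comp_ident_right[OF ht] by simp
    next
      case False
      have "\<eta> T (shift D X) (h \<odot> t) \<in> hom_dual D (shift D X) (S T)"
        using bij ht unfolding bij_betw_def by blast
      then show ?thesis using False unfolding hom_dual_def by blast
    qed
    then have "\<eta> T (shift D X) (h \<odot> t) = \<eta> T (shift D X) 0" using eta0 by (simp add: fun_eq_iff)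
    moreover have "inj_on (\<eta> T (shift D X)) (hom D T (shift D X))" using bij unfolding bij_betw_def by blast
    ultimately show ?thesis using ht zero_in_hom unfolding inj_on_def by blast
  qed
  then show ?thesis unfolding ghost_def using th by blast
qed

subsection \<open>The case \<open>X \<notin> U * [T[1]]\<close>\<close>

lemma dim_hom_direct_sum:
  "is_direct_sum D [A, B] S \<Longrightarrow> vs.dim (hom D Z S) = vs.dim (hom D Z A) + vs.dim (hom D Z B)"
  by (rule dim_subfunctor_direct_sum[of "hom D Z" Z]) (auto intro: hom_subspace comp_in_hom)

lemma dim_endo_pos:
  assumes "indecomposable D X"
  shows "vs.dim (hom D X X) > 0"
proof -
  obtain K where K: "finite K" "hom D X X = vs.span K" using hom_finite unfolding hom_finite_def by blast
  have "{0} \<subset> hom D X X" using indecomposable_ident_nonzero[OF assms] ident_in_hom[of X] zero_in_hom by blast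
  then have "vs.dim {0} < vs.dim (hom D X X)"
    by (rule vs.dim_less_of_psubset[OF _ vs.subspace_single_0 K(1)]) (simp add: K(2))
  then show ?thesis by simp
qed

lemma approx_of_shift_T_in_add_closure:
  assumes M: "is_direct_sum D [U, X] M" "rel_cluster_tilting D T M" and X: "indecomposable D X"
    and not_star: "X \<notin> rel_star D T U"
  shows "\<exists>M' p. right_approx D M M' (shift D T) p \<and> M' \<in> add_closure D U"
proof -
  have rigid: "orth M M" using M(2) rel_rigid_iff unfolding rel_cluster_tilting_def by blast
  have XM: "X \<in> add_closure D M" by (rule add_closure_summand(2)[OF M(1)])
  have in_add_U: "N \<in> add_closure D U" if "N \<in> add_closure D M" "X \<notin> add_closure D N" for N
  proof (rule add_closure_by_indecomposables)
    fix A assume A: "indecomposable D A" "A \<in> add_closure D N"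
    then have "A \<in> add_closure D U \<or> A \<in> add_closure D X"
      using add_closure_direct_sum_cases[OF M(1) A(1)] add_closure_trans[OF A(2) that(1)] by blast
    moreover have "A \<notin> add_closure D X"
      using add_closure_indecomposable_iff[OF A(1) X] add_closure_indecomposable_iff[OF X A(1)]
        isomorphic_sym add_closure_trans[OF _ A(2)] that(2) by blast
    ultimately show "A \<in> add_closure D U" by blast
  qed
  \<comment> \<open>A substitute for minimality: among all right approximations one with least dim
    Hom(X, M') is taken, so that no copy of \<open>X\<close> can be removed from it.\<close>
  define Q where "Q = (\<lambda>(M', p). right_approx D M M' (shift D T) p)"
  obtain M0 p0 where "Q (M0, p0)" unfolding Q_def using right_approx_exists[OF hom_finite, of M "shift D T"] by auto
  then obtain Mp where "Q Mp" "\<forall>z. Q z \<longrightarrow> vs.dim (hom D X (fst Mp)) \<le> vs.dim (hom D X (fst z))"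
    using ex_has_least_nat[of Q "(M0, p0)" "\<lambda>z. vs.dim (hom D X (fst z))"] by blast
  then obtain M' p where p: "right_approx D M M' (shift D T) p" and
    least: "\<And>M'' p'. right_approx D M M'' (shift D T) p' \<Longrightarrow> vs.dim (hom D X M') \<le> vs.dim (hom D X M'')"
    unfolding Q_def by (cases Mp) auto
  have ph: "p \<in> hom D M' (shift D T)" "M' \<in> add_closure D M" using p unfolding right_approx_def by auto
  obtain B b k where tri: "triangle D T B M' b k p" using triangle_cocone[OF ph(1)] by blast
  note th = triangle_hom[OF tri]
  have BM: "B \<in> add_closure D M" by (rule rel_cluster_tilting_coresolution[OF M(2) add_closure_self p tri])
  \<comment> \<open>An invertible endomorphism of \<open>X\<close> through \<open>k\<close> would
    split off from \<open>M'\<close> a copy of \<open>X\<close> on which \<open>p\<close> vanishes,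
    because \<open>p \<odot> k = 0\<close>. The complement \<open>Z\<close> would still be an
    approximation, with a smaller Hom-dimension.\<close>
  have noniso: "\<not> is_iso D X X (c \<odot> (k \<odot> y))" if c: "c \<in> hom D M' X" and y: "y \<in> hom D X B" for c y
  proof
    assume "is_iso D X X (c \<odot> (k \<odot> y))"
    then obtain u where u: "u \<in> hom D X X" "u \<odot> (c \<odot> (k \<odot> y)) = ident D X" using is_isoE by metis
    have d: "k \<odot> y \<in> hom D X M'" by (rule comp_in_hom[OF y th(2)])
    have "(u \<odot> c) \<odot> (k \<odot> y) = ident D X" using comp_assoc[OF d c u(1)] u(2) by simp
    then obtain Z g s r where Z: "is_direct_sum D [X, Z] M'" "g \<in> hom D M' Z" "s \<in> hom D Z M'" "r \<in> hom D M' X"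
      "k \<odot> y \<odot> r + s \<odot> g = ident D M'"
      using split_mono_direct_sum[OF d comp_in_hom[OF c u(1)]] by blast
    have "right_approx D M Z (shift D T) (p \<odot> s)"
    proof (rule right_approxI)
      show "Z \<in> add_closure D M" by (rule add_closure_trans[OF add_closure_summand(2)[OF Z(1)] ph(2)])
      show "p \<odot> s \<in> hom D Z (shift D T)" by (rule comp_in_hom[OF Z(3) ph(1)])
      fix v assume "v \<in> hom D M (shift D T)"
      then obtain w where w: "w \<in> hom D M M'" "v = p \<odot> w"
        using p add_closure_self unfolding right_approx_def by blast
      have pky: "p \<odot> (k \<odot> y) = 0"
        using comp_assoc[OF y th(2,3)] triangle_comp_zero2(1)[OF tri] comp_zero_left[OF y] by simp
      have "p = p \<odot> (k \<odot> y \<odot> r + s \<odot> g)" using Z(5) comp_ident_right[OF ph(1)] by simp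
      also have "\<dots> = p \<odot> (k \<odot> y \<odot> r) + p \<odot> (s \<odot> g)"
        by (rule comp_add_right[OF comp_in_hom[OF Z(4) d] comp_in_hom[OF Z(2,3)] ph(1)])
      also have "\<dots> = p \<odot> s \<odot> g"
        using comp_assoc[OF Z(4) d ph(1)] pky comp_zero_left[OF Z(4)] comp_assoc[OF Z(2,3) ph(1)] by simp
      finally have "v = (p \<odot> s) \<odot> (g \<odot> w)"
        using w(2) comp_assoc[OF w(1) Z(2) comp_in_hom[OF Z(3) ph(1)]] by simp
      then show "\<exists>w \<in> hom D M Z. v = p \<odot> s \<odot> w" using comp_in_hom[OF w(1) Z(2)] by blast
    qed
    then have "vs.dim (hom D X M') \<le> vs.dim (hom D X Z)" by (rule least)
    then show False using dim_hom_direct_sum[OF Z(1), of X] dim_endo_pos[OF X] by simp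
  qed
  \<comment> \<open>If \<open>X\<close> did not occur in \<open>B\<close>, then \<open>B\<close>
    would lie in add U. By rigidity every t: T -> X extends along \<open>b\<close>, so it would
    factor through add U, against \<open>not_star\<close>.\<close>
  have XB: "X \<in> add_closure D B"
  proof (rule ccontr)
    assume "X \<notin> add_closure D B"
    then have BU: "B \<in> add_closure D U" using in_add_U[OF BM] by blast
    have "X \<in> rel_star D T U" unfolding rel_star_iff
    proof
      fix t assume t: "t \<in> hom D T X"
      have "shift_mor D t \<odot> p = 0"
        by (rule orthD[OF orth_left[OF orth_right[OF rigid XM] ph(2)]
              ghost_comp_left[OF ghost_into_shift_T[OF add_closure_self ph(1)] shift_hom[OF t]]])
      then obtain w where "w \<in> hom D B X" "t = w \<odot> b" using triangle_extend_first[OF tri t] by blast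
      then show "t \<in> thru U T X" using thru_via[OF BU th(1)] by blast
    qed
    then show False using not_star by blast
  qed
  obtain y0 s where s: "y0 \<in> hom D X B" "s \<in> hom D B X" "s \<odot> y0 = ident D X"
    using mult_nonzero_summand[OF X, of B] mult_pos_iff[OF X, of B] XB by (metis less_irrefl)
  have "X \<notin> add_closure D M'"
  proof
    assume "X \<in> add_closure D M'"
    then obtain y c where y: "y \<in> hom D X M'" "c \<in> hom D M' X" "c \<odot> y = ident D X"
      using mult_nonzero_summand[OF X, of M'] mult_pos_iff[OF X, of M'] by (metis less_irrefl)
    \<comment> \<open>The map B -> X -> M' is null-homotopic because Hom(T, T[1]) = 0: it has the
      form w' k + k e. Restricted to \<open>X\<close>, this writes the identity of \<open>X\<close>
      as a sum of two endomorphisms through \<open>k\<close>; by locality one of them is invertible,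
      against \<open>noniso\<close>.\<close>
    have r: "y \<odot> s \<in> hom D B M'" by (rule comp_in_hom[OF s(2) y(1)])
    have "(p \<odot> (y \<odot> s)) \<odot> b = 0"
      by (rule hom_add_T_shift[OF add_closure_self add_closure_self comp_in_hom[OF th(1) comp_in_hom[OF r ph(1)]]])
    then obtain w where w: "w \<in> hom D M' (shift D T)" "p \<odot> (y \<odot> s) = w \<odot> k"
      using triangle_extend_second[OF tri comp_in_hom[OF r ph(1)]] by blast
    obtain w' where w': "w' \<in> hom D M' M'" "w = p \<odot> w'" using p w(1) ph(2) unfolding right_approx_def by blast
    have wk: "w' \<odot> k \<in> hom D B M'" by (rule comp_in_hom[OF th(2) w'(1)])
    have "p \<odot> (y \<odot> s - w' \<odot> k) = 0"
      using comp_diff_right[OF r wk ph(1)] w(2) w'(2) comp_assoc[OF th(2) w'(1) ph(1)] by simp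
    then obtain e where e: "e \<in> hom D B B" "y \<odot> s - w' \<odot> k = k \<odot> e"
      using triangle_lift_second[OF tri diff_in_hom[OF r wk]] by blast
    have ke: "k \<odot> e \<in> hom D B M'" by (rule comp_in_hom[OF e(1) th(2)])
    have "y = (y \<odot> s) \<odot> y0" using comp_assoc[OF s(1,2) y(1)] s(3) comp_ident_right[OF y(1)] by simp
    also have "y \<odot> s = w' \<odot> k + k \<odot> e" using e(2) by (simp add: algebra_simps)
    also have "(w' \<odot> k + k \<odot> e) \<odot> y0 = w' \<odot> (k \<odot> y0) + k \<odot> (e \<odot> y0)"
      using comp_add_left[OF s(1) wk ke] comp_assoc[OF s(1) th(2) w'(1)] comp_assoc[OF s(1) e(1) th(2)] by simp
    finally have "y = w' \<odot> (k \<odot> y0) + k \<odot> (e \<odot> y0)" .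
    then have sum: "ident D X = (c \<odot> w') \<odot> (k \<odot> y0) + c \<odot> (k \<odot> (e \<odot> y0))"
      using y(3) comp_add_right[OF comp_in_hom[OF comp_in_hom[OF s(1) th(2)] w'(1)]
          comp_in_hom[OF comp_in_hom[OF s(1) e(1)] th(2)] y(2)]
        comp_assoc[OF comp_in_hom[OF s(1) th(2)] w'(1) y(2)] by simp
    have cw: "c \<odot> w' \<in> hom D M' X" and ey: "e \<odot> y0 \<in> hom D X B"
      using comp_in_hom[OF w'(1) y(2)] comp_in_hom[OF s(1) e(1)] by auto
    have "is_iso D X X ((c \<odot> w') \<odot> (k \<odot> y0)) \<or> is_iso D X X (c \<odot> (k \<odot> (e \<odot> y0)))"
      by (rule indecomposable_noniso_add[OF X comp_in_hom[OF comp_in_hom[OF s(1) th(2)] cw]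
            comp_in_hom[OF comp_in_hom[OF ey th(2)] y(2)]]) (simp add: sum[symmetric] is_iso_ident)
    then show False using noniso[OF cw s(1)] noniso[OF y(2) ey] by blast
  qed
  then show ?thesis using in_add_U[OF ph(2)] p by blast
qed

lemma ghost_of_not_rel_star:
  assumes S: "serre_functor D S Sm"
    and M: "is_direct_sum D [U, X] M" "rel_cluster_tilting D T M" and X: "indecomposable D X"
    and not_star: "X \<notin> rel_star D T U"
    and tri: "triangle D X U2 Y g f h" and g: "left_approx D U X U2 g"
  shows "h \<in> ghost Y (shift D X)"
proof (rule ghost_by_serre_duality[OF S tri])
  obtain M' p where p: "right_approx D M M' (shift D T) p" "M' \<in> add_closure D U"
    using approx_of_shift_T_in_add_closure[OF M X not_star] by blast
  then have ph: "p \<in> hom D M' (shift D T)" unfolding right_approx_def by blast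
  fix x assume x: "x \<in> hom D X (shift D T)"
  obtain w where w: "w \<in> hom D X M'" "x = p \<odot> w"
    using p(1) x add_closure_summand(2)[OF M(1)] unfolding right_approx_def by blast
  obtain v where v: "v \<in> hom D U2 M'" "w = v \<odot> g"
    using g w(1) p(2) unfolding left_approx_def by blast
  have "x = (p \<odot> v) \<odot> g" using w(2) v(2) comp_assoc[OF triangle_hom(1)[OF tri] v(1) ph] by simp
  then show "\<exists>v \<in> hom D U2 (shift D T). x = v \<odot> g" using comp_in_hom[OF v(1) ph] by blast
qed

text \<open>The part common to both cases. That \<open>Y\<close> is outside add M does triple duty:
  \<open>Y\<close> is a new summand beside \<open>U\<close>, it differs from \<open>X\<close>, and
  \<open>N\<close> cannot be isomorphic to \<open>M\<close>.\<close>

lemma exchange_complement: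
  assumes M: "is_direct_sum D [U, X] M" "basic D M" "rel_cluster_tilting D T M" and X: "indecomposable D X"
    and Y: "indecomposable D Y" "Y \<notin> add_closure D M" "orth U Y" "orth Y U" "orth Y Y"
  shows "is_complement D T U Y" "\<not> isomorphic D Y X"
    and "is_direct_sum D [U, Y] N \<Longrightarrow> \<not> isomorphic D N M"
proof -
  have rigid: "orth M M" and count: "num_summands D M = num_summands D T"
    using M(3) rel_rigid_iff unfolding rel_cluster_tilting_def by auto
  have U: "basic D U" "X \<notin> add_closure D U" using basic_direct_sum_iff[OF M(1) X] M(2) by auto
  have num: "num_summands D U + 1 = num_summands D T" using num_summands_direct_sum[OF M(1) X U(2)] count by simp
  have UM: "U \<in> add_closure D M" "X \<in> add_closure D M" using add_closure_summand[OF M(1)] by auto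
  have UU: "orth U U" using orth_of_direct_sum[OF rigid M(1)] by blast
  have YU: "Y \<notin> add_closure D U" using Y(2) add_closure_trans[OF _ UM(1)] by blast
  obtain N0 where N0: "is_direct_sum D [U, Y] N0" using direct_sum_exists by blast
  have "rel_cluster_tilting D T N0" unfolding rel_cluster_tilting_def rel_rigid_iff
    using orth_direct_sum[OF N0 UU Y(3,4,5)] num_summands_direct_sum[OF N0 Y(1) YU] num by simp
  moreover have "basic D N0" using basic_direct_sum_iff[OF N0 Y(1)] U(1) YU by blast
  ultimately show "is_complement D T U Y"
    unfolding is_complement_def almost_rel_cluster_tilting_def rel_rigid_iff using U(1) UU num Y(1) N0 by blast
  show "\<not> isomorphic D Y X"
    using add_closure_indecomposable_iff[OF Y(1) X] Y(2) add_closure_trans[OF _ UM(2)] by blast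
  show "\<not> isomorphic D N M" if N: "is_direct_sum D [U, Y] N"
  proof
    assume "isomorphic D N M"
    then have "is_direct_sum D [U, Y] M" using biproduct_iso_target[OF N] by blast
    then show False using add_closure_summand(2) Y(2) by blast
  qed
qed

section \<open>The order for objects that share the summand \<open>U\<close>\<close>

lemma rel_star_direct_sum:
  assumes "is_direct_sum D [A, B] S" "A \<in> rel_star D T M" "B \<in> rel_star D T M"
  shows "S \<in> rel_star D T M"
  unfolding rel_star_iff
proof
  fix t assume t: "t \<in> hom D T S"
  obtain i p j q where *: "i \<in> hom D A S" "p \<in> hom D S A" "j \<in> hom D B S" "q \<in> hom D S B"
    "i \<odot> p + j \<odot> q = ident D S" using assms(1) by (rule biproductE)
  have "p \<odot> t \<in> thru M T A" "q \<odot> t \<in> thru M T B"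
    using assms(2,3) comp_in_hom[OF t *(2)] comp_in_hom[OF t *(4)] unfolding rel_star_iff by auto
  then have "i \<odot> (p \<odot> t) + j \<odot> (q \<odot> t) \<in> thru M T S"
    using thru_add[OF thru_comp_left[OF _ *(1)] thru_comp_left[OF _ *(3)]] by blast
  moreover have "i \<odot> (p \<odot> t) + j \<odot> (q \<odot> t) = (i \<odot> p + j \<odot> q) \<odot> t"
    using comp_add_left[OF t comp_in_hom[OF *(2,1)] comp_in_hom[OF *(4,3)]]
      comp_assoc[OF t *(2,1)] comp_assoc[OF t *(4,3)] by simp
  ultimately show "t \<in> thru M T S" using *(5) comp_ident_left[OF t] by simp
qed

lemma rel_star_of_add_closure: "Z \<in> add_closure D M \<Longrightarrow> Z \<in> rel_star D T M"
  unfolding rel_star_iff using in_add_closure_iff thru_of_ident_target by blast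

lemma rel_star_mono: "X \<in> rel_star D T U \<Longrightarrow> U \<in> add_closure D N \<Longrightarrow> X \<in> rel_star D T N"
  unfolding rel_star_iff using thru_mono in_add_closure_iff by blast

text \<open>The order is tested on the object \<open>M\<close>, hence on its summands
  \<open>U\<close> and \<open>X\<close>. The second case of the theorem uses this with
  \<open>X\<close> and \<open>Y\<close> exchanged.\<close>

lemma rel_ge_direct_sum:
  assumes "is_direct_sum D [U, X] M" "is_direct_sum D [U, Y] N" "X \<in> rel_star D T U"
  shows "rel_ge D T N M"
proof -
  have U: "U \<in> add_closure D N" by (rule add_closure_summand(1)[OF assms(2)])
  show ?thesis unfolding rel_ge_iff
    by (rule rel_star_direct_sum[OF assms(1) rel_star_of_add_closure[OF U] rel_star_mono[OF assms(3) U]])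
qed

end

theorem theorem4p10:
  fixes D :: "('k::alg_closed_field, 'o, 'm::ab_group_add) tri_cat"
    and T M U X :: 'o
  assumes "k_linear_triangulated_category D"
    and "krull_schmidt D"
    and "hom_finite D"
    and "cluster_tilting D T"
    and "\<exists>S Sm. serre_functor D S Sm"
    and "is_direct_sum D [U, X] M"
    and "basic D M"
    and "rel_cluster_tilting D T M"
    and "indecomposable D X"
  shows "(X \<in> rel_star D T U \<longrightarrow>
           (\<forall>Y U1 g f h. triangle D Y U1 X g f h \<and> minimal_right_approx D U U1 X f \<longrightarrow>
              is_complement D T U Y \<and> \<not> isomorphic D Y X \<and>
              (\<forall>N. is_direct_sum D [U, Y] N \<longrightarrow> rel_gt D T N M))) \<and>
         (X \<notin> rel_star D T U \<longrightarrow>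
           (\<forall>Y U2 g f h. triangle D X U2 Y g f h \<and> minimal_left_approx D U X U2 g \<longrightarrow>
              is_complement D T U Y \<and> \<not> isomorphic D Y X \<and>
              (\<forall>N. is_direct_sum D [U, Y] N \<longrightarrow> rel_gt D T M N)))"
proof -
  interpret k_linear_triangulated_category D by (rule assms(1))
  interpret cluster_tilted_category D T by unfold_locales (rule assms)+
  have rigid: "orth M M" using assms(8) rel_rigid_iff unfolding rel_cluster_tilting_def by blast
  have add: "U \<in> add_closure D M" "X \<in> add_closure D M" using add_closure_summand[OF assms(6)] by auto
  have UU: "orth U U" by (rule orth_of_direct_sum[OF rigid assms(6)])
  have XM: "orth X M" "orth M X" using orth_left[OF rigid add(2)] orth_right[OF rigid add(2)] by auto
  have XU: "X \<notin> add_closure D U" using basic_direct_sum_iff[OF assms(6,9)] assms(7) by blast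
  note complement = exchange_complement[OF assms(6,7,8,9)]
  show ?thesis
  proof (intro conjI impI allI; elim conjE)
    fix Y U1 g f h
    assume star: "X \<in> rel_star D T U" and tri: "triangle D Y U1 X g f h"
      and min: "minimal_right_approx D U U1 X f"
    have f: "right_approx D U U1 X f" and
      minimal: "\<And>\<phi>. \<phi> \<in> hom D U1 U1 \<Longrightarrow> f \<odot>\<^bsub>D\<^esub> \<phi> = f \<Longrightarrow> is_iso D U1 U1 \<phi>"
      using min unfolding minimal_right_approx_def by auto
    have h: "h \<in> ghost X (shift D Y)" by (rule ghost_of_rel_star[OF star f tri])
    have Y: "indecomposable D Y" by (rule left_exchange_indecomposable[OF tri h f assms(9) XM(1) add(1) XU minimal])
    have YM: "Y \<notin> add_closure D M" by (rule left_exchange_not_in_add_closure[OF tri h f XM(1) XU])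
    have UY: "orth U Y" by (rule left_exchange_orth_right[OF tri h f UU])
    \<comment> \<open>\<open>left_exchange_orth_left\<close> is used twice, with \<open>U\<close>
      and with \<open>Y\<close> in the place of \<open>E\<close>; the second use needs
      \<open>UY\<close>, which is why that fact is derived first.\<close>
    note c = complement[OF Y YM UY left_exchange_orth_left[OF tri h f UU] left_exchange_orth_left[OF tri h f UY]]
    show "is_complement D T U Y" "\<not> isomorphic D Y X" by (rule c)+
    fix N assume N: "is_direct_sum D [U, Y] N"
    show "rel_gt D T N M" unfolding rel_gt_def using rel_ge_direct_sum[OF assms(6) N star] c(3)[OF N] by blast
  next
    fix Y U2 g f h
    assume star: "X \<notin> rel_star D T U" and tri: "triangle D X U2 Y g f h"
      and min: "minimal_left_approx D U X U2 g"
    have g: "left_approx D U X U2 g" and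
      minimal: "\<And>\<phi>. \<phi> \<in> hom D U2 U2 \<Longrightarrow> \<phi> \<odot>\<^bsub>D\<^esub> g = g \<Longrightarrow> is_iso D U2 U2 \<phi>"
      using min unfolding minimal_left_approx_def by auto
    obtain S Sm where S: "serre_functor D S Sm" using assms(5) by blast
    have h: "h \<in> ghost Y (shift D X)" by (rule ghost_of_not_rel_star[OF S assms(6,8,9) star tri g])
    have Y: "indecomposable D Y" by (rule right_exchange_indecomposable[OF tri h g assms(9) XM(2) add(1) XU minimal])
    have YM: "Y \<notin> add_closure D M" by (rule right_exchange_not_in_add_closure[OF tri h g XM(2) XU])
    have YU: "orth Y U" by (rule right_exchange_orth_left[OF tri h g UU])
    note c = complement[OF Y YM right_exchange_orth_right[OF tri h g UU] YU right_exchange_orth_right[OF tri h g YU]]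
    show "is_complement D T U Y" "\<not> isomorphic D Y X" by (rule c)+
    fix N assume N: "is_direct_sum D [U, Y] N"
    have "U2 \<in> add_closure D U" using g unfolding left_approx_def by blast
    then have "Y \<in> rel_star D T U" using ghost_triangle_rel_star[OF tri _ h] by blast
    then show "rel_gt D T M N" unfolding rel_gt_def
      using rel_ge_direct_sum[OF N assms(6)] c(3)[OF N] isomorphic_sym by blast
  qed
qed

end
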